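(* If $S_{\boldsymbol\lambda}\in\boldsymbol B(\ell^2(V))$ is a weighted shift on a directed tree $\mathcal T=(V,E)$ with weights $\boldsymbol\lambda=\{\lambda_v\}_{v\in V^\circ}$, then the following conditions are equivalent: (i) $S_{\boldsymbol\lambda}$ is subnormal; (ii) $\big\{\sum_{v\in\operatorname{Chi}^{\langle n\rangle}(u)}|\lambda_{u\mid v}|^2\big\}_{n=0}^\infty$ is a Stieltjes moment sequence for every $u\in V$; (iii) $\{\|S_{\boldsymbol\lambda}^ne_u\|^2\}_{n=0}^\infty$ is a Stieltjes moment sequence for every $u\in V$; (iv) $\{\|S_{\boldsymbol\lambda}^ne_u\|^2\}_{n=0}^\infty$ is a Hamburger moment sequence for every $u\in V$; (v) $\sum_{k,l=0}^n\|S_{\boldsymbol\lambda}^{k+l}e_u\|^2\alpha_k\overline{\alpha_l}\ge0$ for all $\alpha_0,\dots,\alpha_n\in\mathbb C$, $n\in\{0,1,2,\dots\}$ and $u\in V$.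
   Context: A directed tree $\mathcal T=(V,E)$ consists of a nonempty set $V$ (of arbitrary cardinality) of vertices and a set $E\subseteq V\times V\setminus\{(v,v):v\in V\}$ of edges such that: (1) any two distinct vertices $u,v$ are joined by an undirected path, i.e. there are $v_1=u,\dots,v_n=v$ in $V$ ($n\ge 2$) with $(v_j,v_{j+1})\in E$ or $(v_{j+1},v_j)\in E$ for each $j<n$; (2) there is no circuit, i.e. no finite sequence of distinct vertices $u_1,\dots,u_n$ ($n\ge2$) with $(u_j,u_{j+1})\in E$ for $j<n$ and $(u_n,u_1)\in E$; (3) every vertex $v$ that is not a root has a unique vertex $\operatorname{par}(v)$ (its parent) with $(\operatorname{par}(v),v)\in E$; a root is a vertex $v$ for which there is no $u$ with $(u,v)\in E$. A directed tree has at most one root, denoted $\mathrm{root}$ when it exists. $V^\circ$ is $V$ with the root removed (and $V^\circ=V$ if $\mathcal T$ has no root). $\operatorname{Chi}(u)=\{v\in V:(u,v)\in E\}$; $\operatorname{Chi}^{\langle0\rangle}(u)=\{u\}$ and $\operatorname{Chi}^{\langle n+1\rangle}(u)=\bigcup_{v\in\operatorname{Chi}^{\langle n\rangle}(u)}\operatorname{Chi}(v)$ (these sets are pairwise disjoint in $n$). $\operatorname{par}^j$ is the $j$-fold composition of $\operatorname{par}$, $\operatorname{par}^0$ being the identity. $\ell^2(V)$ is the Hilbert space of square summable complex functions on $V$, with orthonormal basis $\{e_u\}_{u\in V}$, $e_u$ being the indicator function of $\{u\}$. For $\boldsymbol\lambda=\{\lambda_v\}_{v\in V^\circ}\subseteq\mathbb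 C$ and $f\colon V\to\mathbb C$ put $(\Lambda f)(v)=\lambda_v f(\operatorname{par}(v))$ for $v\in V^\circ$ and $(\Lambda f)(\mathrm{root})=0$. The weighted shift $S_{\boldsymbol\lambda}$ is the operator in $\ell^2(V)$ with domain $\{f\in\ell^2(V):\Lambda f\in\ell^2(V)\}$ and $S_{\boldsymbol\lambda}f=\Lambda f$. $\boldsymbol B(\mathcal H)$ denotes the bounded operators on $\mathcal H$ with domain $\mathcal H$. For $u\in V$ put $\lambda_{u\mid u}=1$ and $\lambda_{u\mid v}=\prod_{j=0}^{n-1}\lambda_{\operatorname{par}^j(v)}$ if $v\in\operatorname{Chi}^{\langle n\rangle}(u)$, $n\ge1$. $A\in\boldsymbol B(\mathcal H)$ is subnormal if there are a complex Hilbert space $\mathcal K\supseteq\mathcal H$ (isometric embedding) and a normal $N\in\boldsymbol B(\mathcal K)$ with $Ah=Nh$ for all $h\in\mathcal H$. A real sequence $\{t_n\}_{n=0}^\infty$ is a Hamburger moment sequence if there is a positive Borel measure $\mu$ on $\mathbb R$ with $t_n=\int_{\mathbb R}s^n\,d\mu(s)$ for all $n\ge0$; it is a Stieltjes moment sequence if $\mu$ can be chosen concentrated on $[0,\infty)$. *)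

theory Defs
  imports "HOL-Analysis.Analysis"
begin

text \<open>The libraries only offer real inner product spaces. Moreover, subnormality quantifies
  existentially over Hilbert spaces, so these have to be terms rather than types. Inner products
  are linear in the first argument.\<close>

record 'a hspace =
  hcarrier :: "'a set"
  hzero :: 'a
  hadd :: "'a \<Rightarrow> 'a \<Rightarrow> 'a"
  hscale :: "complex \<Rightarrow> 'a \<Rightarrow> 'a"
  hinner :: "'a \<Rightarrow> 'a \<Rightarrow> complex"

definition hdiff :: "'a hspace \<Rightarrow> 'a \<Rightarrow> 'a \<Rightarrow> 'a" where
  "hdiff H x y = hadd H x (hscale H (- 1) y)"

definition hnorm :: "'a hspace \<Rightarrow> 'a \<Rightarrow> real" where
  "hnorm H x = sqrt (Re (hinner H x x))"

locale complex_hilbert_space =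
  fixes H :: "'a hspace"
  assumes zero_closed: "hzero H \<in> hcarrier H"
    and add_closed: "\<lbrakk>x \<in> hcarrier H; y \<in> hcarrier H\<rbrakk> \<Longrightarrow> hadd H x y \<in> hcarrier H"
    and scale_closed: "x \<in> hcarrier H \<Longrightarrow> hscale H c x \<in> hcarrier H"
    and add_assoc: "\<lbrakk>x \<in> hcarrier H; y \<in> hcarrier H; z \<in> hcarrier H\<rbrakk>
          \<Longrightarrow> hadd H (hadd H x y) z = hadd H x (hadd H y z)"
    and add_commute: "\<lbrakk>x \<in> hcarrier H; y \<in> hcarrier H\<rbrakk> \<Longrightarrow> hadd H x y = hadd H y x"
    and add_zero: "x \<in> hcarrier H \<Longrightarrow> hadd H x (hzero H) = x"
    and add_minus: "x \<in> hcarrier H \<Longrightarrow> hadd H x (hscale H (- 1) x) = hzero H"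
    and scale_scale: "x \<in> hcarrier H \<Longrightarrow> hscale H c (hscale H d x) = hscale H (c * d) x"
    and scale_one: "x \<in> hcarrier H \<Longrightarrow> hscale H 1 x = x"
    and scale_add_right: "\<lbrakk>x \<in> hcarrier H; y \<in> hcarrier H\<rbrakk>
          \<Longrightarrow> hscale H c (hadd H x y) = hadd H (hscale H c x) (hscale H c y)"
    and scale_add_left: "x \<in> hcarrier H
          \<Longrightarrow> hscale H (c + d) x = hadd H (hscale H c x) (hscale H d x)"
    and inner_add: "\<lbrakk>x \<in> hcarrier H; y \<in> hcarrier H; z \<in> hcarrier H\<rbrakk>
          \<Longrightarrow> hinner H (hadd H x y) z = hinner H x z + hinner H y z"
    and inner_scale: "\<lbrakk>x \<in> hcarrier H; y \<in> hcarrier H\<rbrakk>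
          \<Longrightarrow> hinner H (hscale H c x) y = c * hinner H x y"
    and inner_commute: "\<lbrakk>x \<in> hcarrier H; y \<in> hcarrier H\<rbrakk>
          \<Longrightarrow> hinner H x y = cnj (hinner H y x)"
    and inner_nonneg: "x \<in> hcarrier H \<Longrightarrow> 0 \<le> Re (hinner H x x)"
    and inner_definite: "\<lbrakk>x \<in> hcarrier H; hinner H x x = 0\<rbrakk> \<Longrightarrow> x = hzero H"
    and complete: "\<And>s :: nat \<Rightarrow> 'a. \<lbrakk>\<And>n. s n \<in> hcarrier H;
            \<And>e :: real. 0 < e \<Longrightarrow> \<exists>M. \<forall>m\<ge>M. \<forall>n\<ge>M. hnorm H (hdiff H (s m) (s n)) < e\<rbrakk>
          \<Longrightarrow> \<exists>x\<in>hcarrier H. (\<lambda>n. hnorm H (hdiff H (s n) x)) \<longlonglongrightarrow> 0"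

definition linear_map :: "'a hspace \<Rightarrow> 'b hspace \<Rightarrow> ('a \<Rightarrow> 'b) \<Rightarrow> bool" where
  "linear_map H K T \<longleftrightarrow>
     (\<forall>x\<in>hcarrier H. T x \<in> hcarrier K) \<and>
     (\<forall>x\<in>hcarrier H. \<forall>y\<in>hcarrier H. T (hadd H x y) = hadd K (T x) (T y)) \<and>
     (\<forall>c. \<forall>x\<in>hcarrier H. T (hscale H c x) = hscale K c (T x))"

definition isometric_embedding :: "'a hspace \<Rightarrow> 'b hspace \<Rightarrow> ('a \<Rightarrow> 'b) \<Rightarrow> bool" where
  "isometric_embedding H K J \<longleftrightarrow> linear_map H K J \<and>
     (\<forall>x\<in>hcarrier H. \<forall>y\<in>hcarrier H. hinner K (J x) (J y) = hinner H x y)"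

definition bounded_op :: "'a hspace \<Rightarrow> ('a \<Rightarrow> 'a) \<Rightarrow> bool" where
  "bounded_op H A \<longleftrightarrow> linear_map H H A \<and>
     (\<exists>C. \<forall>x\<in>hcarrier H. hnorm H (A x) \<le> C * hnorm H x)"

text \<open>For a bounded operator \<open>A\<close> on a Hilbert space such a map \<open>B\<close> is unique on the carrier and
  automatically linear and bounded.\<close>

definition is_adjoint :: "'a hspace \<Rightarrow> ('a \<Rightarrow> 'a) \<Rightarrow> ('a \<Rightarrow> 'a) \<Rightarrow> bool" where
  "is_adjoint H A B \<longleftrightarrow> (\<forall>x\<in>hcarrier H. B x \<in> hcarrier H) \<and>
     (\<forall>x\<in>hcarrier H. \<forall>y\<in>hcarrier H. hinner H (A x) y = hinner H x (B y))"

definition normal_op :: "'a hspace \<Rightarrow> ('a \<Rightarrow> 'a) \<Rightarrow> bool" where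
  "normal_op H N \<longleftrightarrow> bounded_op H N \<and>
     (\<exists>B. is_adjoint H N B \<and> (\<forall>x\<in>hcarrier H. N (B x) = B (N x)))"

definition normal_extension ::
  "'a hspace \<Rightarrow> ('a \<Rightarrow> 'a) \<Rightarrow> 'b hspace \<Rightarrow> ('b \<Rightarrow> 'b) \<Rightarrow> ('a \<Rightarrow> 'b) \<Rightarrow> bool" where
  "normal_extension H A K N J \<longleftrightarrow>
     complex_hilbert_space K \<and> isometric_embedding H K J \<and> normal_op K N \<and>
     (\<forall>h\<in>hcarrier H. J (A h) = N (J h))"

text \<open>HOL cannot quantify over the type of the elements of \<open>K\<close> inside a formula; the type below
  is large enough, i.e. a normal extension on a Hilbert space with elements of an arbitrary type
  yields one of this form. This is proved at the end of this theory (theorem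
  \<open>subnormal_if_normal_extension\<close>).\<close>

definition subnormal :: "'a hspace \<Rightarrow> ('a \<Rightarrow> 'a) \<Rightarrow> bool" where
  "subnormal H A \<longleftrightarrow> bounded_op H A \<and>
     (\<exists>(K :: ('a \<times> nat \<Rightarrow> complex) hspace) N J. normal_extension H A K N J)"

definition is_root :: "'v set \<Rightarrow> ('v \<times> 'v) set \<Rightarrow> 'v \<Rightarrow> bool" where
  "is_root V E v \<longleftrightarrow> v \<in> V \<and> (\<nexists>u. (u, v) \<in> E)"

definition circuit :: "('v \<times> 'v) set \<Rightarrow> 'v list \<Rightarrow> bool" where
  "circuit E us \<longleftrightarrow> 2 \<le> length us \<and> distinct us \<and>
     (\<forall>j. Suc j < length us \<longrightarrow> (us ! j, us ! Suc j) \<in> E) \<and> (last us, hd us) \<in> E"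

definition directed_tree :: "'v set \<Rightarrow> ('v \<times> 'v) set \<Rightarrow> bool" where
  "directed_tree V E \<longleftrightarrow> V \<noteq> {} \<and> E \<subseteq> V \<times> V - Id \<and>
     (\<forall>u\<in>V. \<forall>v\<in>V. u \<noteq> v \<longrightarrow> (u, v) \<in> (E \<union> E\<inverse>)\<^sup>+) \<and>
     (\<nexists>us. circuit E us) \<and>
     (\<forall>v\<in>V. \<not> is_root V E v \<longrightarrow> (\<exists>!u. (u, v) \<in> E))"

definition nonroots :: "'v set \<Rightarrow> ('v \<times> 'v) set \<Rightarrow> 'v set" where
  "nonroots V E = {v \<in> V. \<not> is_root V E v}"

definition parent :: "('v \<times> 'v) set \<Rightarrow> 'v \<Rightarrow> 'v" where
  "parent E v = (THE u. (u, v) \<in> E)"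

definition chi :: "('v \<times> 'v) set \<Rightarrow> 'v \<Rightarrow> 'v set" where
  "chi E u = {v. (u, v) \<in> E}"

primrec chi_pow :: "('v \<times> 'v) set \<Rightarrow> nat \<Rightarrow> 'v \<Rightarrow> 'v set" where
  "chi_pow E 0 u = {u}"
| "chi_pow E (Suc n) u = (\<Union>v\<in>chi_pow E n u. chi E v)"

text \<open>\<open>\<lambda>\<^bsub>u|v\<^esub>\<close> for \<open>v\<close> a descendant of \<open>u\<close>. The generation \<open>n\<close> of \<open>v\<close> relative to \<open>u\<close> is unique in
  a directed tree; for \<open>v = u\<close> it is 0 and the product is empty. The sums of \<open>|\<lambda>\<^bsub>u|v\<^esub>|\<^sup>2\<close> over a generation may be
  infinite but converge whenever the weighted shift is bounded on \<open>\<ell>\<^sup>2(V)\<close>, so the value 0 of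
  divergent sums never occurs.\<close>

definition path_weight :: "('v \<times> 'v) set \<Rightarrow> ('v \<Rightarrow> complex) \<Rightarrow> 'v \<Rightarrow> 'v \<Rightarrow> complex" where
  "path_weight E w u v =
     (let n = (THE n. v \<in> chi_pow E n u) in \<Prod>j<n. w ((parent E ^^ j) v))"

text \<open>Functions on \<open>V\<close> are represented by functions on the whole type that vanish outside \<open>V\<close>.\<close>

definition ell2 :: "'v set \<Rightarrow> ('v \<Rightarrow> complex) hspace" where
  "ell2 V =
     \<lparr> hcarrier = {f. (\<forall>v. v \<notin> V \<longrightarrow> f v = 0) \<and> (\<lambda>v. (cmod (f v))\<^sup>2) summable_on V},
       hzero = (\<lambda>v. 0),
       hadd = (\<lambda>f g v. f v + g v),
       hscale = (\<lambda>c f v. c * f v),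
       hinner = (\<lambda>f g. \<Sum>\<^sub>\<infinity>v\<in>V. f v * cnj (g v)) \<rparr>"

definition basis_vec :: "'v \<Rightarrow> 'v \<Rightarrow> complex" where
  "basis_vec u = indicator {u}"

text \<open>The weight of the root, if there is one, is irrelevant.\<close>

definition wshift ::
  "'v set \<Rightarrow> ('v \<times> 'v) set \<Rightarrow> ('v \<Rightarrow> complex) \<Rightarrow> ('v \<Rightarrow> complex) \<Rightarrow> 'v \<Rightarrow> complex" where
  "wshift V E w f v = (if v \<in> nonroots V E then w v * f (parent E v) else 0)"

definition wshift_dom ::
  "'v set \<Rightarrow> ('v \<times> 'v) set \<Rightarrow> ('v \<Rightarrow> complex) \<Rightarrow> ('v \<Rightarrow> complex) set" where
  "wshift_dom V E w = {f \<in> hcarrier (ell2 V). wshift V E w f \<in> hcarrier (ell2 V)}"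

definition represents_moments :: "real measure \<Rightarrow> (nat \<Rightarrow> real) \<Rightarrow> bool" where
  "represents_moments M t \<longleftrightarrow> sets M = sets borel \<and>
     (\<forall>n. integrable M (\<lambda>s. s ^ n) \<and> t n = (LINT s|M. s ^ n))"

definition hamburger_moment_seq :: "(nat \<Rightarrow> real) \<Rightarrow> bool" where
  "hamburger_moment_seq t \<longleftrightarrow> (\<exists>M. represents_moments M t)"

definition stieltjes_moment_seq :: "(nat \<Rightarrow> real) \<Rightarrow> bool" where
  "stieltjes_moment_seq t \<longleftrightarrow> (\<exists>M. represents_moments M t \<and> emeasure M {..<0} = 0)"

context complex_hilbert_space
begin

lemma inner_add_right:
  "\<lbrakk>x \<in> hcarrier H; y \<in> hcarrier H; z \<in> hcarrier H\<rbrakk>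
    \<Longrightarrow> hinner H z (hadd H x y) = hinner H z x + hinner H z y"
  by (metis add_closed complex_cnj_add inner_add inner_commute)

lemma inner_scale_right:
  "\<lbrakk>x \<in> hcarrier H; y \<in> hcarrier H\<rbrakk> \<Longrightarrow> hinner H y (hscale H c x) = cnj c * hinner H y x"
  by (metis complex_cnj_mult inner_commute inner_scale scale_closed)

lemma diff_closed: "\<lbrakk>x \<in> hcarrier H; y \<in> hcarrier H\<rbrakk> \<Longrightarrow> hdiff H x y \<in> hcarrier H"
  by (simp add: hdiff_def add_closed scale_closed)

lemma inner_diff_left:
  "\<lbrakk>x \<in> hcarrier H; y \<in> hcarrier H; z \<in> hcarrier H\<rbrakk>
    \<Longrightarrow> hinner H (hdiff H x y) z = hinner H x z - hinner H y z"
  by (simp add: hdiff_def inner_add inner_scale scale_closed)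

lemma inner_zero_left: "x \<in> hcarrier H \<Longrightarrow> hinner H (hzero H) x = 0"
  by (metis add_zero add_cancel_left_right inner_add zero_closed)

lemma inner_self: "x \<in> hcarrier H \<Longrightarrow> hinner H x x = complex_of_real ((hnorm H x)\<^sup>2)"
proof -
  assume x: "x \<in> hcarrier H"
  have "Im (hinner H x x) = 0"
    using arg_cong[OF inner_commute[OF x x], of Im] by simp
  then show ?thesis
    using inner_nonneg[OF x] by (simp add: hnorm_def complex_eq_iff)
qed

lemma eq_if_diff_zero:
  assumes "x \<in> hcarrier H" "y \<in> hcarrier H" "hdiff H x y = hzero H"
  shows "x = y"
proof -
  let ?m = "hscale H (- 1) y"
  have m: "?m \<in> hcarrier H" using assms scale_closed by blast
  have "hadd H ?m y = hzero H" using add_minus[OF assms(2)] add_commute[OF m assms(2)] by simp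
  then have "x = hadd H x (hadd H ?m y)" using add_zero assms(1) by simp
  also have "\<dots> = hadd H (hadd H x ?m) y" using add_assoc assms m by simp
  also have "\<dots> = hadd H (hzero H) y" using assms(3) by (simp add: hdiff_def)
  also have "\<dots> = y" using add_zero add_commute zero_closed assms(2) by metis
  finally show ?thesis .
qed

lemma cauchy_schwarz:
  assumes x: "x \<in> hcarrier H" and y: "y \<in> hcarrier H"
  shows "cmod (hinner H x y) \<le> hnorm H x * hnorm H y"
proof (cases "hinner H y y = 0")
  case True
  then have "y = hzero H" using inner_definite y by blast
  then have "hinner H x y = 0" using inner_zero_left[OF x] inner_commute[OF x y] by simp
  then show ?thesis using inner_nonneg x y by (simp add: hnorm_def)
next
  case False
  define b where "b = (hnorm H y)\<^sup>2"
  define c where "c = hinner H x y"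
  have yy: "hinner H y y = complex_of_real b" using inner_self[OF y] by (simp add: b_def)
  then have "b \<noteq> 0" using False by auto
  then have b: "b > 0" by (simp add: b_def)
  define z where "z = hadd H x (hscale H (- (c / b)) y)"
  have sy: "hscale H (- (c / b)) y \<in> hcarrier H" using y scale_closed by blast
  have z: "z \<in> hcarrier H" using x sy add_closed by (simp add: z_def)
  have yx: "hinner H y x = cnj c" using inner_commute[OF y x] by (simp add: c_def)
  have zy: "hinner H z y = 0"
    using b by (simp add: z_def inner_add x y sy inner_scale yy flip: c_def)
  have "hinner H z z = hinner H z x"
    using x y z sy zy by (subst (2) z_def) (simp add: inner_add_right inner_scale_right)
  also have "\<dots> = hinner H x x - c * cnj c / b"
    using x y sy by (simp add: z_def inner_add inner_scale yx)
  also have "\<dots> = complex_of_real ((hnorm H x)\<^sup>2 - (cmod c)\<^sup>2 / b)"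
    using inner_self[OF x] by (simp add: complex_mult_cnj cmod_def)
  finally have "0 \<le> (hnorm H x)\<^sup>2 - (cmod c)\<^sup>2 / b" using inner_nonneg[OF z] by simp
  then have "(cmod c)\<^sup>2 \<le> (hnorm H x)\<^sup>2 * b" using b by (simp add: field_simps)
  then have "(cmod c)\<^sup>2 \<le> (hnorm H x * hnorm H y)\<^sup>2" by (simp add: b_def power_mult_distrib)
  moreover have "0 \<le> hnorm H x * hnorm H y" using inner_nonneg x y by (simp add: hnorm_def)
  ultimately show ?thesis unfolding c_def by (rule power2_le_imp_le)
qed

lemma orthogonal_limit:
  assumes s: "\<And>n. s n \<in> hcarrier H" and x: "x \<in> hcarrier H" and y: "y \<in> hcarrier H"
    and lim: "(\<lambda>n. hnorm H (hdiff H (s n) x)) \<longlonglongrightarrow> 0"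
    and orth: "\<And>n. hinner H (s n) y = 0"
  shows "hinner H x y = 0"
proof -
  have "cmod (hinner H x y) \<le> hnorm H (hdiff H (s n) x) * hnorm H y" for n
    using cauchy_schwarz[OF diff_closed[OF s x] y, of n]
    by (simp add: inner_diff_left s x y orth)
  moreover have "(\<lambda>n. hnorm H (hdiff H (s n) x) * hnorm H y) \<longlonglongrightarrow> 0 * hnorm H y"
    by (intro tendsto_mult lim tendsto_const)
  ultimately have "cmod (hinner H x y) \<le> 0 * hnorm H y"
    by (intro LIMSEQ_le_const) auto
  then show ?thesis by simp
qed

lemma orthogonal_complement_hilbert:
  assumes Q: "Q \<subseteq> hcarrier H"
  shows "complex_hilbert_space (H\<lparr>hcarrier := {x \<in> hcarrier H. \<forall>y\<in>Q. hinner H x y = 0}\<rparr>)"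
proof -
  define C where "C = {x \<in> hcarrier H. \<forall>y\<in>Q. hinner H x y = 0}"
  have sub: "x \<in> hcarrier H" if "x \<in> C" for x using that by (simp add: C_def)
  have nrm: "hnorm (H\<lparr>hcarrier := C\<rparr>) = hnorm H" and dif: "hdiff (H\<lparr>hcarrier := C\<rparr>) = hdiff H"
    by (auto simp: hnorm_def hdiff_def fun_eq_iff)
  have "complex_hilbert_space (H\<lparr>hcarrier := C\<rparr>)"
  proof (unfold_locales, goal_cases)
    case 1
    then show ?case using Q by (auto simp: C_def zero_closed inner_zero_left)
  next
    case (2 x y)
    then show ?case using Q by (auto simp: C_def add_closed inner_add subset_iff)
  next
    case (3 x c)
    then show ?case using Q by (auto simp: C_def scale_closed inner_scale subset_iff)
  next
    case (17 s)
    have sC: "s n \<in> C" for n using 17(1) by simp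
    have "\<exists>x\<in>hcarrier H. (\<lambda>n. hnorm H (hdiff H (s n) x)) \<longlonglongrightarrow> 0"
      using 17(2) sub[OF sC] by (intro complete) (simp_all add: nrm dif)
    then obtain x where x: "x \<in> hcarrier H" "(\<lambda>n. hnorm H (hdiff H (s n) x)) \<longlonglongrightarrow> 0" by blast
    have "hinner H x y = 0" if "y \<in> Q" for y
      using that Q sC by (intro orthogonal_limit[OF sub[OF sC] x(1) _ x(2)]) (auto simp: C_def)
    then have "x \<in> C" using x(1) by (simp add: C_def)
    then show ?case using x(2) by (auto simp: nrm dif)
  qed (use sub in \<open>auto intro: add_assoc add_commute add_zero add_minus scale_scale scale_one
      scale_add_right scale_add_left inner_add inner_scale inner_commute inner_nonneg
      inner_definite\<close>)
  then show ?thesis by (simp add: C_def)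
qed

end

definition transport :: "('a \<Rightarrow> 'b) \<Rightarrow> 'a hspace \<Rightarrow> 'b hspace" where
  "transport T H = (let U = inv_into (hcarrier H) T in
     \<lparr> hcarrier = T ` hcarrier H,
       hzero = T (hzero H),
       hadd = (\<lambda>x y. T (hadd H (U x) (U y))),
       hscale = (\<lambda>c x. T (hscale H c (U x))),
       hinner = (\<lambda>x y. hinner H (U x) (U y)) \<rparr>)"

lemma transport_simps:
  assumes "inj_on T (hcarrier H)"
  shows "hcarrier (transport T H) = T ` hcarrier H"
    and "hzero (transport T H) = T (hzero H)"
    and "\<lbrakk>x \<in> hcarrier H; y \<in> hcarrier H\<rbrakk> \<Longrightarrow> hadd (transport T H) (T x) (T y) = T (hadd H x y)"
    and "x \<in> hcarrier H \<Longrightarrow> hscale (transport T H) c (T x) = T (hscale H c x)"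
    and "\<lbrakk>x \<in> hcarrier H; y \<in> hcarrier H\<rbrakk> \<Longrightarrow> hinner (transport T H) (T x) (T y) = hinner H x y"
    and "x \<in> hcarrier H \<Longrightarrow> hnorm (transport T H) (T x) = hnorm H x"
  using assms by (simp_all add: transport_def Let_def hnorm_def)

lemma (in complex_hilbert_space) transport_hilbert:
  assumes inj: "inj_on T (hcarrier H)"
  shows "complex_hilbert_space (transport T H)"
proof -
  note ts = transport_simps[OF inj]
  have dif: "hnorm (transport T H) (hdiff (transport T H) (T x) (T y)) = hnorm H (hdiff H x y)"
    if "x \<in> hcarrier H" "y \<in> hcarrier H" for x y
    using that by (simp add: hdiff_def ts scale_closed add_closed)
  show ?thesis
  proof (unfold_locales, goal_cases)
    case (5 x y)
    then obtain x' y' where "x = T x'" "y = T y'" "x' \<in> hcarrier H" "y' \<in> hcarrier H"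
      by (auto simp: ts)
    then show ?case using add_commute[of x' y'] by (simp add: ts)
  next
    case (14 x y)
    then show ?case by (auto simp: ts intro: inner_commute)
  next
    case (16 x)
    then show ?case using inner_definite by (auto simp: ts)
  next
    case (17 s)
    have "\<exists>r. r \<in> hcarrier H \<and> s n = T r" for n using 17(1)[of n] unfolding ts by blast
    then obtain r where r: "\<And>n. r n \<in> hcarrier H" "\<And>n. s n = T (r n)" by metis
    have "\<exists>x\<in>hcarrier H. (\<lambda>n. hnorm H (hdiff H (r n) x)) \<longlonglongrightarrow> 0"
      using 17(2) r by (intro complete) (simp_all add: dif)
    then show ?case using r by (auto simp: ts dif)
  qed (auto simp: ts zero_closed add_closed scale_closed add_assoc add_zero add_minus
      scale_scale scale_one scale_add_right scale_add_left inner_add inner_scale inner_nonneg)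
qed

lemma normal_extension_transport:
  assumes ext: "normal_extension H A K N J" and inj: "inj_on T (hcarrier K)"
  shows "normal_extension H A (transport T K) (\<lambda>x. T (N (inv_into (hcarrier K) T x))) (\<lambda>h. T (J h))"
proof -
  note ts = transport_simps[OF inj]
  interpret K: complex_hilbert_space K using ext by (simp add: normal_extension_def)
  have J: "isometric_embedding H K J" and JA: "\<forall>h\<in>hcarrier H. J (A h) = N (J h)"
    and nN: "normal_op K N"
    using ext by (auto simp: normal_extension_def)
  have Jc: "J h \<in> hcarrier K" if "h \<in> hcarrier H" for h
    using J that by (simp add: isometric_embedding_def linear_map_def)
  obtain B where B: "is_adjoint K N B" "\<forall>x\<in>hcarrier K. N (B x) = B (N x)"
    using nN by (auto simp: normal_op_def)
  have Bc: "B x \<in> hcarrier K" if "x \<in> hcarrier K" for x using B(1) that by (simp add: is_adjoint_def)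
  have Nb: "bounded_op K N" using nN by (simp add: normal_op_def)
  then have Nc: "N x \<in> hcarrier K" if "x \<in> hcarrier K" for x
    using that by (simp add: bounded_op_def linear_map_def)
  let ?N = "\<lambda>x. T (N (inv_into (hcarrier K) T x))" and ?B = "\<lambda>x. T (B (inv_into (hcarrier K) T x))"
  have "isometric_embedding H (transport T K) (\<lambda>h. T (J h))"
    using J by (auto simp: isometric_embedding_def linear_map_def ts)
  moreover have "bounded_op (transport T K) ?N"
    using Nb by (auto simp: bounded_op_def linear_map_def ts inj K.add_closed K.scale_closed)
  moreover have "is_adjoint (transport T K) ?N ?B"
    using B(1) Nc Bc by (auto simp: is_adjoint_def ts inj)
  moreover have "\<forall>x\<in>hcarrier (transport T K). ?N (?B x) = ?B (?N x)"
    using B(2) Nc Bc by (auto simp: ts inj)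
  ultimately show ?thesis
    using K.transport_hilbert[OF inj] JA Jc inj by (auto simp: normal_extension_def normal_op_def)
qed

theorem subnormal_if_normal_extension:
  fixes H :: "'a hspace" and K :: "'k hspace"
  assumes A: "bounded_op H A" and ext: "normal_extension H A K N J"
  shows "subnormal H A"
proof -
  interpret K: complex_hilbert_space K using ext by (simp add: normal_extension_def)
  have J: "isometric_embedding H K J" and JA: "\<forall>h\<in>hcarrier H. J (A h) = N (J h)"
    and nN: "normal_op K N"
    using ext by (auto simp: normal_extension_def)
  have Jc: "J h \<in> hcarrier K" if "h \<in> hcarrier H" for h
    using J that by (simp add: isometric_embedding_def linear_map_def)
  have Ac: "A h \<in> hcarrier H" if "h \<in> hcarrier H" for h
    using A that by (simp add: bounded_op_def linear_map_def)
  obtain B where B: "is_adjoint K N B" "\<forall>x\<in>hcarrier K. N (B x) = B (N x)"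
    using nN by (auto simp: normal_op_def)
  have Bc: "B x \<in> hcarrier K" if "x \<in> hcarrier K" for x using B(1) that by (simp add: is_adjoint_def)
  have NB: "hinner K (N x) y = hinner K x (B y)" if "x \<in> hcarrier K" "y \<in> hcarrier K" for x y
    using B(1) that by (simp add: is_adjoint_def)
  have Nb: "bounded_op K N" using nN by (simp add: normal_op_def)
  then have Nc: "N x \<in> hcarrier K" if "x \<in> hcarrier K" for x
    using that by (simp add: bounded_op_def linear_map_def)
  have BN: "hinner K (B x) y = hinner K x (N y)" if "x \<in> hcarrier K" "y \<in> hcarrier K" for x y
    by (metis NB K.inner_commute that Bc Nc)
  have Bpc: "(B ^^ n) x \<in> hcarrier K" if "x \<in> hcarrier K" for n x
    using that by (induction n) (auto simp: Bc)
  have NBp: "N ((B ^^ n) x) = (B ^^ n) (N x)" if "x \<in> hcarrier K" for n x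
    using that B(2) by (induction n) (auto simp: Bpc)
  define P where "P = {(B ^^ n) (J h) | n h. h \<in> hcarrier H}"
  define Q where "Q = {y \<in> hcarrier K. \<forall>p\<in>P. hinner K y p = 0}"
  define C where "C = {x \<in> hcarrier K. \<forall>y\<in>Q. hinner K x y = 0}"
  define L where "L = K\<lparr>hcarrier := C\<rparr>"
  have P: "P \<subseteq> hcarrier K" by (auto simp: P_def Bpc Jc)
  have Qc: "Q \<subseteq> hcarrier K" by (auto simp: Q_def)
  have Cc: "x \<in> hcarrier K" if "x \<in> C" for x using that by (simp add: C_def)
  have NP: "N p \<in> P" if pP: "p \<in> P" for p
  proof -
    obtain n h where p: "p = (B ^^ n) (J h)" "h \<in> hcarrier H" using pP by (auto simp: P_def)
    then have "N p = (B ^^ n) (J (A h))" using NBp Jc JA by simp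
    then show ?thesis using p Ac by (auto simp: P_def)
  qed
  have BP: "B p \<in> P" if pP: "p \<in> P" for p
  proof -
    obtain n h where p: "p = (B ^^ n) (J h)" "h \<in> hcarrier H" using pP by (auto simp: P_def)
    then have "B p = (B ^^ Suc n) (J h)" by simp
    then show ?thesis using p(2) unfolding P_def by blast
  qed
  have NQ: "N y \<in> Q" and BQ: "B y \<in> Q" if "y \<in> Q" for y
    using that P NP BP by (auto simp: Q_def Nc Bc NB BN subset_iff)
  have NC: "N x \<in> C" and BC: "B x \<in> C" if "x \<in> C" for x
    using that Qc NQ BQ by (auto simp: C_def Nc Bc NB BN subset_iff)
  have PC: "p \<in> C" if "p \<in> P" for p
  proof -
    have "hinner K p y = 0" if "y \<in> Q" for y
      using K.inner_commute[of p y] that \<open>p \<in> P\<close> P by (auto simp: Q_def)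
    then show ?thesis using that P by (auto simp: C_def)
  qed
  have JC: "J h \<in> C" if "h \<in> hcarrier H" for h
  proof (rule PC)
    have "J h = (B ^^ 0) (J h)" by simp
    then show "J h \<in> P" using that unfolding P_def by blast
  qed
  have nrm: "hnorm L = hnorm K" by (auto simp: L_def hnorm_def fun_eq_iff)
  have hL: "complex_hilbert_space L"
    using K.orthogonal_complement_hilbert[OF Qc] by (simp add: L_def C_def)
  have "isometric_embedding H L J"
    using J JC by (simp add: isometric_embedding_def linear_map_def L_def)
  moreover have "bounded_op L N"
  proof -
    obtain c where "\<forall>x\<in>hcarrier K. hnorm K (N x) \<le> c * hnorm K x"
      using Nb by (auto simp: bounded_op_def)
    then have "\<forall>x\<in>hcarrier L. hnorm L (N x) \<le> c * hnorm L x"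
      using Cc unfolding nrm by (simp add: L_def)
    moreover have "linear_map L L N"
      using Nb NC Cc by (simp add: bounded_op_def linear_map_def L_def)
    ultimately show ?thesis unfolding bounded_op_def by blast
  qed
  moreover have "is_adjoint L N B"
    using BC Cc NB by (simp add: is_adjoint_def L_def)
  moreover have "\<forall>x\<in>hcarrier L. N (B x) = B (N x)" using B(2) Cc by (simp add: L_def)
  ultimately have extL: "normal_extension H A L N J"
    using hL JA by (auto simp: normal_extension_def normal_op_def)
  define T :: "'k \<Rightarrow> 'a \<times> nat \<Rightarrow> complex" where
    "T x = (\<lambda>(h, n). if h \<in> hcarrier H then hinner K x ((B ^^ n) (J h)) else 0)" for x
  have "inj_on T (hcarrier L)"
  proof (rule inj_onI)
    fix x y assume "x \<in> hcarrier L" "y \<in> hcarrier L" and eq: "T x = T y"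
    then have xy: "x \<in> C" "y \<in> C" by (simp_all add: L_def)
    have xyK: "x \<in> hcarrier K" "y \<in> hcarrier K" using Cc xy by blast+
    let ?d = "hdiff K x y"
    have dK: "?d \<in> hcarrier K" using xyK K.diff_closed by blast
    have "hinner K ?d p = 0" if pP: "p \<in> P" for p
    proof -
      obtain n h where p: "p = (B ^^ n) (J h)" "h \<in> hcarrier H" using pP by (auto simp: P_def)
      have "hinner K x p = hinner K y p"
        using fun_cong[OF eq, of "(h, n)"] p by (simp add: T_def)
      then show ?thesis using xyK that P by (simp add: K.inner_diff_left subset_iff)
    qed
    then have "?d \<in> Q" using dK by (simp add: Q_def)
    then have "hinner K ?d ?d = 0"
      using xy xyK dK by (subst K.inner_diff_left) (auto simp: C_def)
    then show "x = y" using K.eq_if_diff_zero xyK K.inner_definite dK by blast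
  qed
  from normal_extension_transport[OF extL this] show ?thesis
    using A unfolding subnormal_def by blast
qed

end

(*
  If N is a normal extension of S, then with R = N* N the numbers ||S^(k+l) e_u||^2 are the inner
  products of R^k e_u and R^l e_u, so they form a positive semidefinite Hankel matrix: (i) implies (v).

  Conversely, S*^n S^n is diagonal on a directed tree, with entries t_n(u) = ||S^n e_u||^2. Hence
  t_(n+1)(u) is the sum of |w v|^2 t_n(v) over the children v of u, and (v) carries over to the
  shifted sequence. As t_n(u) grows at most like c^n, the functional of (t_n(u)) is nonnegative on
  x^a (c - x)^b, so (t_n(u)) is a moment sequence on [0, c] (Hausdorff), which gives (iii). Since
  S*^n S^n is diagonal, positivity of all these functionals amounts to Embry's condition, which
  implies the Bram--Halmos condition by approximating 1 by multiples of x^n on [0, c]; the normal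
  extension lives on the Hilbert space of the Bram--Halmos kernel.
*)

theory Submission
  imports Defs "HOL-Probability.Helly_Selection"
begin

section \<open>Hilbert spaces of positive definite kernels\<close>

text \<open>Two obstacles shape the proof. The first is boundedness: a positive kernel yields a
  Hilbert space but no bounded operator on it, and positive Hankel forms alone do not confine a
  moment sequence to an interval. Both are settled by \<open>le_of_growth\<close>, where squaring an
  estimate over and over makes a factor that depends on the vector disappear. The second is that
  \<open>x^n\<close> vanishes at 0, so 1 is no uniform limit of its multiples on [0, c]: the
  remainder \<theta> has only x \<theta> small. This suffices, because a term of the Bram--Halmos
  form either contains a vector in the range of the operator or belongs to a part that is
  nonnegative on its own. The same interval [0, c] must serve all vertices, since inner products of
  general vectors are sums over V; c comes from the square of a bound for the operator. There need
  be no operator R on the space with R^n = S*^n S^n; its functional calculus is replaced by the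
  functionals of the scalar sequences.\<close>

text \<open>Minimise over \<open>a\<close> in the direction of \<open>- cnj Z\<close>. Neither
  \<open>X\<close> nor \<open>Y\<close> is assumed nonnegative, so the sign of \<open>Y\<close> is
  forced first, by test values at which the expression would be at most -1. It is about bare numbers
  because it serves the form of a kernel, the forms \<open>W P\<close> below and the functional of a
  moment sequence.\<close>

lemma cauchy_schwarz_quadratic:
  fixes X Y :: real and Z :: complex
  assumes q: "\<And>a. 0 \<le> X + 2 * Re (a * Z) + (cmod a)\<^sup>2 * Y"
  shows "(cmod Z)\<^sup>2 \<le> X * Y"
proof (cases "Z = 0")
  case True
  have X: "0 \<le> X" using q[of 0] by simp
  have "0 \<le> Y"
  proof (rule ccontr)
    assume Y: "\<not> 0 \<le> Y"
    have "0 \<le> X + (sqrt ((X + 1) / - Y))\<^sup>2 * Y"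
      using q[of "of_real (sqrt ((X + 1) / - Y))"] True by simp
    moreover have "(sqrt ((X + 1) / - Y))\<^sup>2 * Y = - (X + 1)"
      using X Y by (simp add: field_simps)
    ultimately show False by linarith
  qed
  then show ?thesis using X True by simp
next
  case False
  define z where "z = (cmod Z)\<^sup>2"
  have z: "z > 0" using False by (simp add: z_def)
  have r: "0 \<le> X - 2 * r * z + r\<^sup>2 * z * Y" for r
  proof -
    have "complex_of_real (- r) * cnj Z * Z = complex_of_real (- r * z)"
      using complex_norm_square[of Z] by (simp add: z_def ac_simps)
    then have "Re (complex_of_real (- r) * cnj Z * Z) = - r * z" by (simp only: Re_complex_of_real)
    moreover have "(cmod (complex_of_real (- r) * cnj Z))\<^sup>2 = r\<^sup>2 * z"
      by (simp add: norm_mult power_mult_distrib z_def)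
    ultimately show ?thesis using q[of "complex_of_real (- r) * cnj Z"] by (simp only:)
  qed
  have Y: "Y > 0"
  proof (rule ccontr)
    assume "\<not> Y > 0"
    then have "((X + 1) / (2 * z))\<^sup>2 * z * Y \<le> 0" using z by (simp add: mult_nonneg_nonpos)
    moreover have "2 * ((X + 1) / (2 * z)) * z = X + 1" using z by simp
    ultimately show False using r[of "(X + 1) / (2 * z)"] by linarith
  qed
  have "0 \<le> X - z / Y"
    using r[of "1 / Y"] Y by (simp add: power2_eq_square)
  then show ?thesis using Y by (simp add: field_simps z_def)
qed

text \<open>If \<open>a 1 / a 0\<close> were \<open>c * r\<close> with \<open>r > 1\<close>,
  doubling the index by \<open>sq\<close> would give \<open>a (2 ^ k)\<close> at least
  \<open>a 0 * (c * r) ^ (2 ^ k)\<close>, too fast for \<open>growth\<close>. The constant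
  \<open>M\<close> leaves no trace in the conclusion, so it may depend on the vector from which
  \<open>a\<close> arises.\<close>

lemma le_of_growth:
  fixes a :: "nat \<Rightarrow> real"
  assumes nonneg: "\<And>m. 0 \<le> a m" and sq: "\<And>m. (a m)\<^sup>2 \<le> a 0 * a (2 * m)"
    and growth: "\<And>m. a m \<le> M * c ^ m" and c: "c > 0"
  shows "a 1 \<le> c * a 0"
proof (rule ccontr)
  assume "\<not> a 1 \<le> c * a 0"
  then have less: "c * a 0 < a 1" by simp
  have a0: "a 0 > 0"
  proof (rule ccontr)
    assume "\<not> a 0 > 0"
    then have "a 0 = 0" using nonneg[of 0] by simp
    then show False using sq[of 1] less by simp
  qed
  define r where "r = a 1 / (c * a 0)"
  have r: "r > 1" using less a0 c by (simp add: r_def)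
  have lower: "a 0 * (c * r) ^ (2 ^ k) \<le> a (2 ^ k)" for k
  proof (induction k)
    case 0
    then show ?case using a0 c by (simp add: r_def)
  next
    case (Suc k)
    have "(a 0 * (c * r) ^ (2 ^ k))\<^sup>2 \<le> (a (2 ^ k))\<^sup>2"
      using Suc a0 c r by (intro power_mono) auto
    also have "\<dots> \<le> a 0 * a (2 ^ Suc k)" using sq[of "2 ^ k"] by simp
    also have "(a 0 * (c * r) ^ (2 ^ k))\<^sup>2 = a 0 * (a 0 * (c * r) ^ (2 ^ Suc k))"
      by (simp add: power2_eq_square power_mult mult.commute[of 2] power_mult_distrib)
    finally show ?case using a0 by simp
  qed
  have bound: "r ^ (2 ^ k) \<le> M / a 0" for k
  proof -
    have "a 0 * r ^ (2 ^ k) * c ^ (2 ^ k) \<le> M * c ^ (2 ^ k)"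
      using order_trans[OF lower[of k] growth[of "2 ^ k"]] by (simp add: power_mult_distrib ac_simps)
    then show ?thesis using c a0 by (simp add: field_simps)
  qed
  obtain n where n: "M / a 0 < r ^ n" using real_arch_pow[OF r] by blast
  have "n \<le> 2 ^ n" by (simp add: less_imp_le)
  then have "r ^ n \<le> r ^ (2 ^ n)" using r by (intro power_increasing) auto
  then show False using n bound[of n] by linarith
qed

section \<open>Formal linear combinations and the form of a kernel\<close>

text \<open>Lists of weighted points stand for finite linear combinations. Different lists may
  denote the same vector; this is harmless because lists are compared through the form only.\<close>

definition kform :: "('x \<Rightarrow> 'x \<Rightarrow> complex) \<Rightarrow> (complex \<times> 'x) list \<Rightarrow> (complex \<times> 'x) list \<Rightarrow> complex" where
  "kform k xs ys = (\<Sum>p\<leftarrow>xs. \<Sum>q\<leftarrow>ys. fst p * cnj (fst q) * k (snd p) (snd q))"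

definition lscale :: "complex \<Rightarrow> (complex \<times> 'x) list \<Rightarrow> (complex \<times> 'x) list" where
  "lscale a = map (\<lambda>p. (a * fst p, snd p))"

definition lsub :: "(complex \<times> 'x) list \<Rightarrow> (complex \<times> 'x) list \<Rightarrow> (complex \<times> 'x) list" where
  "lsub xs ys = xs @ lscale (- 1) ys"

definition lmap :: "('x \<Rightarrow> 'x) \<Rightarrow> (complex \<times> 'x) list \<Rightarrow> (complex \<times> 'x) list" where
  "lmap f = map (\<lambda>p. (fst p, f (snd p)))"

lemma kform_Nil: "kform k [] ys = 0" "kform k xs [] = 0"
  by (induction xs) (auto simp: kform_def)

lemma kform_append: "kform k (xs @ ys) zs = kform k xs zs + kform k ys zs"
    "kform k zs (xs @ ys) = kform k zs xs + kform k zs ys"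
  by (auto simp: kform_def sum_list_addf)

lemma kform_Cons: "kform k (p # xs) zs = kform k [p] zs + kform k xs zs"
    "kform k zs (p # xs) = kform k zs [p] + kform k zs xs"
  by (rule kform_append[where ys = xs and xs = "[p]", unfolded append_Cons append_Nil])+

lemma kform_scale: "kform k (lscale a xs) zs = a * kform k xs zs"
    "kform k zs (lscale a xs) = cnj a * kform k zs xs"
  by (auto simp: kform_def lscale_def sum_list_const_mult o_def ac_simps)

lemma kform_sub: "kform k (lsub xs ys) zs = kform k xs zs - kform k ys zs"
    "kform k zs (lsub xs ys) = kform k zs xs - kform k zs ys"
  by (auto simp: lsub_def kform_append kform_scale)

lemmas kform_simps = kform_append kform_scale kform_sub

lemma kform_commute:
  assumes "\<And>x y. k x y = cnj (k y x)"
  shows "kform k xs ys = cnj (kform k ys xs)"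
proof (induction xs)
  case Nil
  then show ?case by (simp add: kform_Nil)
next
  case (Cons p xs)
  have "kform k [p] ys = cnj (kform k ys [p])"
  proof (induction ys)
    case Nil
    then show ?case by (simp add: kform_Nil)
  next
    case (Cons q ys)
    have "kform k [p] [q] = cnj (kform k [q] [p])"
      using assms[of "snd p" "snd q"] by (simp add: kform_def)
    then show ?case using Cons
      by (simp only: kform_Cons(2)[of k "[p]" q ys] kform_Cons(1)[of k q ys] complex_cnj_add)
  qed
  then show ?case using Cons
    by (simp only: kform_Cons(2)[of k ys p xs] kform_Cons(1)[of k p xs] complex_cnj_add)
qed

locale pos_kernel =
  fixes k :: "'x \<Rightarrow> 'x \<Rightarrow> complex"
  assumes hermitian: "k x y = cnj (k y x)"
    and pos: "0 \<le> Re (kform k xs xs)"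
begin

abbreviation B where "B \<equiv> kform k"

definition sn :: "(complex \<times> 'x) list \<Rightarrow> real" where "sn xs = sqrt (Re (B xs xs))"

lemmas B_commute = kform_commute[of k, OF hermitian]

lemma sn_nonneg: "0 \<le> sn xs" by (simp add: sn_def pos)

lemma B_self: "B xs xs = complex_of_real ((sn xs)\<^sup>2)"
proof -
  have "Im (B xs xs) = 0" using arg_cong[OF B_commute[of xs xs], of Im] by simp
  then show ?thesis using pos[of xs] by (simp add: sn_def complex_eq_iff)
qed

lemma B_cauchy_schwarz: "cmod (B xs ys) \<le> sn xs * sn ys"
proof -
  have "0 \<le> (sn xs)\<^sup>2 + 2 * Re (a * cnj (B xs ys)) + (cmod a)\<^sup>2 * (sn ys)\<^sup>2" for a
  proof -
    have e: "B (xs @ lscale a ys) (xs @ lscale a ys)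
        = B xs xs + a * cnj (B xs ys) + cnj (a * cnj (B xs ys)) + a * cnj a * B ys ys"
      by (simp add: kform_simps B_commute[of ys xs] algebra_simps)
    have "Re (B (xs @ lscale a ys) (xs @ lscale a ys))
        = (sn xs)\<^sup>2 + 2 * Re (a * cnj (B xs ys)) + (cmod a)\<^sup>2 * (sn ys)\<^sup>2"
      unfolding e B_self[of xs] B_self[of ys] complex_norm_square[symmetric] by simp
    then show ?thesis using pos[of "xs @ lscale a ys"] by (simp only:)
  qed
  from cauchy_schwarz_quadratic[OF this] have "(cmod (B xs ys))\<^sup>2 \<le> (sn xs * sn ys)\<^sup>2"
    by (simp add: power_mult_distrib)
  then show ?thesis using sn_nonneg by (metis power2_le_imp_le mult_nonneg_nonneg)
qed

lemma sn_triangle: "sn (xs @ ys) \<le> sn xs + sn ys"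
proof -
  have "(sn (xs @ ys))\<^sup>2 = Re (B xs xs) + 2 * Re (B xs ys) + Re (B ys ys)"
    using pos[of "xs @ ys"] arg_cong[OF B_commute[of ys xs], of Re] by (simp add: sn_def kform_append)
  also have "\<dots> = (sn xs)\<^sup>2 + 2 * Re (B xs ys) + (sn ys)\<^sup>2" by (simp add: sn_def pos)
  also have "\<dots> \<le> (sn xs)\<^sup>2 + 2 * (sn xs * sn ys) + (sn ys)\<^sup>2"
    using B_cauchy_schwarz[of xs ys] complex_Re_le_cmod[of "B xs ys"] by linarith
  also have "\<dots> = (sn xs + sn ys)\<^sup>2" by (simp add: power2_sum)
  finally show ?thesis using sn_nonneg by (meson add_nonneg_nonneg power2_le_imp_le)
qed

lemma sn_scale: "sn (lscale a xs) = cmod a * sn xs"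
proof -
  have "B (lscale a xs) (lscale a xs) = a * cnj a * B xs xs" by (simp add: kform_simps)
  then have "Re (B (lscale a xs) (lscale a xs)) = (cmod a)\<^sup>2 * (sn xs)\<^sup>2"
    unfolding B_self[of xs] complex_norm_square[symmetric] by simp
  then show ?thesis using sn_nonneg[of xs] by (simp add: sn_def[of "lscale a xs"] real_sqrt_mult)
qed

text \<open>Replaces the quotient by null vectors: lists that the form cannot tell apart are
  interchangeable under the seminorm, although they differ as lists.\<close>

lemma sn_cong: "(\<And>zs. B xs zs = B ys zs) \<Longrightarrow> sn xs = sn ys"
  by (metis B_commute sn_def)

lemma sn_sub_commute: "sn (lsub xs ys) = sn (lsub ys xs)"
proof -
  have "sn (lsub xs ys) = sn (lscale (- 1) (lsub ys xs))" by (rule sn_cong) (simp add: kform_simps)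
  then show ?thesis by (simp add: sn_scale)
qed

lemma sn_sub_triangle: "sn (lsub xs zs) \<le> sn (lsub xs ys) + sn (lsub ys zs)"
proof -
  have "sn (lsub xs zs) = sn (lsub xs ys @ lsub ys zs)" by (rule sn_cong) (simp add: kform_simps)
  then show ?thesis by (simp add: sn_triangle)
qed

lemma sn_diff_le: "\<bar>sn xs - sn ys\<bar> \<le> sn (lsub xs ys)"
proof -
  have *: "sn xs \<le> sn (lsub xs ys) + sn ys" for xs ys
  proof -
    have "sn xs = sn (lsub xs ys @ ys)" by (rule sn_cong) (simp add: kform_simps)
    then show ?thesis by (simp add: sn_triangle)
  qed
  from *[of xs ys] *[of ys xs] show ?thesis by (simp add: sn_sub_commute)
qed

section \<open>Completion as a space of functions\<close>

definition cauchy :: "(nat \<Rightarrow> (complex \<times> 'x) list) \<Rightarrow> bool" where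
  "cauchy s \<longleftrightarrow> (\<forall>e>0. \<exists>M. \<forall>m\<ge>M. \<forall>n\<ge>M. sn (lsub (s m) (s n)) < e)"

lemma cauchy_bounded:
  assumes "cauchy s"
  obtains C where "C > 0" "\<And>n. sn (s n) \<le> C"
proof -
  have "Cauchy (\<lambda>n. sn (s n))"
  proof (rule metric_CauchyI)
    fix e :: real assume "e > 0"
    then show "\<exists>M. \<forall>m\<ge>M. \<forall>n\<ge>M. dist (sn (s m)) (sn (s n)) < e"
      using assms sn_diff_le unfolding cauchy_def dist_real_def by (meson le_less_trans)
  qed
  then obtain C where "C > 0" "\<And>n. norm (sn (s n)) \<le> C"
    using Cauchy_Bseq Bseq_def by metis
  then show thesis using that sn_nonneg by fastforce
qed

lemma cauchy_const: "cauchy (\<lambda>n. xs)"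
proof -
  have "sn (lsub xs xs) = 0" by (simp add: sn_def kform_simps)
  then show ?thesis by (simp add: cauchy_def)
qed

lemma cauchy_append:
  assumes "cauchy s" "cauchy t"
  shows "cauchy (\<lambda>n. s n @ t n)"
  unfolding cauchy_def
proof (intro allI impI)
  fix e :: real assume "e > 0"
  then obtain M M' where M: "\<And>m n. \<lbrakk>m \<ge> M; n \<ge> M\<rbrakk> \<Longrightarrow> sn (lsub (s m) (s n)) < e / 2"
      "\<And>m n. \<lbrakk>m \<ge> M'; n \<ge> M'\<rbrakk> \<Longrightarrow> sn (lsub (t m) (t n)) < e / 2"
    using assms unfolding cauchy_def by (meson half_gt_zero)
  have "sn (lsub (s m @ t m) (s n @ t n)) < e" if "m \<ge> max M M'" "n \<ge> max M M'" for m n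
  proof -
    have "sn (lsub (s m @ t m) (s n @ t n)) = sn (lsub (s m) (s n) @ lsub (t m) (t n))"
      by (rule sn_cong) (simp add: kform_simps)
    also have "\<dots> \<le> sn (lsub (s m) (s n)) + sn (lsub (t m) (t n))" by (rule sn_triangle)
    also have "\<dots> < e" using M(1)[of m n] M(2)[of m n] that by simp
    finally show ?thesis .
  qed
  then show "\<exists>M. \<forall>m\<ge>M. \<forall>n\<ge>M. sn (lsub (s m @ t m) (s n @ t n)) < e" by blast
qed

lemma cauchy_linear:
  assumes s: "cauchy s" and C: "\<And>xs ys. sn (lsub (T xs) (T ys)) \<le> C * sn (lsub xs ys)"
  shows "cauchy (\<lambda>n. T (s n))"
  unfolding cauchy_def
proof (intro allI impI)
  fix e :: real assume e: "e > 0"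
  define C' where "C' = \<bar>C\<bar> + 1"
  have C': "C' > 0" "C \<le> C'" by (auto simp: C'_def)
  obtain M where M: "\<And>m n. \<lbrakk>m \<ge> M; n \<ge> M\<rbrakk> \<Longrightarrow> sn (lsub (s m) (s n)) < e / C'"
    using s e C' unfolding cauchy_def by (meson divide_pos_pos)
  have "sn (lsub (T (s m)) (T (s n))) < e" if "m \<ge> M" "n \<ge> M" for m n
  proof -
    have "sn (lsub (T (s m)) (T (s n))) \<le> C' * sn (lsub (s m) (s n))"
      using C[of "s m" "s n"] C' sn_nonneg[of "lsub (s m) (s n)"] by (meson mult_right_mono order_trans)
    also have "\<dots> < e" using M[OF that] C' by (simp add: field_simps)
    finally show ?thesis .
  qed
  then show "\<exists>M. \<forall>m\<ge>M. \<forall>n\<ge>M. sn (lsub (T (s m)) (T (s n))) < e" by blast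
qed

lemma cauchy_scale: "cauchy s \<Longrightarrow> cauchy (\<lambda>n. lscale a (s n))"
proof (erule cauchy_linear[where C = "cmod a"])
  fix xs ys
  have "sn (lsub (lscale a xs) (lscale a ys)) = sn (lscale a (lsub xs ys))"
    by (rule sn_cong) (simp add: kform_simps algebra_simps)
  then show "sn (lsub (lscale a xs) (lscale a ys)) \<le> cmod a * sn (lsub xs ys)" by (simp add: sn_scale)
qed

lemma B_convergent:
  assumes "cauchy s" "cauchy t"
  shows "convergent (\<lambda>n. B (s n) (t n))"
proof -
  obtain C where C: "C > 0" "\<And>n. sn (s n) \<le> C" using cauchy_bounded assms(1) by blast
  obtain D where D: "D > 0" "\<And>n. sn (t n) \<le> D" using cauchy_bounded assms(2) by blast
  have "Cauchy (\<lambda>n. B (s n) (t n))"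
  proof (rule metric_CauchyI)
    fix e :: real assume "e > 0"
    then have e: "e / (2 * D) > 0" "e / (2 * C) > 0" using C D by auto
    then obtain M M' where M: "\<And>m n. \<lbrakk>m \<ge> M; n \<ge> M\<rbrakk> \<Longrightarrow> sn (lsub (s m) (s n)) < e / (2 * D)"
      "\<And>m n. \<lbrakk>m \<ge> M'; n \<ge> M'\<rbrakk> \<Longrightarrow> sn (lsub (t m) (t n)) < e / (2 * C)"
      using assms unfolding cauchy_def by meson
    have "dist (B (s m) (t m)) (B (s n) (t n)) < e" if "m \<ge> max M M'" "n \<ge> max M M'" for m n
    proof -
      have "B (s m) (t m) - B (s n) (t n)
          = B (lsub (s m) (s n)) (t m) + B (s n) (lsub (t m) (t n))" by (simp add: kform_simps)
      then have "dist (B (s m) (t m)) (B (s n) (t n))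
          \<le> cmod (B (lsub (s m) (s n)) (t m)) + cmod (B (s n) (lsub (t m) (t n)))"
        unfolding dist_norm by (simp add: norm_triangle_ineq)
      also have "\<dots> \<le> sn (lsub (s m) (s n)) * D + C * sn (lsub (t m) (t n))"
        using B_cauchy_schwarz[of "lsub (s m) (s n)" "t m"] B_cauchy_schwarz[of "s n" "lsub (t m) (t n)"]
          mult_left_mono[OF D(2) sn_nonneg] mult_right_mono[OF C(2) sn_nonneg]
        by (meson add_mono order_trans)
      also have "\<dots> < e / 2 + e / 2"
        using M(1)[of m n] M(2)[of m n] that C D by (intro add_strict_mono) (auto simp: field_simps)
      finally show ?thesis by simp
    qed
    then show "\<exists>M. \<forall>m\<ge>M. \<forall>n\<ge>M. dist (B (s m) (t m)) (B (s n) (t n)) < e" by blast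
  qed
  then show ?thesis by (simp add: Cauchy_convergent_iff)
qed

text \<open>A vector of the completion is coded by its inner products with the points, as in a
  reproducing kernel space. Equality of vectors is then equality of functions, and Cauchy sequences
  need no quotient.\<close>

definition reps :: "('x \<Rightarrow> complex) \<Rightarrow> (nat \<Rightarrow> (complex \<times> 'x) list) \<Rightarrow> bool" where
  "reps F s \<longleftrightarrow> cauchy s \<and> (\<forall>x. (\<lambda>n. B (s n) [(1, x)]) \<longlonglongrightarrow> F x)"

definition ev :: "('x \<Rightarrow> complex) \<Rightarrow> (complex \<times> 'x) list \<Rightarrow> complex" where
  "ev F zs = (\<Sum>p\<leftarrow>zs. cnj (fst p) * F (snd p))"

lemma reps_ev: "reps F s \<Longrightarrow> (\<lambda>n. B (s n) zs) \<longlonglongrightarrow> ev F zs"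
proof (induction zs)
  case Nil
  then show ?case by (simp add: ev_def kform_Nil)
next
  case (Cons p zs)
  obtain d y where p: "p = (d, y)" by (cases p)
  have "B (s n) (p # zs) = cnj d * B (s n) [(1, y)] + B (s n) zs" for n
    using kform_Cons(2)[of k "s n" p zs] kform_scale(2)[of k "s n" d "[(1, y)]"] p
    by (simp add: lscale_def)
  then show ?case using Cons p
    by (auto simp: ev_def reps_def intro!: tendsto_intros)
qed

text \<open>By Cauchy--Schwarz the convergence in \<open>reps_ev\<close> is uniform over lists of
  bounded seminorm, hence along the Cauchy sequence \<open>t\<close>. So two sequences representing
  the same \<open>F\<close> have asymptotically equal form values against \<open>t\<close>, which
  makes \<open>kinner\<close> independent of its choices.\<close>

lemma reps_ev_close:
  assumes F: "reps F s" and t: "cauchy t"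
  shows "(\<lambda>n. ev F (t n) - B (s n) (t n)) \<longlonglongrightarrow> 0"
proof (rule LIMSEQ_I)
  fix e :: real assume e: "e > 0"
  obtain D where D: "D > 0" "\<And>n. sn (t n) \<le> D" using cauchy_bounded t by blast
  obtain M where M: "\<And>m n. \<lbrakk>m \<ge> M; n \<ge> M\<rbrakk> \<Longrightarrow> sn (lsub (s m) (s n)) < e / (2 * D)"
    using F e D unfolding reps_def cauchy_def by (meson divide_pos_pos mult_pos_pos zero_less_numeral)
  have "norm (ev F (t n) - B (s n) (t n) - 0) < e" if n: "n \<ge> M" for n
  proof -
    have "cmod (B (s m) (t n) - B (s n) (t n)) \<le> e / 2" if m: "m \<ge> M" for m
    proof -
      have "cmod (B (s m) (t n) - B (s n) (t n)) = cmod (B (lsub (s m) (s n)) (t n))"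
        by (simp add: kform_simps)
      also have "\<dots> \<le> sn (lsub (s m) (s n)) * D"
        using B_cauchy_schwarz[of "lsub (s m) (s n)" "t n"] mult_left_mono[OF D(2) sn_nonneg]
        by (meson order_trans)
      also have "\<dots> \<le> e / 2" using M[OF m n] D by (simp add: field_simps)
      finally show ?thesis .
    qed
    moreover have "(\<lambda>m. cmod (B (s m) (t n) - B (s n) (t n))) \<longlonglongrightarrow> cmod (ev F (t n) - B (s n) (t n))"
      by (intro tendsto_intros reps_ev F)
    ultimately have "cmod (ev F (t n) - B (s n) (t n)) \<le> e / 2"
      by (intro LIMSEQ_le_const2) auto
    then show ?thesis using e by simp
  qed
  then show "\<exists>no. \<forall>n\<ge>no. norm (ev F (t n) - B (s n) (t n) - 0) < e" by blast
qed

definition kinner :: "('x \<Rightarrow> complex) \<Rightarrow> ('x \<Rightarrow> complex) \<Rightarrow> complex" where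
  "kinner F G = lim (\<lambda>n. B ((SOME s. reps F s) n) ((SOME t. reps G t) n))"

lemma B_tendsto_indep:
  assumes "reps F s" "reps F s'" "cauchy t" "(\<lambda>n. B (s n) (t n)) \<longlonglongrightarrow> z"
  shows "(\<lambda>n. B (s' n) (t n)) \<longlonglongrightarrow> z"
proof -
  have "(\<lambda>n. B (s n) (t n) + (ev F (t n) - B (s n) (t n)) - (ev F (t n) - B (s' n) (t n)))
      \<longlonglongrightarrow> z + 0 - 0"
    using assms by (intro tendsto_add tendsto_diff reps_ev_close)
  then show ?thesis by simp
qed

text \<open>The chosen sequences are exchanged for the given ones in one argument at a time; the
  second exchange goes through conjugation because \<open>B_tendsto_indep\<close> treats the first
  argument.\<close>

lemma kinner_tendsto:
  assumes F: "reps F s" and G: "reps G t"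
  shows "(\<lambda>n. B (s n) (t n)) \<longlonglongrightarrow> kinner F G"
proof -
  define s' where "s' = (SOME s. reps F s)"
  define t' where "t' = (SOME s. reps G s)"
  have s': "reps F s'" unfolding s'_def using F by (rule someI[of "reps F"])
  have t': "reps G t'" unfolding t'_def using G by (rule someI[of "reps G"])
  have c: "cauchy s" "cauchy t" "cauchy s'" "cauchy t'" using F G s' t' by (auto simp: reps_def)
  have "(\<lambda>n. B (s' n) (t' n)) \<longlonglongrightarrow> kinner F G"
    using B_convergent[OF c(3,4)] by (simp add: kinner_def s'_def t'_def convergent_LIMSEQ_iff)
  then have "(\<lambda>n. B (s n) (t' n)) \<longlonglongrightarrow> kinner F G" using B_tendsto_indep[OF s' F c(4)] by blast
  then have "(\<lambda>n. cnj (B (s n) (t' n))) \<longlonglongrightarrow> cnj (kinner F G)" by (rule tendsto_cnj)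
  then have "(\<lambda>n. B (t' n) (s n)) \<longlonglongrightarrow> cnj (kinner F G)" using B_commute by (subst B_commute)
  then have "(\<lambda>n. B (t n) (s n)) \<longlonglongrightarrow> cnj (kinner F G)" using B_tendsto_indep[OF t' G c(1)] by blast
  then have "(\<lambda>n. cnj (B (t n) (s n))) \<longlonglongrightarrow> cnj (cnj (kinner F G))" by (rule tendsto_cnj)
  then show ?thesis by (subst B_commute) simp
qed

definition kspace :: "('x \<Rightarrow> complex) hspace" where
  "kspace = \<lparr> hcarrier = {F. \<exists>s. reps F s}, hzero = (\<lambda>x. 0), hadd = (\<lambda>F G x. F x + G x),
     hscale = (\<lambda>a F x. a * F x), hinner = kinner \<rparr>"

lemma kspace_simps [simp]:
  "hcarrier kspace = {F. \<exists>s. reps F s}" "hzero kspace = (\<lambda>x. 0)"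
  "hadd kspace = (\<lambda>F G x. F x + G x)" "hscale kspace = (\<lambda>a F x. a * F x)"
  "hinner kspace = kinner" "hdiff kspace = (\<lambda>F G x. F x - G x)"
  by (auto simp: kspace_def hdiff_def fun_eq_iff)

lemma reps_add: "\<lbrakk>reps F s; reps G t\<rbrakk> \<Longrightarrow> reps (\<lambda>x. F x + G x) (\<lambda>n. s n @ t n)"
  by (auto simp: reps_def cauchy_append kform_simps intro!: tendsto_intros)

lemma reps_scale: "reps F s \<Longrightarrow> reps (\<lambda>x. a * F x) (\<lambda>n. lscale a (s n))"
  by (auto simp: reps_def cauchy_scale kform_simps intro!: tendsto_intros)

lemma reps_diff: "\<lbrakk>reps F s; reps G t\<rbrakk> \<Longrightarrow> reps (\<lambda>x. F x - G x) (\<lambda>n. lsub (s n) (t n))"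
  using reps_add[OF _ reps_scale[of G t "- 1"]] by (simp add: lsub_def)

definition point :: "(complex \<times> 'x) list \<Rightarrow> 'x \<Rightarrow> complex" where
  "point xs x = B xs [(1, x)]"

lemma reps_point: "reps (point xs) (\<lambda>n. xs)"
  by (simp add: reps_def cauchy_const point_def)

lemma kinner_point: "kinner (point xs) (point ys) = B xs ys"
  using kinner_tendsto[OF reps_point reps_point] by (simp add: LIMSEQ_const_iff)

lemma hnorm_tendsto: "reps F s \<Longrightarrow> (\<lambda>n. sn (s n)) \<longlonglongrightarrow> hnorm kspace F"
  using kinner_tendsto[of F s F s] unfolding sn_def hnorm_def
  by (auto intro!: tendsto_intros)

lemma hnorm_triangle:
  assumes "reps F s" "reps G t" "reps P r"
  shows "hnorm kspace (\<lambda>x. F x - G x) \<le> hnorm kspace (\<lambda>x. F x - P x) + hnorm kspace (\<lambda>x. P x - G x)"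
  by (rule LIMSEQ_le[OF hnorm_tendsto[OF reps_diff[OF assms(1,2)]]
      tendsto_add[OF hnorm_tendsto[OF reps_diff[OF assms(1,3)]] hnorm_tendsto[OF reps_diff[OF assms(3,2)]]]])
    (auto intro: sn_sub_triangle)

lemma hnorm_diff_point:
  assumes F: "reps F s" and M: "\<And>m. m \<ge> M \<Longrightarrow> sn (lsub (s m) zs) \<le> e"
  shows "hnorm kspace (\<lambda>x. F x - point zs x) \<le> e"
  by (rule LIMSEQ_le_const2[OF hnorm_tendsto[OF reps_diff[OF F reps_point]]]) (use M in blast)

text \<open>Finite combinations are dense: replace each \<open>F n\<close> by a single list at
  distance at most 1/(n + 1). These lists form one Cauchy sequence, and the function that it
  represents is the limit.\<close>

lemma kspace_complete:
  assumes F: "\<And>n. \<exists>s. reps (F n) s"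
    and cau: "\<And>e :: real. 0 < e \<Longrightarrow> \<exists>M. \<forall>m\<ge>M. \<forall>n\<ge>M. hnorm kspace (\<lambda>x. F m x - F n x) < e"
  shows "\<exists>G s. reps G s \<and> (\<lambda>n. hnorm kspace (\<lambda>x. F n x - G x)) \<longlonglongrightarrow> 0"
proof -
  have "\<exists>ys. hnorm kspace (\<lambda>x. F n x - point ys x) \<le> 1 / (Suc n)" for n
  proof -
    obtain s where s: "reps (F n) s" using F by blast
    have "0 < 1 / real (Suc n)" by simp
    then obtain M where M: "\<And>i j. \<lbrakk>i \<ge> M; j \<ge> M\<rbrakk> \<Longrightarrow> sn (lsub (s i) (s j)) < 1 / real (Suc n)"
      using s unfolding reps_def cauchy_def by meson
    have "hnorm kspace (\<lambda>x. F n x - point (s M) x) \<le> 1 / (Suc n)"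
      by (rule hnorm_diff_point[OF s, of M]) (use M[of _ M] in \<open>simp add: less_imp_le\<close>)
    then show ?thesis by blast
  qed
  then obtain y where y: "\<And>n. hnorm kspace (\<lambda>x. F n x - point (y n) x) \<le> 1 / (Suc n)" by metis
  have sn_point: "hnorm kspace (\<lambda>x. point xs x - point ys x) = sn (lsub xs ys)" for xs ys
    using hnorm_tendsto[OF reps_diff[OF reps_point reps_point]] by (simp add: LIMSEQ_const_iff)
  have sym: "hnorm kspace (\<lambda>x. P x - Q x) = hnorm kspace (\<lambda>x. Q x - P x)"
    if "reps P s" "reps Q t" for P Q s t
  proof (rule LIMSEQ_unique[OF hnorm_tendsto[OF reps_diff[OF that]]])
    show "(\<lambda>n. sn (lsub (s n) (t n))) \<longlonglongrightarrow> hnorm kspace (\<lambda>x. Q x - P x)"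
      using hnorm_tendsto[OF reps_diff[OF that(2,1)]] by (subst sn_sub_commute)
  qed
  have small: "\<exists>M. \<forall>n\<ge>M. 1 / real (Suc n) < e" if "e > 0" for e
  proof -
    obtain N where N: "1 / real (Suc N) < e" using reals_Archimedean \<open>e > 0\<close> by (metis inverse_eq_divide)
    have "1 / real (Suc n) \<le> 1 / real (Suc N)" if "n \<ge> N" for n using that by (simp add: frac_le)
    then show ?thesis using N by (meson le_less_trans)
  qed
  have cy: "cauchy y"
    unfolding cauchy_def
  proof (intro allI impI)
    fix e :: real assume "e > 0"
    then have e3: "e / 3 > 0" by simp
    obtain M where M: "\<forall>m\<ge>M. \<forall>n\<ge>M. hnorm kspace (\<lambda>x. F m x - F n x) < e / 3" using cau[OF e3] by blast
    obtain M' where M': "\<forall>n\<ge>M'. 1 / real (Suc n) < e / 3" using small[OF e3] by blast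
    have "sn (lsub (y m) (y n)) < e" if "m \<ge> max M M'" "n \<ge> max M M'" for m n
    proof -
      obtain s t where st: "reps (F m) s" "reps (F n) t" using F by meson
      have "sn (lsub (y m) (y n)) \<le> hnorm kspace (\<lambda>x. point (y m) x - F m x)
          + hnorm kspace (\<lambda>x. F m x - point (y n) x)"
        using hnorm_triangle[OF reps_point reps_point st(1)] by (simp add: sn_point)
      moreover have "hnorm kspace (\<lambda>x. F m x - point (y n) x)
          \<le> hnorm kspace (\<lambda>x. F m x - F n x) + hnorm kspace (\<lambda>x. F n x - point (y n) x)"
        using hnorm_triangle[OF st(1) reps_point st(2)] .
      moreover have "hnorm kspace (\<lambda>x. point (y m) x - F m x) < e / 3"
        using sym[OF reps_point st(1)] y[of m] M' that by (metis le_less_trans max.bounded_iff)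
      moreover have "hnorm kspace (\<lambda>x. F n x - point (y n) x) < e / 3"
        using y[of n] M' that by (metis le_less_trans max.bounded_iff)
      moreover have "hnorm kspace (\<lambda>x. F m x - F n x) < e / 3" using M that by simp
      ultimately show ?thesis by linarith
    qed
    then show "\<exists>M. \<forall>m\<ge>M. \<forall>n\<ge>M. sn (lsub (y m) (y n)) < e" by blast
  qed
  define G where "G x = lim (\<lambda>n. B (y n) [(1, x)])" for x
  have G: "reps G y"
    using cy B_convergent[OF cy cauchy_const] by (simp add: reps_def G_def convergent_LIMSEQ_iff)
  have "(\<lambda>n. hnorm kspace (\<lambda>x. F n x - G x)) \<longlonglongrightarrow> 0"
  proof (rule LIMSEQ_I)
    fix e :: real assume e: "e > 0"
    then have e3: "e / 3 > 0" by simp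
    obtain M where M: "\<forall>m\<ge>M. \<forall>n\<ge>M. sn (lsub (y m) (y n)) < e / 3" using cy e3 unfolding cauchy_def by blast
    obtain M' where M': "\<forall>n\<ge>M'. 1 / real (Suc n) < e / 3" using small[OF e3] by blast
    have "norm (hnorm kspace (\<lambda>x. F n x - G x) - 0) < e" if "n \<ge> max M M'" for n
    proof -
      obtain s where s: "reps (F n) s" using F by meson
      have "hnorm kspace (\<lambda>x. F n x - G x)
          \<le> hnorm kspace (\<lambda>x. F n x - point (y n) x) + hnorm kspace (\<lambda>x. point (y n) x - G x)"
        using hnorm_triangle[OF s G reps_point] .
      moreover have "hnorm kspace (\<lambda>x. G x - point (y n) x) \<le> e / 3"
        by (rule hnorm_diff_point[OF G, of M]) (use M that in \<open>simp add: less_imp_le\<close>)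
      moreover have "hnorm kspace (\<lambda>x. F n x - point (y n) x) < e / 3"
        using y[of n] M' that by (metis le_less_trans max.bounded_iff)
      moreover have "0 \<le> hnorm kspace (\<lambda>x. F n x - G x)"
        by (rule LIMSEQ_le_const[OF hnorm_tendsto[OF reps_diff[OF s G]]]) (auto simp: sn_nonneg)
      ultimately show ?thesis using sym[OF reps_point G, of "y n"] e by simp
    qed
    then show "\<exists>no. \<forall>n\<ge>no. norm (hnorm kspace (\<lambda>x. F n x - G x) - 0) < e" by blast
  qed
  then show ?thesis using G by blast
qed

lemma kspace_hilbert: "complex_hilbert_space kspace"
proof (unfold_locales, goal_cases)
  case 1
  have "point [] = (\<lambda>x. 0)" by (simp add: point_def kform_Nil fun_eq_iff)
  then show ?case using reps_point[of "[]"] unfolding kspace_simps by (metis mem_Collect_eq)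
next
  case (2 x y)
  then obtain s t where "reps x s" "reps y t" by auto
  from reps_add[OF this] show ?case by auto
next
  case (3 x c)
  then obtain s where "reps x s" by auto
  from reps_scale[OF this] show ?case by auto
next
  case (12 x y z)
  then obtain r s t where r: "reps x r" and s: "reps y s" and t: "reps z t" by auto
  have "(\<lambda>n. B (r n @ s n) (t n)) \<longlonglongrightarrow> kinner x z + kinner y z"
    unfolding kform_append by (rule tendsto_add[OF kinner_tendsto[OF r t] kinner_tendsto[OF s t]])
  then show ?case using LIMSEQ_unique[OF kinner_tendsto[OF reps_add[OF r s] t]] by simp
next
  case (13 x y c)
  then obtain r s where r: "reps x r" and s: "reps y s" by auto
  have "(\<lambda>n. B (lscale c (r n)) (s n)) \<longlonglongrightarrow> c * kinner x y"
    unfolding kform_scale by (rule tendsto_mult[OF tendsto_const kinner_tendsto[OF r s]])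
  then show ?case using LIMSEQ_unique[OF kinner_tendsto[OF reps_scale[OF r] s]] by simp
next
  case (14 x y)
  then obtain r s where r: "reps x r" and s: "reps y s" by auto
  have "(\<lambda>n. cnj (B (s n) (r n))) \<longlonglongrightarrow> cnj (kinner y x)"
    by (rule tendsto_cnj[OF kinner_tendsto[OF s r]])
  then show ?case using LIMSEQ_unique[OF kinner_tendsto[OF r s]] by (simp add: B_commute[symmetric])
next
  case (15 x)
  then obtain r where r: "reps x r" by auto
  show ?case using LIMSEQ_le_const[OF tendsto_Re[OF kinner_tendsto[OF r r]], of 0] pos by simp
next
  \<comment> \<open>Definiteness: by Cauchy--Schwarz a null vector has vanishing inner products with
    all points, and these are its values.\<close>
  case (16 F)
  then obtain s where s: "reps F s" by auto
  then have n0: "(\<lambda>n. sn (s n)) \<longlonglongrightarrow> 0" using hnorm_tendsto[OF s] 16 by (simp add: hnorm_def)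
  have "F x = 0" for x
  proof -
    have "(\<lambda>n. B (s n) [(1, x)]) \<longlonglongrightarrow> 0"
    proof (rule Lim_null_comparison)
      show "\<forall>\<^sub>F n in sequentially. norm (B (s n) [(1, x)]) \<le> sn (s n) * sn [(1, x)]"
        by (simp add: B_cauchy_schwarz)
      show "(\<lambda>n. sn (s n) * sn [(1, x)]) \<longlonglongrightarrow> 0" using tendsto_mult_left_zero[OF n0] by simp
    qed
    then show ?thesis using s by (auto simp: reps_def intro: LIMSEQ_unique)
  qed
  then show ?case by auto
next
  case (17 s)
  have "\<exists>G t. reps G t \<and> (\<lambda>n. hnorm kspace (\<lambda>x. s n x - G x)) \<longlonglongrightarrow> 0"
    using 17 by (intro kspace_complete) simp_all
  then show ?case unfolding kspace_simps by blast
qed (auto simp: algebra_simps)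

end

section \<open>Normal operators induced by maps of the points\<close>

lemma kform_lmap:
  assumes "\<And>x y. k (f x) y = k x (g y)"
  shows "kform k (lmap f xs) ys = kform k xs (lmap g ys)"
  by (simp add: kform_def lmap_def o_def assms)

lemma lmap_lmap: "lmap f (lmap g xs) = lmap (\<lambda>x. f (g x)) xs"
  by (simp add: lmap_def o_def)

lemma lmap_lsub: "lmap f (lsub xs ys) = lsub (lmap f xs) (lmap f ys)"
  by (simp add: lmap_def lsub_def lscale_def)

text \<open>Composing a function with \<open>D\<close> takes its inner products with moved points,
  so this composition extends the linear action of \<open>D'\<close> to the completion; see
  \<open>reps_D\<close>. In \<open>growth\<close> the bound \<open>M\<close> may depend on the list,
  so boundedness of this action still has to be derived.\<close>

locale normal_kernel = pos_kernel k for k :: "'x \<Rightarrow> 'x \<Rightarrow> complex" +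
  fixes D D' :: "'x \<Rightarrow> 'x" and c :: real
  assumes adj: "k (D x) y = k x (D' y)"
    and comm: "D (D' x) = D' (D x)"
    and c_pos: "c > 0"
    and growth: "\<exists>M. \<forall>m. Re (B (lmap (D' ^^ m) zs) (lmap (D' ^^ m) zs)) \<le> M * c ^ m"
begin

lemma adj': "k (D' x) y = k x (D y)"
  by (metis adj hermitian)

lemma B_D: "B (lmap D xs) ys = B xs (lmap D' ys)"
  by (rule kform_lmap) (rule adj)

lemma B_D': "B (lmap D' xs) ys = B xs (lmap D ys)"
  by (rule kform_lmap) (rule adj')

text \<open>With \<open>T = D \<circ> D'\<close>, which is symmetric for the kernel, the squared
  seminorm of the m-th image under \<open>D'\<close> is the form of \<open>zs\<close> with its image
  under \<open>T ^^ m\<close>. Cauchy--Schwarz then gives the hypothesis \<open>sq\<close> of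
  \<open>le_of_growth\<close>, which turns a growth depending on the list into a uniform
  bound.\<close>

lemma sn_D'_sq: "(sn (lmap D' zs))\<^sup>2 \<le> c * (sn zs)\<^sup>2"
proof -
  define T where "T = D \<circ> D'"
  have DD: "(D' ^^ m) (D x) = D ((D' ^^ m) x)" for m x by (induction m) (auto simp: comm)
  have Tm: "(T ^^ m) x = (D ^^ m) ((D' ^^ m) x)" for m x
  proof (induction m arbitrary: x)
    case (Suc m)
    have "(T ^^ Suc m) x = (T ^^ m) (T x)" by (metis comp_apply funpow_Suc_right)
    also have "\<dots> = (D ^^ m) ((D' ^^ m) (T x))" by (rule Suc)
    also have "\<dots> = (D ^^ Suc m) ((D' ^^ Suc m) x)"
      by (simp add: T_def DD funpow_swap1)
    finally show ?case .
  qed simp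
  have adjm: "k ((D' ^^ m) x) y = k x ((D ^^ m) y)" for m x y
    by (induction m arbitrary: x y) (auto simp: adj' funpow_swap1)
  have adjT: "k ((T ^^ m) x) y = k x ((T ^^ m) y)" for m x y
  proof (induction m arbitrary: x y)
    case (Suc m)
    have "k ((T ^^ Suc m) x) y = k ((T ^^ m) x) (T y)" by (simp add: T_def adj adj' comm)
    then show ?case using Suc by (simp add: funpow_swap1)
  qed simp
  define a where "a m = Re (B (lmap (D' ^^ m) zs) (lmap (D' ^^ m) zs))" for m
  have a: "a m = Re (B zs (lmap (T ^^ m) zs))" for m
    by (simp add: a_def kform_lmap[of k "D' ^^ m" "D ^^ m", OF adjm] lmap_lmap flip: Tm)
  obtain M where M: "\<And>m. a m \<le> M * c ^ m" using growth unfolding a_def by blast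
  have "(a m)\<^sup>2 \<le> a 0 * a (2 * m)" for m
  proof -
    have "(a m)\<^sup>2 \<le> (cmod (B zs (lmap (T ^^ m) zs)))\<^sup>2"
      unfolding a by (rule abs_le_square_iff[THEN iffD1]) (simp add: abs_Re_le_cmod)
    also have "\<dots> \<le> (sn zs * sn (lmap (T ^^ m) zs))\<^sup>2"
      using B_cauchy_schwarz by (intro power_mono) auto
    also have "\<dots> = Re (B zs zs) * Re (B (lmap (T ^^ m) zs) (lmap (T ^^ m) zs))"
      by (simp add: sn_def power_mult_distrib pos)
    also have "B (lmap (T ^^ m) zs) (lmap (T ^^ m) zs) = B zs (lmap (T ^^ (2 * m)) zs)"
      by (simp add: kform_lmap[of k "T ^^ m" "T ^^ m", OF adjT] lmap_lmap mult_2 funpow_add o_def)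
    finally show ?thesis by (simp add: a[symmetric]) (simp add: a lmap_def)
  qed
  from le_of_growth[of a, OF _ this M c_pos] have "a 1 \<le> c * a 0" by (simp add: a_def pos)
  then show ?thesis by (simp add: a_def sn_def pos lmap_def)
qed

lemma sn_D': "sn (lmap D' zs) \<le> sqrt c * sn zs"
  using real_sqrt_le_mono[OF sn_D'_sq[of zs]] sn_nonneg by (simp add: real_sqrt_mult)

text \<open>This is where commutation enters: it transfers the bound for \<open>D'\<close> to
  \<open>D\<close>.\<close>

lemma sn_D: "sn (lmap D zs) = sn (lmap D' zs)"
  by (simp add: sn_def B_D B_D' lmap_lmap comm)

lemma reps_D: "reps F s \<Longrightarrow> reps (\<lambda>x. F (D x)) (\<lambda>n. lmap D' (s n))"
  using cauchy_linear[of s "lmap D'" "sqrt c"] sn_D'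
  by (auto simp: reps_def B_D' lmap_lsub[symmetric]) (simp add: lmap_def)

lemma reps_D': "reps F s \<Longrightarrow> reps (\<lambda>x. F (D' x)) (\<lambda>n. lmap D (s n))"
  using cauchy_linear[of s "lmap D" "sqrt c"] sn_D' sn_D
  by (auto simp: reps_def B_D lmap_lsub[symmetric]) (simp add: lmap_def)

lemma normal_op_D: "normal_op kspace (\<lambda>F x. F (D x))"
proof -
  have "hnorm kspace (\<lambda>x. F (D x)) \<le> sqrt c * hnorm kspace F" if "reps F s" for F s
    by (rule LIMSEQ_le[OF hnorm_tendsto[OF reps_D[OF that]] tendsto_mult[OF tendsto_const hnorm_tendsto[OF that]]])
      (auto intro: sn_D')
  moreover have "linear_map kspace kspace (\<lambda>F x. F (D x))"
    unfolding linear_map_def kspace_simps using reps_D by blast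
  ultimately have "bounded_op kspace (\<lambda>F x. F (D x))"
    unfolding bounded_op_def by auto
  moreover have "kinner (\<lambda>x. F (D x)) G = kinner F (\<lambda>x. G (D' x))" if F: "reps F s" and G: "reps G t" for F G s t
    using kinner_tendsto[OF reps_D[OF F] G] LIMSEQ_unique[OF kinner_tendsto[OF F reps_D'[OF G]]]
    by (simp add: B_D')
  then have "is_adjoint kspace (\<lambda>F x. F (D x)) (\<lambda>F x. F (D' x))"
    unfolding is_adjoint_def kspace_simps using reps_D' by blast
  ultimately show ?thesis unfolding normal_op_def by (auto simp: comm)
qed

end

section \<open>The Bram--Halmos criterion\<close>

lemma linear_map_pow:
  assumes "linear_map H H A"
  shows "linear_map H H (A ^^ n)"
  using assms by (induction n) (auto simp: linear_map_def)

lemma growth_sum_list: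
  fixes c :: real and F :: "'p \<Rightarrow> nat \<Rightarrow> complex"
  assumes "\<And>p. p \<in> set xs \<Longrightarrow> \<exists>M. \<forall>m. cmod (F p m) \<le> M * c ^ m"
  shows "\<exists>M. \<forall>m. cmod (\<Sum>p\<leftarrow>xs. F p m) \<le> M * c ^ m"
  using assms
proof (induction xs)
  case Nil
  then show ?case by (auto intro: exI[of _ 0])
next
  case (Cons p xs)
  then obtain M M' where "\<And>m. cmod (F p m) \<le> M * c ^ m" "\<And>m. cmod (\<Sum>p\<leftarrow>xs. F p m) \<le> M' * c ^ m"
    by fastforce
  then have "cmod (\<Sum>p\<leftarrow>p # xs. F p m) \<le> (M + M') * c ^ m" for m
    using norm_triangle_mono by (fastforce simp: algebra_simps)
  then show ?case by blast
qed

context complex_hilbert_space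
begin

lemma hnorm_nonneg: "x \<in> hcarrier H \<Longrightarrow> 0 \<le> hnorm H x"
  using inner_nonneg by (simp add: hnorm_def)

lemma bounded_op_powE:
  assumes "bounded_op H A"
  obtains C where "C \<ge> 1" "\<And>n x. x \<in> hcarrier H \<Longrightarrow> hnorm H ((A ^^ n) x) \<le> C ^ n * hnorm H x"
proof -
  obtain C0 where C0: "\<And>x. x \<in> hcarrier H \<Longrightarrow> hnorm H (A x) \<le> C0 * hnorm H x"
    using assms by (auto simp: bounded_op_def)
  define C where "C = max 1 C0"
  have C: "hnorm H (A x) \<le> C * hnorm H x" if "x \<in> hcarrier H" for x
    using C0[OF that] hnorm_nonneg[OF that] unfolding C_def
    by (meson max.cobounded2 mult_right_mono order_trans)
  have cl: "(A ^^ n) x \<in> hcarrier H" if "x \<in> hcarrier H" for n x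
    using assms linear_map_pow[of H A n] that by (auto simp: bounded_op_def linear_map_def)
  have "hnorm H ((A ^^ n) x) \<le> C ^ n * hnorm H x" if x: "x \<in> hcarrier H" for n x
  proof (induction n)
    case (Suc n)
    have "hnorm H ((A ^^ Suc n) x) \<le> C * hnorm H ((A ^^ n) x)" using C[OF cl[OF x]] by simp
    also have "\<dots> \<le> C * (C ^ n * hnorm H x)" using Suc by (intro mult_left_mono) (auto simp: C_def)
    finally show ?case by (simp add: mult.assoc)
  qed simp
  then show thesis using that[of C] by (simp add: C_def)
qed

text \<open>The pair \<open>(i, f)\<close> stands for the vector \<open>N\<^sup>*\<^sup>i f\<close> of the normal extension to be
  constructed, since \<open>\<langle>N\<^sup>*\<^sup>i f, N\<^sup>*\<^sup>j g\<rangle> = \<langle>N\<^sup>j f, N\<^sup>i g\<rangle>\<close>.\<close>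

theorem bram_halmos:
  assumes A: "bounded_op H A"
    and pos: "\<And>zs. set zs \<subseteq> UNIV \<times> hcarrier H \<Longrightarrow>
      0 \<le> Re (\<Sum>p\<leftarrow>zs. \<Sum>q\<leftarrow>zs. hinner H ((A ^^ fst q) (snd p)) ((A ^^ fst p) (snd q)))"
  shows "subnormal H A"
proof -
  \<comment> \<open>The kernel has to be total on the type and positive on all lists, so vectors
    outside the carrier are read as zero.\<close>
  define pr where "pr f = (if f \<in> hcarrier H then f else hzero H)" for f
  have pr: "pr f \<in> hcarrier H" for f by (simp add: pr_def zero_closed)
  have pr_id: "f \<in> hcarrier H \<Longrightarrow> pr f = f" for f by (simp add: pr_def)
  have lin: "linear_map H H (A ^^ n)" for n
    using A by (simp add: linear_map_pow bounded_op_def)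
  have cl: "(A ^^ n) x \<in> hcarrier H" if "x \<in> hcarrier H" for n x
    using lin[of n] that by (simp add: linear_map_def)
  have cl1: "A x \<in> hcarrier H" if "x \<in> hcarrier H" for x using cl[of x 1] that by simp
  obtain C where C: "C \<ge> 1" "\<And>n x. x \<in> hcarrier H \<Longrightarrow> hnorm H ((A ^^ n) x) \<le> C ^ n * hnorm H x"
    using bounded_op_powE[OF A] by blast
  define k where "k p q = hinner H ((A ^^ fst q) (pr (snd p))) ((A ^^ fst p) (pr (snd q)))" for p q
  \<comment> \<open>On the vectors that pairs stand for, \<open>D\<close> applies the adjoint of the
    normal extension N, and \<open>D'\<close> applies N itself, since N N*^i f = N*^i (A f).\<close>
  define D :: "nat \<times> 'a \<Rightarrow> nat \<times> 'a" where "D p = (Suc (fst p), snd p)" for p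
  define D' :: "nat \<times> 'a \<Rightarrow> nat \<times> 'a" where "D' p = (fst p, A (pr (snd p)))" for p
  have D'm: "fst ((D' ^^ m) p) = fst p" "pr (snd ((D' ^^ m) p)) = (A ^^ m) (pr (snd p))" for m p
    by (induction m) (auto simp: D'_def cl cl1 pr pr_id)
  interpret pos_kernel k
  proof
    show "k x y = cnj (k y x)" for x y
      unfolding k_def by (rule inner_commute) (simp_all add: cl pr)
    show "0 \<le> Re (kform k xs xs)" for xs
    proof -
      \<comment> \<open>The positivity hypothesis has no coefficients; they are absorbed into the
        vectors.\<close>
      define zs where "zs = map (\<lambda>p. (fst (snd p), hscale H (fst p) (pr (snd (snd p))))) xs"
      have "hinner H ((A ^^ j) (hscale H c f)) ((A ^^ i) (hscale H d g))
          = c * cnj d * hinner H ((A ^^ j) f) ((A ^^ i) g)"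
        if "f \<in> hcarrier H" "g \<in> hcarrier H" for i j c d f g
        using lin[of i] lin[of j] that
        by (simp add: linear_map_def inner_scale inner_scale_right cl scale_closed)
      then have "(\<Sum>p\<leftarrow>zs. \<Sum>q\<leftarrow>zs. hinner H ((A ^^ fst q) (snd p)) ((A ^^ fst p) (snd q))) = kform k xs xs"
        by (simp add: zs_def kform_def k_def pr o_def)
      moreover have "set zs \<subseteq> UNIV \<times> hcarrier H" by (auto simp: zs_def scale_closed pr)
      ultimately show ?thesis using pos[of zs] by simp
    qed
  qed
  \<comment> \<open>Applying \<open>D'\<close> m times inserts m further powers of \<open>A\<close>
    into both arguments of the inner product, each at the cost of \<open>C ^ m\<close>.\<close>
  interpret normal_kernel k D D' "C\<^sup>2"
  proof
    show "k (D x) y = k x (D' y)" for x y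
      by (simp add: k_def D_def D'_def pr_id cl1 pr funpow_swap1)
    show "D (D' x) = D' (D x)" for x by (simp add: D_def D'_def)
    show "C\<^sup>2 > 0" using C by simp
    show "\<exists>M. \<forall>m. Re (kform k (lmap (D' ^^ m) zs) (lmap (D' ^^ m) zs)) \<le> M * (C\<^sup>2) ^ m" for zs
    proof -
      have "cmod (fst p * cnj (fst q) * k ((D' ^^ m) (snd p)) ((D' ^^ m) (snd q)))
          \<le> cmod (fst p) * cmod (fst q) * (C ^ fst (snd q) * hnorm H (pr (snd (snd p))))
            * (C ^ fst (snd p) * hnorm H (pr (snd (snd q)))) * (C\<^sup>2) ^ m" for p q m
      proof -
        obtain c i f d j g where pq: "p = (c, i, f)" "q = (d, j, g)" by (metis prod.collapse)
        have "cmod (k ((D' ^^ m) (i, f)) ((D' ^^ m) (j, g)))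
            = cmod (hinner H ((A ^^ (j + m)) (pr f)) ((A ^^ (i + m)) (pr g)))"
          by (simp add: k_def D'm funpow_add)
        also have "\<dots> \<le> hnorm H ((A ^^ (j + m)) (pr f)) * hnorm H ((A ^^ (i + m)) (pr g))"
          by (intro cauchy_schwarz cl pr)
        also have "\<dots> \<le> (C ^ (j + m) * hnorm H (pr f)) * (C ^ (i + m) * hnorm H (pr g))"
          using C(1) by (intro mult_mono C(2) pr hnorm_nonneg cl mult_nonneg_nonneg) auto
        also have "\<dots> = (C ^ j * hnorm H (pr f)) * (C ^ i * hnorm H (pr g)) * (C\<^sup>2) ^ m"
          by (simp add: power_add power2_eq_square power_mult_distrib ac_simps)
        finally have *: "cmod (k ((D' ^^ m) (i, f)) ((D' ^^ m) (j, g)))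
          \<le> (C ^ j * hnorm H (pr f)) * (C ^ i * hnorm H (pr g)) * (C\<^sup>2) ^ m" .
        have "cmod c * cmod d * cmod (k ((D' ^^ m) (i, f)) ((D' ^^ m) (j, g)))
          \<le> cmod c * cmod d * ((C ^ j * hnorm H (pr f)) * (C ^ i * hnorm H (pr g)) * (C\<^sup>2) ^ m)"
          by (intro mult_left_mono * mult_nonneg_nonneg norm_ge_zero)
        then show ?thesis by (simp add: pq norm_mult mult.assoc)
      qed
      then have "\<exists>M. \<forall>m. cmod (fst p * cnj (fst q) * k ((D' ^^ m) (snd p)) ((D' ^^ m) (snd q)))
          \<le> M * (C\<^sup>2) ^ m" for p q by blast
      then have "\<exists>M. \<forall>m. cmod (\<Sum>p\<leftarrow>zs. \<Sum>q\<leftarrow>zs. fst p * cnj (fst q)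
          * k ((D' ^^ m) (snd p)) ((D' ^^ m) (snd q))) \<le> M * (C\<^sup>2) ^ m"
        by (intro growth_sum_list)
      then obtain M where "\<And>m. cmod (kform k (lmap (D' ^^ m) zs) (lmap (D' ^^ m) zs)) \<le> M * (C\<^sup>2) ^ m"
        by (auto simp: kform_def lmap_def o_def)
      then show ?thesis using complex_Re_le_cmod order_trans by blast
    qed
  qed
  define J where "J h = point [(1, (0, h))]" for h
  have J: "J h q = hinner H ((A ^^ fst q) h) (pr (snd q))" if "h \<in> hcarrier H" for h q
    using that by (simp add: J_def point_def kform_def k_def pr_id)
  have "linear_map H kspace J"
    unfolding linear_map_def
  proof (intro conjI ballI allI)
    show "J x \<in> hcarrier kspace" for x using reps_point by (auto simp: J_def)
    show "J (hadd H x y) = hadd kspace (J x) (J y)" if "x \<in> hcarrier H" "y \<in> hcarrier H" for x y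
      using that lin by (auto simp: J add_closed linear_map_def inner_add cl pr fun_eq_iff)
    show "J (hscale H c x) = hscale kspace c (J x)" if "x \<in> hcarrier H" for c x
      using that lin by (auto simp: J scale_closed linear_map_def inner_scale cl pr fun_eq_iff)
  qed
  moreover have "hinner kspace (J x) (J y) = hinner H x y"
    if "x \<in> hcarrier H" "y \<in> hcarrier H" for x y
    using that by (simp add: J_def kinner_point kform_def k_def pr_id)
  ultimately have "isometric_embedding H kspace J" by (simp add: isometric_embedding_def)
  moreover have "\<forall>h\<in>hcarrier H. J (A h) = (\<lambda>x. J h (D x))"
    by (auto simp: J cl1 D_def funpow_swap1)
  ultimately have "normal_extension H A kspace (\<lambda>F x. F (D x)) J"
    unfolding normal_extension_def using kspace_hilbert normal_op_D by simp
  then show ?thesis by (rule subnormal_if_normal_extension[OF A])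
qed

end

section \<open>Embry's criterion\<close>

text \<open>The Riesz functional of \<open>t\<close>: the linear map on polynomials that sends
  \<open>x^n\<close> to \<open>t n\<close>. Its values lie in a real vector space so that it also
  applies to sequences of complex inner products.\<close>

definition mf :: "(nat \<Rightarrow> 'a :: real_vector) \<Rightarrow> real poly \<Rightarrow> 'a" where
  "mf t p = (\<Sum>i\<le>degree p. coeff p i *\<^sub>R t i)"

lemma mf_eq: "degree p \<le> n \<Longrightarrow> mf t p = (\<Sum>i\<le>n. coeff p i *\<^sub>R t i)"
  unfolding mf_def by (rule sum.mono_neutral_left) (auto simp: coeff_eq_0 not_le)

lemma mf_add: "mf t (p + q) = mf t p + mf t q"
proof -
  let ?n = "max (degree p) (degree q)"
  have "mf t (p + q) = (\<Sum>i\<le>?n. coeff (p + q) i *\<^sub>R t i)" by (rule mf_eq) (simp add: degree_add_le_max)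
  then show ?thesis by (simp add: mf_eq[of p ?n] mf_eq[of q ?n] scaleR_add_left sum.distrib)
qed

lemma mf_smult: "mf t (smult a p) = a *\<^sub>R mf t p"
  using degree_smult_le[of a p] by (simp add: mf_eq[of "smult a p" "degree p"] mf_def scaleR_sum_right)

lemma mf_0 [simp]: "mf t 0 = 0"
  by (simp add: mf_def)

lemma mf_diff: "mf t (p - q) = mf t p - mf t q"
  using mf_add[of t p "smult (- 1) q"] mf_smult[of t "- 1" q] by simp

lemma mf_sum: "mf t (sum f A) = (\<Sum>a\<in>A. mf t (f a))"
  by (induction A rule: infinite_finite_induct) (auto simp: mf_add)

lemma mf_pCons: "mf t (pCons a p) = a *\<^sub>R t 0 + mf (\<lambda>n. t (Suc n)) p"
proof -
  have "mf t (pCons a p) = (\<Sum>i\<le>Suc (degree p). coeff (pCons a p) i *\<^sub>R t i)"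
    by (rule mf_eq) (rule degree_pCons_le)
  then show ?thesis by (simp add: sum.atMost_Suc_shift mf_def del: sum.atMost_Suc)
qed

lemma mf_monom_mult: "mf t (monom 1 k * p) = mf (\<lambda>n. t (n + k)) p"
  by (induction k arbitrary: t) (auto simp: monom_Suc mf_pCons monom_0)

lemma mf_monom: "mf t (monom 1 k) = t k"
  using mf_monom_mult[of t k 1] by (simp add: mf_def)

lemma Re_sum_list: "Re (\<Sum>x\<leftarrow>xs. f x) = (\<Sum>x\<leftarrow>xs. Re (f x))"
  by (induction xs) auto

lemma sum_list_pairs_filter:
  fixes f :: "'p \<Rightarrow> 'p \<Rightarrow> 'b :: ab_group_add"
  shows "(\<Sum>p\<leftarrow>xs. \<Sum>q\<leftarrow>xs. if P p \<and> P q then f p q else 0)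
    = (\<Sum>p\<leftarrow>filter P xs. \<Sum>q\<leftarrow>filter P xs. f p q)"
proof -
  have *: "(\<Sum>q\<leftarrow>ys. if P q then g q else 0) = (\<Sum>q\<leftarrow>filter P ys. g q)" for ys and g :: "'p \<Rightarrow> 'b"
    by (induction ys) auto
  have "(\<Sum>q\<leftarrow>xs. if P p \<and> P q then f p q else 0) = (if P p then \<Sum>q\<leftarrow>filter P xs. f p q else 0)" for p
    using *[of "f p" xs] by (cases "P p") simp_all
  then show ?thesis by (simp add: *)
qed

text \<open>Bernoulli's inequality replaces the linear factor by (2 - s)^k, and (2 - s) s = 1 - (1 -
  s)^2 is at most 1.\<close>

lemma power_mult_le:
  fixes s :: real
  assumes "0 \<le> s" "s \<le> 1"
  shows "real k * ((1 - s) * s ^ k) \<le> 1"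
proof -
  have "(1 + real k * (1 - s)) * s ^ k \<le> (1 + (1 - s)) ^ k * s ^ k"
    using assms by (intro mult_right_mono Bernoulli_inequality) auto
  also have "\<dots> = (1 - (1 - s)\<^sup>2) ^ k"
    by (simp add: power_mult_distrib[symmetric] power2_eq_square algebra_simps)
  also have "\<dots> \<le> 1" using assms by (intro power_le_one) (auto simp: power_le_one)
  finally show ?thesis using assms by (simp add: algebra_simps) (smt (verit) zero_le_power)
qed

text \<open>With \<open>s = 1 - x / c\<close> the multiple of \<open>x\<^sup>n\<close> is \<open>(1 - s\<^sup>k)\<^sup>n\<close>.\<close>

lemma one_decomposition:
  fixes c :: real and k n :: nat
  assumes c: "c > 0" and k: "k > 0"
  obtains P \<theta> :: "real poly" where "1 = monom 1 n * P + \<theta>"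
    and "\<And>x. \<lbrakk>0 \<le> x; x \<le> c\<rbrakk> \<Longrightarrow> 0 \<le> poly P x"
    and "\<And>x. \<lbrakk>0 \<le> x; x \<le> c\<rbrakk> \<Longrightarrow> 0 \<le> poly \<theta> x \<and> poly \<theta> x \<le> 1 \<and> x * poly \<theta> x \<le> n * c / k"
proof
  define r :: "real poly" where "r = [:1, - (1 / c):]"
  \<comment> \<open>This is the polynomial (1 - r^k) / x, written as a geometric sum to make its
    nonnegativity on [0, c] visible.\<close>
  define g where "g = smult (1 / c) (\<Sum>l<k. r ^ l)"
  have r: "poly r x = 1 - x / c" for x by (simp add: r_def)
  have "1 - r ^ k = (1 - r) * (\<Sum>l<k. r ^ l)" by (rule one_diff_power_eq)
  also have "1 - r = smult (1 / c) (monom 1 1)" by (simp add: r_def monom_altdef one_pCons)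
  finally have g: "monom 1 1 * g = 1 - r ^ k" by (simp add: g_def)
  have "monom 1 n * g ^ n = (1 - r ^ k) ^ n"
    by (simp add: g[symmetric] power_mult_distrib monom_power)
  then show "1 = monom 1 n * g ^ n + (1 - (1 - r ^ k) ^ n)" by simp
  fix x assume x: "0 \<le> x" "x \<le> c"
  define s where "s = 1 - x / c"
  have s: "0 \<le> s" "s \<le> 1" "poly r x = s" "x = c * (1 - s)" using x c by (auto simp: s_def r)
  show "0 \<le> poly (g ^ n) x" using s c by (simp add: g_def poly_sum sum_nonneg)
  have sk: "0 \<le> s ^ k" "s ^ k \<le> 1" using s by (auto simp: power_le_one)
  have th: "poly (1 - (1 - r ^ k) ^ n) x = 1 - (1 - s ^ k) ^ n" by (simp add: s(3))
  \<comment> \<open>At x = 0 the remainder equals 1 unless n = 0, so it is not small itself.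
    Bernoulli bounds it by n s^k, and the factor x = c (1 - s) brings in
    \<open>power_mult_le\<close>.\<close>
  have "1 - (1 - s ^ k) ^ n \<le> n * s ^ k"
    using Bernoulli_inequality[of "- (s ^ k)" n] sk by simp
  then have "x * (1 - (1 - s ^ k) ^ n) \<le> x * (n * s ^ k)" using x by (intro mult_left_mono) auto
  also have "\<dots> = n * c / k * (k * ((1 - s) * s ^ k))" using s(4) k by simp
  also have "\<dots> \<le> n * c / k * 1" using power_mult_le[OF s(1,2), of k] c by (intro mult_left_mono) auto
  finally show "0 \<le> poly (1 - (1 - r ^ k) ^ n) x \<and> poly (1 - (1 - r ^ k) ^ n) x \<le> 1
      \<and> x * poly (1 - (1 - r ^ k) ^ n) x \<le> n * c / k"
    unfolding th using sk by (simp add: power_le_one)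
qed

text \<open>Embry's condition (with a polynomial density) implies the Bram--Halmos condition. The form
  \<open>W p\<close> should be thought of as \<open>\<langle>p(R) f, g\<rangle>\<close> for a positive operator \<open>R\<close> with spectrum in
  \<open>[0, c]\<close> that commutes with \<open>A\<close> and satisfies \<open>\<langle>R\<^sup>n f, g\<rangle> = \<langle>A\<^sup>n f, A\<^sup>n g\<rangle>\<close>.\<close>

theorem (in complex_hilbert_space) subnormal_if_embry:
  assumes A: "bounded_op H A" and c: "c > 0"
    and embry: "\<And>zs P. \<lbrakk>set zs \<subseteq> UNIV \<times> hcarrier H; \<And>x. \<lbrakk>0 \<le> x; x \<le> c\<rbrakk> \<Longrightarrow> 0 \<le> poly P x\<rbrakk> \<Longrightarrow>
      0 \<le> Re (\<Sum>p\<leftarrow>zs. \<Sum>q\<leftarrow>zs. mf (\<lambda>n. hinner H ((A ^^ n) (snd p)) ((A ^^ n) (snd q)))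
        (monom 1 (fst p + fst q) * P))"
  shows "subnormal H A"
proof (rule bram_halmos[OF A])
  fix zs :: "(nat \<times> 'a) list" assume zs: "set zs \<subseteq> UNIV \<times> hcarrier H"
  define W where "W P f g = mf (\<lambda>n. hinner H ((A ^^ n) f) ((A ^^ n) g)) P" for P f g
  note emb = embry[folded W_def]
  have lin: "linear_map H H (A ^^ n)" for n
    using A by (simp add: linear_map_pow bounded_op_def)
  have cl: "(A ^^ n) x \<in> hcarrier H" if "x \<in> hcarrier H" for n x
    using lin[of n] that by (simp add: linear_map_def)
  have zsc: "snd p \<in> hcarrier H" if "p \<in> set zs" for p using zs that by auto
  have W_shift: "W (monom 1 n * P) f g = W P ((A ^^ n) f) ((A ^^ n) g)" for n P f g
    by (simp add: W_def mf_monom_mult funpow_add)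
  have W_add: "W (P + Q) f g = W P f g + W Q f g" for P Q f g by (simp add: W_def mf_add)
  have W_diff: "W (P - Q) f g = W P f g - W Q f g" for P Q f g by (simp add: W_def mf_diff)
  have W_one: "W 1 f g = hinner H f g" for f g by (simp add: W_def mf_def)
  have W_const: "W [:a:] f g = a * hinner H f g" for a f g by (simp add: W_def mf_def scaleR_conv_of_real)
  have W_herm: "W P g f = cnj (W P f g)" if "f \<in> hcarrier H" "g \<in> hcarrier H" for P f g
    using inner_commute[OF cl[OF that(2)] cl[OF that(1)]] by (simp add: W_def mf_def scaleR_conv_of_real)
  have W_addL: "W P (hadd H f h) g = W P f g + W P h g"
    if "f \<in> hcarrier H" "g \<in> hcarrier H" "h \<in> hcarrier H" for P f g h
    using lin that by (simp add: W_def mf_def linear_map_def inner_add cl scaleR_add_right sum.distrib)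
  have W_scaleL: "W P (hscale H a f) g = a * W P f g"
    if "f \<in> hcarrier H" "g \<in> hcarrier H" for P f g a
    using lin that
    by (simp add: W_def mf_def linear_map_def inner_scale cl scaleR_conv_of_real sum_distrib_left ac_simps)
  have W_nonneg: "0 \<le> Re (W P f f)"
    if "f \<in> hcarrier H" "\<And>x. \<lbrakk>0 \<le> x; x \<le> c\<rbrakk> \<Longrightarrow> 0 \<le> poly P x" for P f
    using emb[of "[(0, f)]" P] that by (simp add: monom_0)
  have W_mono: "Re (W P f f) \<le> Re (W Q f f)"
    if "f \<in> hcarrier H" "\<And>x. \<lbrakk>0 \<le> x; x \<le> c\<rbrakk> \<Longrightarrow> poly P x \<le> poly Q x" for P Q f
    using W_nonneg[of f "Q - P"] that by (simp add: W_diff)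
  have W_cs: "(cmod (W P f g))\<^sup>2 \<le> Re (W P f f) * Re (W P g g)"
    if f: "f \<in> hcarrier H" and g: "g \<in> hcarrier H"
      and P: "\<And>x. \<lbrakk>0 \<le> x; x \<le> c\<rbrakk> \<Longrightarrow> 0 \<le> poly P x" for P f g
  proof -
    have "0 \<le> Re (W P f f) + 2 * Re (a * cnj (W P f g)) + (cmod a)\<^sup>2 * Re (W P g g)" for a
    proof -
      define h where "h = hscale H a g"
      have h: "h \<in> hcarrier H" using g by (simp add: h_def scale_closed)
      have hf: "W P h f = a * cnj (W P f g)" using f g by (simp add: h_def W_scaleL W_herm[OF f g])
      have "W P h h = a * cnj a * W P g g"
        using W_scaleL[OF g h, of P a] W_herm[OF h g, of P] W_scaleL[OF g g, of P a] W_herm[OF g g, of P]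
        by (simp add: h_def)
      then have "Re (W P h h) = (cmod a)\<^sup>2 * Re (W P g g)"
        unfolding complex_norm_square[symmetric] by simp
      moreover have "Re (W P f h) = Re (W P h f)" using W_herm[OF h f, of P] by simp
      moreover have "Re (W P (hadd H f h) (hadd H f h)) = Re (W P f f) + Re (W P h f) + Re (W P f h) + Re (W P h h)"
        using W_addL[OF f add_closed[OF f h] h, of P] W_herm[OF add_closed[OF f h] f, of P]
          W_herm[OF add_closed[OF f h] h, of P] W_addL[OF f f h, of P] W_addL[OF f h h, of P] by simp
      moreover have "0 \<le> Re (W P (hadd H f h) (hadd H f h))" by (rule W_nonneg[OF add_closed[OF f h] P])
      ultimately show ?thesis unfolding hf by linarith
    qed
    from cauchy_schwarz_quadratic[OF this] show ?thesis by simp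
  qed
  define n where "n = 2 * sum_list (map fst zs)"
  have n: "fst p + fst q \<le> n" if "p \<in> set zs" "q \<in> set zs" for p q
    using member_le_sum_list[of "fst p" "map fst zs"] member_le_sum_list[of "fst q" "map fst zs"] that
    by (simp add: n_def)
  \<comment> \<open>The Bram--Halmos form with the polynomial \<open>P\<close> of the imagined
    operator inserted; \<open>Q 1\<close> is the form to be shown nonnegative.\<close>
  define Q where "Q P = (\<Sum>p\<leftarrow>zs. \<Sum>q\<leftarrow>zs. W P ((A ^^ fst q) (snd p)) ((A ^^ fst p) (snd q)))" for P
  have Q_add: "Q (P + P') = Q P + Q P'" for P P' by (simp add: Q_def W_add sum_list_addf)
  have Q_monom: "0 \<le> Re (Q (monom 1 n * P))"
    if P: "\<And>x. \<lbrakk>0 \<le> x; x \<le> c\<rbrakk> \<Longrightarrow> 0 \<le> poly P x" for P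
  proof -
    \<comment> \<open>The factor x^n raises both exponents by n, and
      \<open>n + fst q = fst p + fst q + (n - fst p)\<close>. So the Bram--Halmos form turns into an
      Embry form of the vectors \<open>(A ^^ (n - fst p)) (snd p)\<close>; \<open>n\<close> is large
      enough for the subtractions to be genuine.\<close>
    define ys where "ys = map (\<lambda>p. (fst p, (A ^^ (n - fst p)) (snd p))) zs"
    have ys: "set ys \<subseteq> UNIV \<times> hcarrier H" using zsc cl by (auto simp: ys_def)
    have "W (monom 1 n * P) ((A ^^ fst q) (snd p)) ((A ^^ fst p) (snd q))
        = W (monom 1 (fst p + fst q) * P) ((A ^^ (n - fst p)) (snd p)) ((A ^^ (n - fst q)) (snd q))"
      if "p \<in> set zs" "q \<in> set zs" for p q
    proof -
      have pow: "(A ^^ i) ((A ^^ j) f) = (A ^^ (i + j)) f" for i j f by (simp add: funpow_add)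
      have "n + fst q = fst p + fst q + (n - fst p)" "n + fst p = fst p + fst q + (n - fst q)"
        using n[OF that] by auto
      then show ?thesis by (simp only: W_shift pow)
    qed
    then have "Q (monom 1 n * P) = (\<Sum>p\<leftarrow>ys. \<Sum>q\<leftarrow>ys. W (monom 1 (fst p + fst q) * P) (snd p) (snd q))"
      unfolding Q_def ys_def by (simp add: o_def cong: map_cong)
    then show ?thesis using emb[OF ys P] by simp
  qed
  \<comment> \<open>One \<open>A\<close> is stripped from the first argument, or from the second if
    the first carries none. For \<open>fst p = fst q = 0\<close>, where \<open>0 - 1 = 0\<close>,
    the value is merely nonnegative, which is all that is asked of it.\<close>
  define \<kappa> where "\<kappa> p q = (if fst q > 0 then hnorm H ((A ^^ (fst q - 1)) (snd p)) * hnorm H ((A ^^ fst p) (snd q))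
      else hnorm H ((A ^^ fst q) (snd p)) * hnorm H ((A ^^ (fst p - 1)) (snd q)))" for p q
  define K where "K = (\<Sum>p\<leftarrow>zs. \<Sum>q\<leftarrow>zs. \<kappa> p q)"
  \<comment> \<open>For a term with an argument \<open>A f\<close>, the value of
    \<open>W \<theta>\<close> at \<open>A f\<close>, \<open>A f\<close> is that of x \<theta> at
    \<open>f\<close>, \<open>f\<close>, hence at most \<epsilon> times the squared norm of
    \<open>f\<close>; Cauchy--Schwarz brings in the square root of \<epsilon>. The terms without any
    \<open>A\<close> need not be small, but their sum is nonnegative by \<open>embry\<close> for
    \<theta>.\<close>
  have Q_theta: "- (sqrt \<epsilon> * K) \<le> Re (Q \<theta>)"
    if \<theta>: "\<And>x. \<lbrakk>0 \<le> x; x \<le> c\<rbrakk> \<Longrightarrow> 0 \<le> poly \<theta> x \<and> poly \<theta> x \<le> 1 \<and> x * poly \<theta> x \<le> \<epsilon>" for \<theta> \<epsilon>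
  proof -
    have \<theta>0: "\<And>x. \<lbrakk>0 \<le> x; x \<le> c\<rbrakk> \<Longrightarrow> 0 \<le> poly \<theta> x" using \<theta> by blast
    have \<epsilon>: "\<epsilon> \<ge> 0" using \<theta>[of 0] c by simp
    have h2: "Re (hinner H f f) = (hnorm H f)\<^sup>2" if "f \<in> hcarrier H" for f using inner_self[OF that] by simp
    have small: "Re (W \<theta> (A f) (A f)) \<le> \<epsilon> * (hnorm H f)\<^sup>2" if f: "f \<in> hcarrier H" for f
    proof -
      have "Re (W \<theta> (A f) (A f)) = Re (W (monom 1 1 * \<theta>) f f)" by (simp add: W_shift)
      also have "\<dots> \<le> Re (W [:\<epsilon>:] f f)" by (rule W_mono[OF f]) (use \<theta> in \<open>simp add: poly_monom\<close>)
      finally show ?thesis by (simp add: W_const h2 f)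
    qed
    have le1: "Re (W \<theta> f f) \<le> (hnorm H f)\<^sup>2" if f: "f \<in> hcarrier H" for f
      using W_mono[OF f, of \<theta> 1] \<theta> by (simp add: W_one h2 f)
    have nn: "0 \<le> Re (W \<theta> f f)" if "f \<in> hcarrier H" for f by (rule W_nonneg[OF that \<theta>0])
    have W1: "cmod (W \<theta> (A f) g) \<le> sqrt \<epsilon> * (hnorm H f * hnorm H g)"
      and W2: "cmod (W \<theta> g (A f)) \<le> sqrt \<epsilon> * (hnorm H g * hnorm H f)"
      if f: "f \<in> hcarrier H" and g: "g \<in> hcarrier H" for f g
    proof -
      have Af: "A f \<in> hcarrier H" using cl[OF f, of 1] by simp
      have "(cmod (W \<theta> (A f) g))\<^sup>2 \<le> Re (W \<theta> (A f) (A f)) * Re (W \<theta> g g)" by (rule W_cs[OF Af g \<theta>0])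
      also have "\<dots> \<le> (\<epsilon> * (hnorm H f)\<^sup>2) * (hnorm H g)\<^sup>2"
        using \<epsilon> by (intro mult_mono small le1 f g nn) auto
      also have "\<dots> = (sqrt \<epsilon> * (hnorm H f * hnorm H g))\<^sup>2" using \<epsilon> by (simp add: power_mult_distrib)
      finally show 1: "cmod (W \<theta> (A f) g) \<le> sqrt \<epsilon> * (hnorm H f * hnorm H g)"
        using \<epsilon> f g by (intro power2_le_imp_le[of "cmod _"]) (auto simp: hnorm_nonneg)
      then show "cmod (W \<theta> g (A f)) \<le> sqrt \<epsilon> * (hnorm H g * hnorm H f)"
        using W_herm[OF Af g] by (simp add: mult.commute)
    qed
    let ?U = "\<lambda>p q. W \<theta> ((A ^^ fst q) (snd p)) ((A ^^ fst p) (snd q))"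
    let ?Z = "\<lambda>p q. if fst p = 0 \<and> fst q = 0 then W \<theta> (snd p) (snd q) else 0"
    have bound: "Re (?Z p q) - sqrt \<epsilon> * \<kappa> p q \<le> Re (?U p q)" if "p \<in> set zs" "q \<in> set zs" for p q
    proof -
      note pc = zsc[OF that(1)] and qc = zsc[OF that(2)]
      consider "fst p = 0" "fst q = 0" | j where "fst q = Suc j" | i where "fst q = 0" "fst p = Suc i"
        by (metis not0_implies_Suc)
      then show ?thesis
      proof cases
        case 1
        have "0 \<le> \<kappa> p q" using pc qc by (auto simp: \<kappa>_def 1 hnorm_nonneg)
        then show ?thesis using 1 \<epsilon> by simp
      next
        case 2
        then show ?thesis
          using W1[OF cl[OF pc, of j] cl[OF qc, of "fst p"]] abs_Re_le_cmod[of "?U p q"] by (simp add: \<kappa>_def)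
      next
        case 3
        then show ?thesis
          using W2[OF cl[OF qc, of i] pc] abs_Re_le_cmod[of "?U p q"] by (simp add: \<kappa>_def)
      qed
    qed
    have "0 \<le> Re (\<Sum>p\<leftarrow>zs. \<Sum>q\<leftarrow>zs. ?Z p q)"
    proof -
      let ?ys = "filter (\<lambda>p. fst p = 0) zs"
      have "set ?ys \<subseteq> UNIV \<times> hcarrier H" using zs by auto
      note emb[OF this \<theta>0]
      also have "(\<Sum>p\<leftarrow>?ys. \<Sum>q\<leftarrow>?ys. W (monom 1 (fst p + fst q) * \<theta>) (snd p) (snd q))
          = (\<Sum>p\<leftarrow>?ys. \<Sum>q\<leftarrow>?ys. W \<theta> (snd p) (snd q))"
        by (intro arg_cong[of _ _ sum_list] map_cong refl) (simp add: monom_0)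
      finally show ?thesis by (simp only: sum_list_pairs_filter)
    qed
    then have "- (sqrt \<epsilon> * K) \<le> (\<Sum>p\<leftarrow>zs. \<Sum>q\<leftarrow>zs. Re (?Z p q) - sqrt \<epsilon> * \<kappa> p q)"
      by (simp add: K_def Re_sum_list sum_list_subtractf sum_list_const_mult)
    also have "\<dots> \<le> (\<Sum>p\<leftarrow>zs. \<Sum>q\<leftarrow>zs. Re (?U p q))" by (intro sum_list_mono bound)
    finally show ?thesis by (simp add: Q_def Re_sum_list)
  qed
  \<comment> \<open>Neither \<open>n\<close> nor \<open>K\<close> depends on \<open>k\<close>, so
    the lower bound tends to 0.\<close>
  have "- (sqrt (n * c / Suc k) * K) \<le> Re (Q 1)" for k
  proof -
    obtain P \<theta> where "1 = monom 1 n * P + \<theta>"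
      and P: "\<And>x. \<lbrakk>0 \<le> x; x \<le> c\<rbrakk> \<Longrightarrow> 0 \<le> poly P x"
      and \<theta>: "\<And>x. \<lbrakk>0 \<le> x; x \<le> c\<rbrakk> \<Longrightarrow> 0 \<le> poly \<theta> x \<and> poly \<theta> x \<le> 1 \<and> x * poly \<theta> x \<le> n * c / Suc k"
      using one_decomposition[OF c zero_less_Suc] by metis
    then have "Q 1 = Q (monom 1 n * P) + Q \<theta>" by (metis Q_add)
    then show ?thesis using Q_monom[OF P] Q_theta[OF \<theta>] by simp
  qed
  moreover have "(\<lambda>k. - (sqrt (n * c / Suc k) * K)) \<longlonglongrightarrow> - (sqrt 0 * K)"
    by (intro tendsto_intros LIMSEQ_Suc[OF lim_const_over_n])
  ultimately have "- (sqrt 0 * K) \<le> Re (Q 1)" by (intro LIMSEQ_le_const2) auto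
  then show "0 \<le> Re (\<Sum>p\<leftarrow>zs. \<Sum>q\<leftarrow>zs. hinner H ((A ^^ fst q) (snd p)) ((A ^^ fst p) (snd q)))"
    by (simp add: Q_def W_one)
qed

section \<open>Moment problems on compact intervals\<close>

lemma monom_one_add: "monom 1 (i + j) = monom 1 i * (monom 1 j :: 'a :: comm_semiring_1 poly)"
  by (simp add: mult_monom)

text \<open>The factorial moments of the binomial distribution, from the identity (k choose j) (m
  choose k) = (m choose j) (m-j choose k-j). It is wanted in a polynomial ring with y = c - x, where
  x + y is constant.\<close>

lemma sum_choose_bernstein:
  fixes x y :: "'a :: comm_ring_1"
  assumes "j \<le> m"
  shows "(\<Sum>k\<le>m. of_nat (k choose j) * (of_nat (m choose k) * (x ^ k * y ^ (m - k))))
    = of_nat (m choose j) * x ^ j * (x + y) ^ (m - j)"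
proof -
  have "(\<Sum>k\<le>m. of_nat (k choose j) * (of_nat (m choose k) * (x ^ k * y ^ (m - k))))
      = (\<Sum>k=j..m. of_nat (k choose j) * (of_nat (m choose k) * (x ^ k * y ^ (m - k))))"
    by (rule sum.mono_neutral_right) (auto simp: not_le binomial_eq_0)
  also have "\<dots> = (\<Sum>k=j..m. of_nat (m choose j) * x ^ j
      * (of_nat ((m - j) choose (k - j)) * x ^ (k - j) * y ^ (m - k)))"
  proof (rule sum.cong)
    fix k assume "k \<in> {j..m}"
    then have k: "j \<le> k" "k \<le> m" by auto
    have 1: "of_nat (k choose j) * of_nat (m choose k) = (of_nat (m choose j) * of_nat ((m - j) choose (k - j)) :: 'a)"
      using arg_cong[OF choose_mult[OF k], of "of_nat :: nat \<Rightarrow> 'a"] by (simp add: mult.commute)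
    have 2: "x ^ k = x ^ j * x ^ (k - j)" using k by (simp add: power_add[symmetric])
    have "of_nat (k choose j) * (of_nat (m choose k) * (x ^ k * y ^ (m - k)))
      = (of_nat (k choose j) * of_nat (m choose k)) * x ^ k * y ^ (m - k)" by (simp only: mult.assoc)
    also have "\<dots> = of_nat (m choose j) * x ^ j * (of_nat ((m - j) choose (k - j)) * x ^ (k - j) * y ^ (m - k))"
      unfolding 1 2 by (simp only: ac_simps)
    finally show "of_nat (k choose j) * (of_nat (m choose k) * (x ^ k * y ^ (m - k)))
      = of_nat (m choose j) * x ^ j * (of_nat ((m - j) choose (k - j)) * x ^ (k - j) * y ^ (m - k))" .
  qed simp
  also have "\<dots> = of_nat (m choose j) * x ^ j
      * (\<Sum>i\<le>m - j. of_nat ((m - j) choose i) * x ^ i * y ^ (m - j - i))"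
    unfolding sum_distrib_left[symmetric]
    by (rule arg_cong[where f = "(*) _"], rule sum.reindex_bij_witness[of _ "\<lambda>i. i + j" "\<lambda>k. k - j"])
      (use assms in auto)
  finally show ?thesis by (simp add: binomial_ring)
qed

text \<open>Both quantities are products of j factors in [-1, 1], compared factor by factor: k/m
  against (k - i)/(m - i). The latter is negative for k < i, and \<open>2 * j < m\<close> keeps it
  above -1.\<close>

lemma choose_ratio_close:
  assumes k: "k \<le> m" and m: "2 * j < m"
  shows "\<bar>(real k / real m) ^ j - real (k choose j) / real (m choose j)\<bar> \<le> real j * (real j / (real m - real j))"
proof -
  have fact: "real (n choose j) * fact j = (\<Prod>i<j. real n - real i)" for n
    using gbinomial_mult_fact'[of "real n" j] by (simp add: binomial_gbinomial atLeast0LessThan)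
  have "real (k choose j) / real (m choose j) = (real (k choose j) * fact j) / (real (m choose j) * fact j)"
    by simp
  also have "\<dots> = (\<Prod>i<j. (real k - real i) / (real m - real i))" by (simp only: fact prod_dividef)
  finally have ratio: "real (k choose j) / real (m choose j) = (\<Prod>i<j. (real k - real i) / (real m - real i))" .
  have "norm ((\<Prod>i<j. real k / real m) - (\<Prod>i<j. (real k - real i) / (real m - real i)))
      \<le> (\<Sum>i<j. norm (real k / real m - (real k - real i) / (real m - real i)))"
    by (rule norm_prod_diff) (use k m in \<open>auto simp: divide_le_eq abs_le_iff\<close>)
  also have "\<dots> \<le> (\<Sum>i<j. real j / (real m - real j))"
  proof (rule sum_mono)
    fix i assume "i \<in> {..<j}"
    then have i: "i < j" by simp
    have "real k / real m - (real k - real i) / (real m - real i)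
        = (real i / (real m - real i)) * (1 - real k / real m)"
      using i m by (simp add: field_simps)
    moreover have "0 \<le> 1 - real k / real m" "1 - real k / real m \<le> 1" using k m by auto
    moreover have "0 \<le> real i / (real m - real i)" using i m by auto
    ultimately have "norm (real k / real m - (real k - real i) / (real m - real i)) \<le> real i / (real m - real i)"
      by (simp only: real_norm_def abs_of_nonneg mult_nonneg_nonneg mult_left_le)
    also have "\<dots> \<le> real j / (real m - real j)" using i m by (intro frac_le) auto
    finally show "norm (real k / real m - (real k - real i) / (real m - real i)) \<le> real j / (real m - real j)" .
  qed
  finally show ?thesis by (simp add: ratio)
qed

text \<open>The solution of the Hausdorff moment problem is a weak limit of discrete measures with mass
  \<open>c\<^sup>-\<^sup>m (m choose k) L(x\<^sup>k (c - x)\<^sup>m\<^sup>-\<^sup>k)\<close> at \<open>c k / m\<close>; their binomial moments are known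
  exactly.\<close>

theorem hausdorff_moment_problem:
  fixes t :: "nat \<Rightarrow> real" and c :: real
  assumes c: "c > 0" and t0: "t 0 = 1"
    and pos: "\<And>a b. 0 \<le> mf t (monom 1 a * [:c, - 1:] ^ b)"
  shows "\<exists>M. real_distribution M \<and> (AE x in M. 0 \<le> x \<and> x \<le> c) \<and> (\<forall>n. t n = (LINT x|M. x ^ n))"
proof -
  define wt where "wt m k = real (m choose k) * mf t (monom 1 k * [:c, - 1:] ^ (m - k)) / c ^ m" for m k
  have wt: "0 \<le> wt m k" for m k using pos c by (simp add: wt_def)
  have moment: "(\<Sum>k\<le>m. wt m k * real (k choose j)) = real (m choose j) * t j / c ^ j" if "j \<le> m" for m j
  proof -
    have x: "monom 1 1 + [:c, - 1:] = [:c:]" by (simp add: monom_altdef)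
    have sm: "mf t (of_nat a * p) = real a * mf t p" for a p
      using mf_smult[of t "of_nat a" p] by (simp add: of_nat_poly)
    have "(\<Sum>k\<le>m. real (k choose j) * (real (m choose k) * mf t (monom 1 k * [:c, - 1:] ^ (m - k))))
        = mf t (\<Sum>k\<le>m. of_nat (k choose j) * (of_nat (m choose k) * (monom 1 1 ^ k * [:c, - 1:] ^ (m - k))))"
      by (simp add: mf_sum sm monom_power)
    also have "\<dots> = mf t (of_nat (m choose j) * (monom 1 j * [:c:] ^ (m - j)))"
      by (simp only: sum_choose_bernstein[OF that] x) (simp add: monom_power mult.assoc)
    also have "\<dots> = real (m choose j) * (c ^ (m - j) * t j)"
    proof -
      have "[:c:] ^ i = [:c ^ i:]" for i by (induction i) (auto simp: one_pCons)
      then have "monom 1 j * [:c:] ^ (m - j) = smult (c ^ (m - j)) (monom 1 j)" by simp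
      then show ?thesis by (simp only: sm mf_smult mf_monom) simp
    qed
    finally have "(\<Sum>k\<le>m. wt m k * real (k choose j)) = real (m choose j) * (c ^ (m - j) * t j) / c ^ m"
      by (simp add: wt_def sum_divide_distrib[symmetric] mult.commute)
    also have "c ^ m = c ^ (m - j) * c ^ j" using that by (simp add: power_add[symmetric])
    finally show ?thesis using c by simp
  qed
  have wt_sum: "(\<Sum>k\<le>m. wt m k) = 1" for m using moment[of 0 m] t0 by simp
  define D where "D m = distr (point_measure {..m} (\<lambda>k. ennreal (wt m k))) borel (\<lambda>k. c * (real k / real m))" for m
  have D_int: "(LINT x|D m. f x) = (\<Sum>k\<le>m. wt m k * f (c * (real k / real m)))"
    if "f \<in> borel_measurable borel" for m and f :: "real \<Rightarrow> real"
    unfolding D_def using that wt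
    by (subst integral_distr) (auto simp: lebesgue_integral_point_measure_finite measurable_point_measure_eq1)
  have "emeasure (point_measure {..m} (\<lambda>k. ennreal (wt m k))) {..m} = 1" for m
    using wt wt_sum by (subst emeasure_point_measure_finite) (auto simp: sum_ennreal)
  then have "prob_space (point_measure {..m} (\<lambda>k. ennreal (wt m k)))" for m
    by (intro prob_spaceI) (simp add: space_point_measure)
  then have D_dist: "real_distribution (D m)" for m
    unfolding real_distribution_def real_distribution_axioms_def D_def
    by (auto intro!: prob_space.prob_space_distr simp: measurable_point_measure_eq1)
  have pts: "0 \<le> c * (real k / real m)" "c * (real k / real m) \<le> c" if "k \<le> m" for k m
    using c that by (auto simp: divide_le_eq)
  have "tight D"
    unfolding tight_def
  proof (intro conjI allI impI)
    fix \<epsilon> :: real assume \<epsilon>: "\<epsilon> > 0"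
    \<comment> \<open>There may be mass at 0, so the half-open interval has to start below
      it.\<close>
    have "measure (D m) {-1<..c} = 1" for m
    proof -
      interpret real_distribution "D m" by (rule D_dist)
      have "measure (D m) {-1<..c} = (LINT x|D m. indicator {-1<..c} x)" by simp
      also have "\<dots> = (\<Sum>k\<le>m. wt m k * indicator {-1<..c} (c * (real k / real m)))" by (rule D_int) simp
      also have "\<dots> = (\<Sum>k\<le>m. wt m k)"
      proof (rule sum.cong)
        fix k assume "k \<in> {..m}"
        then have "c * (real k / real m) \<in> {-1<..c}" using pts[of k m] by auto
        then show "wt m k * indicator {-1<..c} (c * (real k / real m)) = wt m k" by simp
      qed simp
      finally show ?thesis by (simp add: wt_sum)
    qed
    then show "\<exists>a b. a < b \<and> (\<forall>n. 1 - \<epsilon> < measure (D n) {a<..b})"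
      using \<epsilon> c by (intro exI[of _ "-1"] exI[of _ c]) auto
  qed (rule D_dist)
  from tight_imp_convergent_subsubsequence[OF this strict_mono_id] obtain r M
    where r: "strict_mono (r :: nat \<Rightarrow> nat)" and M: "real_distribution M" and wc: "weak_conv_m (D \<circ> id \<circ> r) M"
    by blast
  interpret M: real_distribution M by (rule M)
  have conv: "(\<lambda>n. \<Sum>k\<le>r n. wt (r n) k * f (c * (real k / real (r n)))) \<longlonglongrightarrow> (LINT x|M. f x)"
    if "\<And>x. isCont f x" "\<And>x. norm (f x) \<le> B" for f :: "real \<Rightarrow> real" and B
  proof -
    have "f \<in> borel_measurable borel"
      using that(1) by (intro borel_measurable_continuous_onI continuous_at_imp_continuous_on) auto
    then show ?thesis
      using weak_conv_imp_integral_bdd_continuous_conv[OF _ M wc that] D_dist by (simp add: D_int)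
  qed
  \<comment> \<open>Weak convergence tests bounded continuous functions only, and powers are
    unbounded. Clamping to [0, c] bounds them without changing their values at the atoms of the
    discrete measures or almost everywhere for \<open>M\<close>.\<close>
  define cl where "cl x = min c (max 0 x)" for x
  have cl: "0 \<le> cl x" "cl x \<le> c" for x using c by (auto simp: cl_def)
  have cl_pt: "cl (c * (real k / real m)) = c * (real k / real m)" if "k \<le> m" for k m
    using pts[OF that] by (simp add: cl_def)
  have cont_cl: "isCont cl x" for x unfolding cl_def by (intro continuous_intros)
  have AE: "AE x in M. 0 \<le> x \<and> x \<le> c"
  proof -
    \<comment> \<open>A bounded continuous function whose zero set is [0, c]; it vanishes at all
      atoms, hence its integral vanishes in the limit.\<close>
    define h where "h x = min 1 \<bar>x - cl x\<bar>" for x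
    have cont_h: "isCont h x" for x unfolding h_def using cont_cl by (intro continuous_intros) auto
    have [measurable]: "h \<in> borel_measurable borel"
      using cont_h by (intro borel_measurable_continuous_onI continuous_at_imp_continuous_on) auto
    have "(\<Sum>k\<le>r n. wt (r n) k * h (c * (real k / real (r n)))) = 0" for n
      by (intro sum.neutral) (simp add: h_def cl_pt del: times_divide_eq_right)
    with conv[of h 1] cont_h have "(\<lambda>n. 0) \<longlonglongrightarrow> (LINT x|M. h x)" by (simp add: h_def)
    then have "(LINT x|M. h x) = 0" by (simp add: LIMSEQ_const_iff)
    moreover have "integrable M h" by (rule M.integrable_const_bound[of _ 1]) (auto simp: h_def)
    ultimately have "AE x in M. h x = 0"
      by (subst (asm) integral_nonneg_eq_0_iff_AE) (auto simp: h_def)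
    then show ?thesis
    proof eventually_elim
      case (elim x)
      then have "x = cl x" by (simp add: h_def min_def split: if_splits)
      then show ?case using cl[of x] by simp
    qed
  qed
  have "t j = (LINT x|M. x ^ j)" for j
  proof -
    have lim_cl: "(\<lambda>n. \<Sum>k\<le>r n. wt (r n) k * cl (c * (real k / real (r n))) ^ j) \<longlonglongrightarrow> (LINT x|M. cl x ^ j)"
      using cl cont_cl by (intro conv[of "\<lambda>x. cl x ^ j" "c ^ j"]) (auto intro!: power_mono continuous_intros)
    have int_cl: "(LINT x|M. cl x ^ j) = (LINT x|M. x ^ j)"
    proof (rule integral_cong_AE)
      show "AE x in M. cl x ^ j = x ^ j" using AE by eventually_elim (simp add: cl_def)
    qed (simp_all add: cl_def)
    have "(\<lambda>n. \<Sum>k\<le>r n. wt (r n) k * cl (c * (real k / real (r n))) ^ j) \<longlonglongrightarrow> t j"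
    proof -
      have lim: "(\<lambda>m. c ^ j * (real j * (real j / (real m - real j)))) \<longlonglongrightarrow> 0"
        by real_asymp
      have lim: "(\<lambda>n. c ^ j * (real j * (real j / (real (r n) - real j)))) \<longlonglongrightarrow> 0"
        using LIMSEQ_subseq_LIMSEQ[OF lim r] by (simp add: o_def)
      \<comment> \<open>The power (k/m)^j is exchanged for the ratio of binomials, whose mean is
        exactly t_j / c^j. The weights are nonnegative with sum 1, so a bound for the error at each
        atom bounds the total error.\<close>
      have "norm ((\<Sum>k\<le>m. wt m k * cl (c * (real k / real m)) ^ j) - t j)
          \<le> c ^ j * (real j * (real j / (real m - real j)))" if m: "2 * j < m" for m
      proof -
        have "t j = c ^ j * ((\<Sum>k\<le>m. wt m k * real (k choose j)) / real (m choose j))"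
          using moment[of j m] m c by simp
        also have "\<dots> = (\<Sum>k\<le>m. wt m k * (c ^ j * (real (k choose j) / real (m choose j))))"
          by (simp add: sum_distrib_left sum_divide_distrib ac_simps)
        finally have tj: "t j = (\<Sum>k\<le>m. wt m k * (c ^ j * (real (k choose j) / real (m choose j))))" .
        have "(\<Sum>k\<le>m. wt m k * cl (c * (real k / real m)) ^ j) - t j
            = (\<Sum>k\<le>m. wt m k * (c ^ j * ((real k / real m) ^ j - real (k choose j) / real (m choose j))))"
          unfolding tj sum_subtractf[symmetric]
          by (intro sum.cong refl) (simp only: cl_pt atMost_iff power_mult_distrib right_diff_distrib mult.assoc)
        also have "norm \<dots> \<le> (\<Sum>k\<le>m. wt m k * (c ^ j * (real j * (real j / (real m - real j)))))"
        proof (rule sum_norm_le)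
          fix k assume "k \<in> {..m}"
          then have "\<bar>(real k / real m) ^ j - real (k choose j) / real (m choose j)\<bar>
              \<le> real j * (real j / (real m - real j))" using choose_ratio_close m by simp
          then show "norm (wt m k * (c ^ j * ((real k / real m) ^ j - real (k choose j) / real (m choose j))))
              \<le> wt m k * (c ^ j * (real j * (real j / (real m - real j))))"
            using wt[of m k] c by (simp add: abs_mult mult_left_mono del: times_divide_eq_right)
        qed
        also have "\<dots> = c ^ j * (real j * (real j / (real m - real j)))"
          by (simp only: sum_distrib_right[symmetric] wt_sum mult_1)
        finally show ?thesis .
      qed
      moreover have "\<forall>\<^sub>F n in sequentially. 2 * j < r n"
        unfolding eventually_sequentially
      proof (intro exI allI impI)
        fix n assume "n \<ge> Suc (2 * j)"
        then show "2 * j < r n" using seq_suble[OF r, of n] by simp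
      qed
      ultimately have "\<forall>\<^sub>F n in sequentially. norm ((\<Sum>k\<le>r n. wt (r n) k * cl (c * (real k / real (r n))) ^ j) - t j)
          \<le> c ^ j * (real j * (real j / (real (r n) - real j)))"
        by (rule eventually_mono[rotated])
      then have "(\<lambda>n. (\<Sum>k\<le>r n. wt (r n) k * cl (c * (real k / real (r n))) ^ j) - t j) \<longlonglongrightarrow> 0"
        using lim by (rule Lim_null_comparison)
      then show ?thesis by (rule LIM_zero_cancel)
    qed
    from LIMSEQ_unique[OF this lim_cl] show ?thesis by (simp only: int_cl)
  qed
  then show ?thesis using M AE by blast
qed

text \<open>Every x^a (c - x)^b is a square times one of 1, x, c - x and x (c - x). For c - x the
  growth is used: with L the functional of \<open>t\<close>, \<open>le_of_growth\<close> applied to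
  a_m = L(x^m p^2) yields L(x p^2) <= c L(p^2). The factor x (c - x) then follows from c x (c - x) =
  (c - x) x^2 + x (c - x)^2.\<close>

theorem stieltjes_moment_problem_bounded:
  fixes t :: "nat \<Rightarrow> real" and c :: real
  assumes c: "c > 0" and t0: "t 0 = 1" and growth: "\<And>n. t n \<le> K * c ^ n"
    and pos: "\<And>p. 0 \<le> mf t (p * p)" and pos1: "\<And>p. 0 \<le> mf t (monom 1 1 * (p * p))"
  shows "\<exists>M. real_distribution M \<and> (AE x in M. 0 \<le> x \<and> x \<le> c) \<and> (\<forall>n. t n = (LINT x|M. x ^ n))"
proof (rule hausdorff_moment_problem[where t = t, OF c t0])
  have posm: "0 \<le> mf t (monom 1 m * (p * p))" for m p
  proof (cases "even m")
    case True
    obtain k where "m = k + k" using True by (metis evenE mult_2)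
    then have "monom 1 m * (p * p) = (monom 1 k * p) * (monom 1 k * p)"
      by (simp only: monom_one_add ac_simps)
    then show ?thesis by (simp only: pos)
  next
    case False
    then obtain k where "m = 1 + (k + k)" by (metis oddE mult_2 add.commute)
    then have "monom 1 m * (p * p) = monom 1 1 * ((monom 1 k * p) * (monom 1 k * p))"
      by (simp only: monom_one_add ac_simps)
    then show ?thesis by (simp only: pos1)
  qed
  have t_nonneg: "0 \<le> t n" for n using posm[of n 1] by (simp add: mf_monom)
  have posc: "0 \<le> mf t ([:c, - 1:] * (p * p))" for p
  proof -
    define a where "a m = mf t (monom 1 m * (p * p))" for m
    have "(a m)\<^sup>2 \<le> a 0 * a (2 * m)" for m
    proof -
      \<comment> \<open>Polynomials are real here, so only the real part of \<open>z\<close> is used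
        as a multiplier; its imaginary part just enlarges the quadratic term.\<close>
      have "0 \<le> a 0 + 2 * Re (z * of_real (a m)) + (cmod z)\<^sup>2 * a (2 * m)" for z
      proof -
        define y where "y = monom 1 m * p"
        have eq: "(p + smult (Re z) y) * (p + smult (Re z) y)
            = p * p + smult (Re z) (p * y) + smult (Re z) (p * y) + smult (Re z * Re z) (y * y)"
          by (simp only: distrib_left distrib_right mult_smult_left mult_smult_right smult_add_right
              smult_smult mult.commute[of y p] add.assoc)
        have "mf t (p * p) = a 0" by (simp add: a_def monom_0)
        moreover have "mf t (p * y) = a m" unfolding a_def y_def by (simp only: ac_simps)
        moreover have "mf t (y * y) = a (2 * m)"
          unfolding a_def y_def mult_2 monom_one_add by (simp only: ac_simps)
        ultimately have "mf t ((p + smult (Re z) y) * (p + smult (Re z) y))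
            = a 0 + 2 * Re z * a m + (Re z)\<^sup>2 * a (2 * m)"
          by (simp only: eq mf_add mf_smult) (simp add: power2_eq_square)
        then have "0 \<le> a 0 + 2 * Re z * a m + (Re z)\<^sup>2 * a (2 * m)"
          using pos[of "p + smult (Re z) y"] by simp
        also have "(Re z)\<^sup>2 * a (2 * m) \<le> (cmod z)\<^sup>2 * a (2 * m)"
          using posm by (intro mult_right_mono) (auto simp: a_def cmod_power2)
        finally show ?thesis by simp
      qed
      from cauchy_schwarz_quadratic[OF this] show ?thesis by simp
    qed
    moreover have "a m \<le> (\<Sum>i\<le>degree (p * p). \<bar>coeff (p * p) i\<bar> * (K * c ^ i)) * c ^ m" for m
    proof -
      have "a m = (\<Sum>i\<le>degree (p * p). coeff (p * p) i * t (i + m))"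
        unfolding a_def by (simp add: mf_monom_mult) (simp add: mf_def)
      also have "\<dots> \<le> (\<Sum>i\<le>degree (p * p). \<bar>coeff (p * p) i\<bar> * (K * c ^ (i + m)))"
        using growth t_nonneg by (intro sum_mono mult_mono) auto
      finally show ?thesis by (simp add: sum_distrib_right power_add mult.assoc)
    qed
    ultimately have "a 1 \<le> c * a 0" using le_of_growth[of a] posm c unfolding a_def by blast
    moreover have "[:c, - 1:] * (p * p) = smult c (monom 1 0 * (p * p)) - monom 1 1 * (p * p)"
      by (simp add: monom_altdef)
    ultimately show ?thesis by (simp only: mf_diff mf_smult a_def) simp
  qed
  have posc1: "0 \<le> mf t (monom 1 1 * ([:c, - 1:] * (p * p)))" for p
  proof -
    let ?x = "monom 1 1 :: real poly" and ?y = "[:c, - 1:]"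
    have ring: "(X + Y) * (X * (Y * (p * p))) = Y * ((X * p) * (X * p)) + X * ((Y * p) * (Y * p))"
      for X Y :: "real poly" by (simp add: algebra_simps)
    have "?x + ?y = [:c:]" by (simp add: monom_altdef)
    then have "smult c (?x * (?y * (p * p))) = (?x + ?y) * (?x * (?y * (p * p)))" by simp
    also note ring
    finally have eq: "smult c (?x * (?y * (p * p))) = ?y * ((?x * p) * (?x * p)) + ?x * ((?y * p) * (?y * p))" .
    have "c * mf t (?x * (?y * (p * p))) = mf t (smult c (?x * (?y * (p * p))))"
      by (simp only: mf_smult real_scaleR_def)
    also have "\<dots> \<ge> 0" unfolding eq mf_add using posc[of "?x * p"] pos1[of "?y * p"] by (rule add_nonneg_nonneg)
    finally have "0 \<le> c * mf t (?x * (?y * (p * p)))" .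
    then show ?thesis using c by (simp add: zero_le_mult_iff)
  qed
  fix a b
  obtain k i where a: "a = k + k \<or> a = Suc (k + k)" and b: "b = i + i \<or> b = Suc (i + i)"
    by (metis evenE oddE mult_2 Suc_eq_plus1)
  let ?p = "monom 1 k * [:c, - 1:] ^ i"
  have "monom 1 (k + k) = monom 1 k * (monom 1 k :: real poly)" by (simp add: mult_monom)
  moreover have "monom 1 (Suc (k + k)) = monom 1 1 * (monom 1 k * (monom 1 k :: real poly))"
    by (simp add: mult_monom)
  ultimately have "monom 1 a * [:c, - 1:] ^ b \<in> {?p * ?p, monom 1 1 * (?p * ?p), [:c, - 1:] * (?p * ?p),
      monom 1 1 * ([:c, - 1:] * (?p * ?p))}"
    using a b by (auto simp only: power_add power_Suc insert_iff ac_simps)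
  then show "0 \<le> mf t (monom 1 a * [:c, - 1:] ^ b)" using pos[of ?p] pos1[of ?p] posc[of ?p] posc1[of ?p] by auto
qed

section \<open>The Hilbert space of square summable functions\<close>

lemma ell2_simps [simp]:
  "hzero (ell2 V) = (\<lambda>v. 0)" "hadd (ell2 V) = (\<lambda>f g v. f v + g v)"
  "hscale (ell2 V) = (\<lambda>c f v. c * f v)" "hdiff (ell2 V) = (\<lambda>f g v. f v - g v)"
  "hinner (ell2 V) = (\<lambda>f g. \<Sum>\<^sub>\<infinity>v\<in>V. f v * cnj (g v))"
  by (auto simp: ell2_def hdiff_def fun_eq_iff)

lemma ell2_carrier_iff:
  "f \<in> hcarrier (ell2 V) \<longleftrightarrow> (\<forall>v. v \<notin> V \<longrightarrow> f v = 0) \<and> (\<lambda>v. (cmod (f v))\<^sup>2) summable_on V"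
  by (simp add: ell2_def)

lemma infsum_complex_of_real: "(\<Sum>\<^sub>\<infinity>x\<in>A. complex_of_real (f x)) = complex_of_real (\<Sum>\<^sub>\<infinity>x\<in>A. f x)"
proof (rule infsum_bounded_linear_strong[OF _ bounded_linear_of_real])
  show "(\<lambda>x. complex_of_real (f x)) summable_on A \<longleftrightarrow> f summable_on A"
    using summable_on_Re[of "\<lambda>x. complex_of_real (f x)" A] summable_on_of_real[of f A] by auto
qed

lemma ell2_inner_self: "(\<Sum>\<^sub>\<infinity>v\<in>V. f v * cnj (f v)) = complex_of_real (\<Sum>\<^sub>\<infinity>v\<in>V. (cmod (f v))\<^sup>2)"
  by (simp only: complex_norm_square[symmetric] infsum_complex_of_real)

lemma ell2_hnorm_sq: "(hnorm (ell2 V) f)\<^sup>2 = (\<Sum>\<^sub>\<infinity>v\<in>V. (cmod (f v))\<^sup>2)"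
  unfolding hnorm_def by (simp only: ell2_simps ell2_inner_self Re_complex_of_real)
    (simp add: infsum_nonneg)

lemma ell2_abs_summable_mult:
  assumes "f \<in> hcarrier (ell2 V)" "g \<in> hcarrier (ell2 V)"
  shows "(\<lambda>v. norm (f v * cnj (g v))) summable_on V"
proof (rule Infinite_Sum.abs_summable_on_comparison_test')
  show "(\<lambda>v. (cmod (f v))\<^sup>2 + (cmod (g v))\<^sup>2) summable_on V"
    using assms by (intro summable_on_add) (auto simp: ell2_carrier_iff)
  show "norm (f v * cnj (g v)) \<le> (cmod (f v))\<^sup>2 + (cmod (g v))\<^sup>2" for v
    using sum_squares_bound[of "cmod (f v)" "cmod (g v)"] mult_nonneg_nonneg[OF norm_ge_zero norm_ge_zero, of "f v" "g v"]
    unfolding norm_mult complex_mod_cnj by linarith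
qed

lemma ell2_summable_mult:
  assumes "f \<in> hcarrier (ell2 V)" "g \<in> hcarrier (ell2 V)"
  shows "(\<lambda>v. f v * cnj (g v)) summable_on V"
  using abs_summable_summable[OF ell2_abs_summable_mult[OF assms]] .

lemma ell2_add_closed:
  assumes "f \<in> hcarrier (ell2 V)" "g \<in> hcarrier (ell2 V)"
  shows "(\<lambda>v. f v + g v) \<in> hcarrier (ell2 V)"
proof -
  have "(\<lambda>v. 2 * (cmod (f v))\<^sup>2 + 2 * (cmod (g v))\<^sup>2) summable_on V"
    using assms by (intro summable_on_add summable_on_cmult_right) (auto simp: ell2_carrier_iff)
  moreover have "(cmod (f v + g v))\<^sup>2 \<le> 2 * (cmod (f v))\<^sup>2 + 2 * (cmod (g v))\<^sup>2" for v
  proof -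
    have "(cmod (f v + g v))\<^sup>2 \<le> (cmod (f v) + cmod (g v))\<^sup>2"
      by (intro power_mono norm_triangle_ineq) auto
    also have "\<dots> \<le> 2 * (cmod (f v))\<^sup>2 + 2 * (cmod (g v))\<^sup>2"
      using sum_squares_bound[of "cmod (f v)" "cmod (g v)"] by (simp add: power2_sum)
    finally show ?thesis .
  qed
  ultimately have "(\<lambda>v. (cmod (f v + g v))\<^sup>2) summable_on V"
    by (rule summable_on_comparison_test) auto
  then show ?thesis using assms by (simp add: ell2_carrier_iff)
qed

lemma ell2_scale_closed: "f \<in> hcarrier (ell2 V) \<Longrightarrow> (\<lambda>v. c * f v) \<in> hcarrier (ell2 V)"
  by (auto simp: ell2_carrier_iff norm_mult power_mult_distrib intro: summable_on_cmult_right)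

lemma ell2_diff_closed:
  "\<lbrakk>f \<in> hcarrier (ell2 V); g \<in> hcarrier (ell2 V)\<rbrakk> \<Longrightarrow> (\<lambda>v. f v - g v) \<in> hcarrier (ell2 V)"
  using ell2_add_closed[of f V "\<lambda>v. - 1 * g v"] ell2_scale_closed[of g V "- 1"] by simp

lemma ell2_sum_le:
  assumes "f \<in> hcarrier (ell2 V)" "finite F" "F \<subseteq> V"
  shows "(\<Sum>v\<in>F. (cmod (f v))\<^sup>2) \<le> (hnorm (ell2 V) f)\<^sup>2"
  unfolding ell2_hnorm_sq using assms by (intro finite_sum_le_infsum) (auto simp: ell2_carrier_iff)

text \<open>The candidate is the pointwise limit. As in Fatou's lemma, Cauchy bounds for finite
  partial sums survive the limit and then bound the full sum.\<close>

lemma ell2_complete: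
  fixes s :: "nat \<Rightarrow> 'v \<Rightarrow> complex"
  assumes s: "\<And>n. s n \<in> hcarrier (ell2 V)"
    and cau: "\<And>e :: real. 0 < e \<Longrightarrow> \<exists>M. \<forall>m\<ge>M. \<forall>n\<ge>M. hnorm (ell2 V) (\<lambda>v. s m v - s n v) < e"
  shows "\<exists>f\<in>hcarrier (ell2 V). (\<lambda>n. hnorm (ell2 V) (\<lambda>v. s n v - f v)) \<longlonglongrightarrow> 0"
proof -
  note sd = ell2_diff_closed[OF s s]
  have nn: "0 \<le> hnorm (ell2 V) g" for g by (simp add: hnorm_def ell2_inner_self infsum_nonneg)
  have "\<exists>l. (\<lambda>n. s n v) \<longlonglongrightarrow> l" for v
  proof (cases "v \<in> V")
    case True
    have "Cauchy (\<lambda>n. s n v)"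
    proof (rule metric_CauchyI)
      fix e :: real assume "e > 0"
      then obtain M where M: "\<forall>m\<ge>M. \<forall>n\<ge>M. hnorm (ell2 V) (\<lambda>v. s m v - s n v) < e" using cau by blast
      have "dist (s m v) (s n v) < e" if "m \<ge> M" "n \<ge> M" for m n
      proof -
        have "(dist (s m v) (s n v))\<^sup>2 \<le> (hnorm (ell2 V) (\<lambda>v. s m v - s n v))\<^sup>2"
          using ell2_sum_le[OF sd, of "{v}" m n] True by (simp add: dist_norm)
        then have "dist (s m v) (s n v) \<le> hnorm (ell2 V) (\<lambda>v. s m v - s n v)"
          using nn by (rule power2_le_imp_le)
        also have "\<dots> < e" using M that by blast
        finally show ?thesis .
      qed
      then show "\<exists>M. \<forall>m\<ge>M. \<forall>n\<ge>M. dist (s m v) (s n v) < e" by blast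
    qed
    then show ?thesis by (simp add: Cauchy_convergent_iff convergent_def)
  next
    case False
    then have "(\<lambda>n. s n v) = (\<lambda>n. 0)" using s by (simp add: ell2_carrier_iff)
    then show ?thesis by auto
  qed
  then obtain f where f: "\<And>v. (\<lambda>n. s n v) \<longlonglongrightarrow> f v" by metis
  have f0: "f v = 0" if "v \<notin> V" for v
  proof -
    have "(\<lambda>n. s n v) = (\<lambda>n. 0)" using s that by (simp add: ell2_carrier_iff)
    then show ?thesis using f[of v] by (simp add: LIMSEQ_const_iff)
  qed
  have key: "\<exists>M. \<forall>m\<ge>M. (\<lambda>v. s m v - f v) \<in> hcarrier (ell2 V) \<and> hnorm (ell2 V) (\<lambda>v. s m v - f v) \<le> e"
    if e: "e > 0" for e
  proof -
    obtain M where M: "\<forall>m\<ge>M. \<forall>n\<ge>M. hnorm (ell2 V) (\<lambda>v. s m v - s n v) < e" using cau[OF e] by blast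
    have "(\<lambda>v. s m v - f v) \<in> hcarrier (ell2 V) \<and> hnorm (ell2 V) (\<lambda>v. s m v - f v) \<le> e" if m: "m \<ge> M" for m
    proof -
      have bound: "(\<Sum>v\<in>F. (cmod (s m v - f v))\<^sup>2) \<le> e\<^sup>2" if F: "finite F" "F \<subseteq> V" for F
      proof (rule LIMSEQ_le_const2)
        show "(\<lambda>n. \<Sum>v\<in>F. (cmod (s m v - s n v))\<^sup>2) \<longlonglongrightarrow> (\<Sum>v\<in>F. (cmod (s m v - f v))\<^sup>2)"
          by (intro tendsto_sum tendsto_power tendsto_norm tendsto_diff tendsto_const f)
        have "(\<Sum>v\<in>F. (cmod (s m v - s n v))\<^sup>2) \<le> e\<^sup>2" if n: "n \<ge> M" for n
        proof -
          have "(\<Sum>v\<in>F. (cmod (s m v - s n v))\<^sup>2) \<le> (hnorm (ell2 V) (\<lambda>v. s m v - s n v))\<^sup>2"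
            by (rule ell2_sum_le[OF sd F])
          also have "\<dots> \<le> e\<^sup>2" by (rule power_mono[OF less_imp_le[OF M[rule_format, OF m n]] nn])
          finally show ?thesis .
        qed
        then show "\<exists>N. \<forall>n\<ge>N. (\<Sum>v\<in>F. (cmod (s m v - s n v))\<^sup>2) \<le> e\<^sup>2" by blast
      qed
      have sum: "(\<lambda>v. (cmod (s m v - f v))\<^sup>2) summable_on V"
      proof (rule nonneg_bdd_above_summable_on)
        show "bdd_above (sum (\<lambda>v. (cmod (s m v - f v))\<^sup>2) ` {F. F \<subseteq> V \<and> finite F})"
          by (rule bdd_aboveI2[where M = "e\<^sup>2"]) (simp add: bound)
      qed simp
      moreover have "(hnorm (ell2 V) (\<lambda>v. s m v - f v))\<^sup>2 \<le> e\<^sup>2"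
        unfolding ell2_hnorm_sq by (rule infsum_le_finite_sums[OF sum bound])
      then have "hnorm (ell2 V) (\<lambda>v. s m v - f v) \<le> e" using e by (auto intro: power2_le_imp_le)
      ultimately show ?thesis using f0 s[of m] by (simp add: ell2_carrier_iff)
    qed
    then show ?thesis by blast
  qed
  obtain m where m: "(\<lambda>v. s m v - f v) \<in> hcarrier (ell2 V)" using key[of 1] by (meson le_refl zero_less_one)
  have "f \<in> hcarrier (ell2 V)" using ell2_diff_closed[OF s[of m] m] by simp
  moreover have "(\<lambda>n. hnorm (ell2 V) (\<lambda>v. s n v - f v)) \<longlonglongrightarrow> 0"
  proof (rule LIMSEQ_I)
    fix r :: real assume "r > 0"
    then obtain M where "\<forall>m\<ge>M. hnorm (ell2 V) (\<lambda>v. s m v - f v) \<le> r / 2" using key[of "r / 2"] by auto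
    then show "\<exists>no. \<forall>n\<ge>no. norm (hnorm (ell2 V) (\<lambda>v. s n v - f v) - 0) < r"
    proof (intro exI allI impI)
      fix n assume "n \<ge> M"
      then have "hnorm (ell2 V) (\<lambda>v. s n v - f v) \<le> r / 2" using \<open>\<forall>m\<ge>M. _\<close> by blast
      then show "norm (hnorm (ell2 V) (\<lambda>v. s n v - f v) - 0) < r" using nn[of "\<lambda>v. s n v - f v"] \<open>r > 0\<close> by simp
    qed
  qed
  ultimately show ?thesis by blast
qed

lemma ell2_hilbert: "complex_hilbert_space (ell2 V)"
proof (unfold_locales, goal_cases)
  case (2 x y)
  then show ?case using ell2_add_closed by simp
next
  case (3 x c)
  then show ?case using ell2_scale_closed by simp
next
  case (12 x y z)
  then show ?case by (simp add: distrib_right infsum_add ell2_summable_mult)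
next
  case (13 x y c)
  then show ?case by (simp add: mult.assoc infsum_cmult_right')
next
  case (14 x y)
  have "(\<Sum>\<^sub>\<infinity>v\<in>V. x v * cnj (y v)) = (\<Sum>\<^sub>\<infinity>v\<in>V. cnj (y v * cnj (x v)))" by (simp add: mult.commute)
  then show ?case by (simp only: infsum_cnj ell2_simps)
next
  case (15 x)
  then show ?case by (simp add: ell2_inner_self infsum_nonneg)
next
  case (16 x)
  then have sum: "(\<Sum>\<^sub>\<infinity>v\<in>V. (cmod (x v))\<^sup>2) = 0" "(\<lambda>v. (cmod (x v))\<^sup>2) summable_on V" "\<forall>v. v \<notin> V \<longrightarrow> x v = 0"
    by (auto simp: ell2_inner_self ell2_carrier_iff)
  have "x v = 0" for v
  proof (cases "v \<in> V")
    case True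
    then have "(cmod (x v))\<^sup>2 = 0" using nonneg_infsum_le_0D[OF _ sum(2), of v] sum(1) by simp
    then show ?thesis by simp
  qed (use sum in auto)
  then show ?case by (auto simp: fun_eq_iff)
next
  case (17 s)
  then show ?case using ell2_complete[of s V] unfolding ell2_simps by blast
qed (auto simp: ell2_carrier_iff algebra_simps)

section \<open>Positivity of Hankel matrices\<close>

lemma (in complex_hilbert_space) gram_nonneg:
  fixes z :: "nat \<Rightarrow> 'a" and \<alpha> :: "nat \<Rightarrow> complex"
  assumes z: "\<And>k. z k \<in> hcarrier H"
  shows "(\<Sum>k\<le>n. \<Sum>l\<le>n. hinner H (z k) (z l) * \<alpha> k * cnj (\<alpha> l)) \<in> \<real>\<^sub>\<ge>\<^sub>0"
proof -
  \<comment> \<open>The linear combination of the \<open>z k\<close> is built by recursion, since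
    the addition of the space is a field of a record.\<close>
  define comb where "comb = rec_nat (hscale H (\<alpha> 0) (z 0)) (\<lambda>n x. hadd H x (hscale H (\<alpha> (Suc n)) (z (Suc n))))"
  have comb: "comb 0 = hscale H (\<alpha> 0) (z 0)" "comb (Suc n) = hadd H (comb n) (hscale H (\<alpha> (Suc n)) (z (Suc n)))" for n
    by (simp_all add: comb_def)
  have cl: "comb n \<in> hcarrier H" for n
    by (induction n) (auto simp: comb add_closed scale_closed z)
  have left: "hinner H (comb n) y = (\<Sum>k\<le>n. \<alpha> k * hinner H (z k) y)" if "y \<in> hcarrier H" for n y
    by (induction n) (auto simp: comb inner_add inner_scale that z cl scale_closed)
  have right: "hinner H y (comb n) = (\<Sum>k\<le>n. cnj (\<alpha> k) * hinner H y (z k))" if "y \<in> hcarrier H" for n y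
    by (induction n) (auto simp: comb inner_add_right inner_scale_right that z cl scale_closed)
  have "(\<Sum>k\<le>n. \<Sum>l\<le>n. hinner H (z k) (z l) * \<alpha> k * cnj (\<alpha> l)) = hinner H (comb n) (comb n)"
    by (subst left[OF cl]) (simp add: right z sum_distrib_left ac_simps)
  also have "\<dots> = complex_of_real ((hnorm H (comb n))\<^sup>2)" by (rule inner_self[OF cl])
  finally show ?thesis by (simp only: nonneg_Reals_of_real_iff zero_le_power2)
qed

theorem (in complex_hilbert_space) subnormal_imp_hankel_nonneg:
  assumes sub: "subnormal H A" and x: "x \<in> hcarrier H"
  shows "(\<Sum>k\<le>n. \<Sum>l\<le>n. complex_of_real ((hnorm H ((A ^^ (k + l)) x))\<^sup>2) * \<alpha> k * cnj (\<alpha> l)) \<in> \<real>\<^sub>\<ge>\<^sub>0"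
proof -
  obtain K :: "('a \<times> nat \<Rightarrow> complex) hspace" and N J where ext: "normal_extension H A K N J"
    using sub by (auto simp: subnormal_def)
  interpret K: complex_hilbert_space K using ext by (simp add: normal_extension_def)
  have J: "J h \<in> hcarrier K" "hinner K (J h) (J h) = hinner H h h" "J (A h) = N (J h)"
    if "h \<in> hcarrier H" for h
    using ext that by (auto simp: normal_extension_def isometric_embedding_def linear_map_def)
  have Ac: "(A ^^ m) x \<in> hcarrier H" for m
    using sub linear_map_pow[of H A m] x by (auto simp: subnormal_def bounded_op_def linear_map_def)
  have "normal_op K N" using ext by (simp add: normal_extension_def)
  then obtain B where adj: "is_adjoint K N B" and comm: "\<forall>x\<in>hcarrier K. N (B x) = B (N x)"
    unfolding normal_op_def by blast
  have B: "B x \<in> hcarrier K" "y \<in> hcarrier K \<Longrightarrow> hinner K (N y) x = hinner K y (B x)" "N (B x) = B (N x)"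
    if "x \<in> hcarrier K" for x y
    using adj comm that by (auto simp: is_adjoint_def)
  have N: "N x \<in> hcarrier K" if "x \<in> hcarrier K" for x
    using ext that by (auto simp: normal_extension_def normal_op_def bounded_op_def linear_map_def)
  have BN: "hinner K (B x) y = hinner K x (N y)" if "x \<in> hcarrier K" "y \<in> hcarrier K" for x y
    by (metis B(1,2) K.inner_commute N that)
  define R where "R y = B (N y)" for y
  have Rc: "(R ^^ m) y \<in> hcarrier K" if "y \<in> hcarrier K" for m y
    using that by (induction m) (auto simp: R_def B(1) N)
  have RN: "(R ^^ m) (N y) = N ((R ^^ m) y)" if "y \<in> hcarrier K" for m y
    using Rc[OF that] by (induction m) (auto simp: R_def B(3) N)
  have R: "hinner K (R y) z = hinner K y (R z)" if "y \<in> hcarrier K" "z \<in> hcarrier K" for y z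
    using that by (simp add: R_def B BN N)
  have Rm: "hinner K ((R ^^ m) y) z = hinner K y ((R ^^ m) z)" if "y \<in> hcarrier K" "z \<in> hcarrier K" for m y z
    using that
  proof (induction m arbitrary: z)
    case (Suc m)
    have "R z \<in> hcarrier K" using Rc[OF Suc.prems(2), of 1] by simp
    then show ?case using R[OF Rc[OF Suc.prems(1)] Suc.prems(2), of m] Suc.IH[OF Suc.prems(1), of "R z"]
      by (simp add: funpow_swap1)
  qed simp
  have JA: "J ((A ^^ m) x) = (N ^^ m) (J x)" for m
    using J(3) Ac by (induction m) auto
  \<comment> \<open>Normality enters here: N commutes with \<open>R\<close>, so N*^m N^m collapses
    to \<open>R ^^ m\<close>.\<close>
  have NN: "hinner K ((N ^^ m) y) ((N ^^ m) y) = hinner K ((R ^^ m) y) y" if "y \<in> hcarrier K" for m y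
    using that
  proof (induction m arbitrary: y)
    case (Suc m)
    have "hinner K ((N ^^ Suc m) y) ((N ^^ Suc m) y) = hinner K ((R ^^ m) (N y)) (N y)"
      using Suc.IH[OF N[OF Suc.prems]] by (simp add: funpow_swap1)
    also have "\<dots> = hinner K (B (N ((R ^^ m) y))) y"
      using Suc.prems by (simp add: RN BN N Rc)
    finally show ?case by (simp add: R_def[symmetric])
  qed simp
  have "complex_of_real ((hnorm H ((A ^^ (k + l)) x))\<^sup>2) = hinner K ((R ^^ k) (J x)) ((R ^^ l) (J x))" for k l
  proof -
    have "complex_of_real ((hnorm H ((A ^^ (k + l)) x))\<^sup>2) = hinner K ((N ^^ (k + l)) (J x)) ((N ^^ (k + l)) (J x))"
      using inner_self[OF Ac] J(2)[OF Ac] JA by simp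
    also have "\<dots> = hinner K ((R ^^ (l + k)) (J x)) (J x)" using NN J(1)[OF x] by (simp add: add.commute)
    also have "\<dots> = hinner K ((R ^^ k) (J x)) ((R ^^ l) (J x))"
      using Rm[OF Rc[OF J(1)[OF x]] J(1)[OF x], of l k] by (simp add: funpow_add)
    finally show ?thesis .
  qed
  then show ?thesis using K.gram_nonneg[of "\<lambda>k. (R ^^ k) (J x)" \<alpha> n] Rc J(1)[OF x] by simp
qed

text \<open>The double sum is the integral of the squared modulus of the polynomial with
  coefficients \<alpha>.\<close>

lemma hamburger_imp_hankel_nonneg:
  fixes \<alpha> :: "nat \<Rightarrow> complex"
  assumes "hamburger_moment_seq t"
  shows "(\<Sum>k\<le>n. \<Sum>l\<le>n. complex_of_real (t (k + l)) * \<alpha> k * cnj (\<alpha> l)) \<in> \<real>\<^sub>\<ge>\<^sub>0"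
proof -
  obtain M where M: "\<And>n. integrable M (\<lambda>s. s ^ n)" "\<And>n. t n = (LINT s|M. s ^ n)"
    using assms by (auto simp: hamburger_moment_seq_def represents_moments_def)
  have int: "integrable M (\<lambda>s. complex_of_real (s ^ (k + l)) * \<alpha> k * cnj (\<alpha> l))" for k l
    using M(1)[of "k + l"] by (intro integrable_mult_left integrable_of_real) auto
  have "complex_of_real (t (k + l)) * \<alpha> k * cnj (\<alpha> l) = (LINT s|M. complex_of_real (s ^ (k + l)) * \<alpha> k * cnj (\<alpha> l))" for k l
    by (simp only: M(2) integral_complex_of_real[symmetric] integral_mult_left_zero)
  then have "(\<Sum>k\<le>n. \<Sum>l\<le>n. complex_of_real (t (k + l)) * \<alpha> k * cnj (\<alpha> l))
      = (LINT s|M. (\<Sum>k\<le>n. \<Sum>l\<le>n. complex_of_real (s ^ (k + l)) * \<alpha> k * cnj (\<alpha> l)))"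
    by (simp only: Bochner_Integration.integral_sum int Bochner_Integration.integrable_sum)
  also have "\<dots> = (LINT s|M. complex_of_real ((cmod (\<Sum>k\<le>n. complex_of_real (s ^ k) * \<alpha> k))\<^sup>2))"
  proof (rule Bochner_Integration.integral_cong[OF refl])
    fix s
    have "complex_of_real ((cmod (\<Sum>k\<le>n. complex_of_real (s ^ k) * \<alpha> k))\<^sup>2)
        = (\<Sum>k\<le>n. complex_of_real (s ^ k) * \<alpha> k) * (\<Sum>l\<le>n. complex_of_real (s ^ l) * cnj (\<alpha> l))"
      unfolding complex_norm_square by (simp add: cnj_sum)
    also have "\<dots> = (\<Sum>k\<le>n. \<Sum>l\<le>n. complex_of_real (s ^ (k + l)) * \<alpha> k * cnj (\<alpha> l))"
      by (simp add: sum_product power_add ac_simps)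
    finally show "(\<Sum>k\<le>n. \<Sum>l\<le>n. complex_of_real (s ^ (k + l)) * \<alpha> k * cnj (\<alpha> l))
        = complex_of_real ((cmod (\<Sum>k\<le>n. complex_of_real (s ^ k) * \<alpha> k))\<^sup>2)" by simp
  qed
  also have "\<dots> = complex_of_real (LINT s|M. (cmod (\<Sum>k\<le>n. complex_of_real (s ^ k) * \<alpha> k))\<^sup>2)"
    by (rule integral_complex_of_real)
  also have "\<dots> \<in> \<real>\<^sub>\<ge>\<^sub>0" by (simp add: nonneg_Reals_of_real_iff)
  finally show ?thesis .
qed

section \<open>Weighted shifts on directed trees\<close>

lemma has_sum_sum:
  fixes F :: "'i \<Rightarrow> 'a \<Rightarrow> 'b :: topological_comm_monoid_add"
  assumes "\<And>i. i \<in> I \<Longrightarrow> (F i has_sum s i) A"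
  shows "((\<lambda>v. \<Sum>i\<in>I. F i v) has_sum (\<Sum>i\<in>I. s i)) A"
  using assms by (induction I rule: infinite_finite_induct) (auto intro: has_sum_add has_sum_0)

lemma has_sum_sum_list:
  fixes F :: "'i \<Rightarrow> 'a \<Rightarrow> 'b :: topological_comm_monoid_add"
  assumes "\<And>i. i \<in> set is \<Longrightarrow> (F i has_sum s i) A"
  shows "((\<lambda>v. \<Sum>i\<leftarrow>is. F i v) has_sum (\<Sum>i\<leftarrow>is. s i)) A"
  using assms by (induction "is") (auto intro: has_sum_add has_sum_0)

lemma has_sum_mf:
  fixes F :: "nat \<Rightarrow> 'a \<Rightarrow> 'b :: real_normed_vector"
  assumes "\<And>n. (F n has_sum t n) A"
  shows "((\<lambda>v. mf (\<lambda>n. F n v) P) has_sum mf t P) A"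
  unfolding mf_def by (intro has_sum_sum has_sum_scaleR assms)

lemma mf_of_real_mult:
  fixes z :: complex
  shows "mf (\<lambda>n. complex_of_real (t n) * z) P = complex_of_real (mf t P) * z"
  by (simp add: mf_def scaleR_conv_of_real sum_distrib_right mult.assoc)

lemma mf_of_real: "mf (\<lambda>n. complex_of_real (t n)) P = complex_of_real (mf t P)"
  using mf_of_real_mult[of t 1 P] by simp

lemma mf_sum_list: "mf t (\<Sum>a\<leftarrow>xs. f a) = (\<Sum>a\<leftarrow>xs. mf t (f a))"
  by (induction xs) (auto simp: mf_add)

lemma mf_monom_scale: "mf t (monom a k * P) = a *\<^sub>R mf t (monom 1 k * P)"
proof -
  have "monom a k * P = smult a (monom 1 k * P)" by (simp add: smult_monom flip: mult_smult_left)
  then show ?thesis by (simp only: mf_smult)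
qed

lemma mf_mult:
  fixes t :: "nat \<Rightarrow> real"
  shows "mf t (p * q) = (\<Sum>k\<le>degree p. \<Sum>l\<le>degree q. coeff p k * coeff q l * t (k + l))"
proof -
  have "p * q = (\<Sum>k\<le>degree p. \<Sum>l\<le>degree q. monom (coeff p k) k * monom (coeff q l) l)"
    by (subst (1) poly_as_sum_of_monoms[symmetric], subst (1) poly_as_sum_of_monoms[of q, symmetric])
      (rule sum_product)
  moreover have "mf t (monom a k * monom b l) = a * b * t (k + l)" for a b k l
    using mf_monom_scale[of t "a * b" "k + l" 1] by (simp add: mult_monom mf_monom)
  ultimately show ?thesis by (simp only: mf_sum)
qed

lemma sum_list_product:
  fixes f g :: "'i \<Rightarrow> 'b :: semiring_0"
  shows "(\<Sum>i\<leftarrow>xs. f i) * (\<Sum>j\<leftarrow>ys. g j) = (\<Sum>i\<leftarrow>xs. \<Sum>j\<leftarrow>ys. f i * g j)"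
  by (simp add: sum_list_const_mult sum_list_mult_const)

text \<open>Embry's condition at one vertex. With F the polynomial whose monomials have coefficients
  \<open>snd p\<close> and exponents \<open>fst p\<close>, the sum is the functional at |F|^2 P. On
  real arguments |F|^2 = R^2 + I^2, where \<open>R\<close> and \<open>I\<close> collect real and
  imaginary parts, so only real polynomials nonnegative on [0, c] are involved.\<close>

lemma pos_mf_quadratic:
  fixes t :: "nat \<Rightarrow> real" and zs :: "(nat \<times> complex) list"
  assumes t: "\<And>Q. (\<And>x. \<lbrakk>0 \<le> x; x \<le> c\<rbrakk> \<Longrightarrow> 0 \<le> poly Q x) \<Longrightarrow> 0 \<le> mf t Q"
    and P: "\<And>x. \<lbrakk>0 \<le> x; x \<le> c\<rbrakk> \<Longrightarrow> 0 \<le> poly P x"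
  shows "0 \<le> Re (\<Sum>p\<leftarrow>zs. \<Sum>q\<leftarrow>zs. complex_of_real (mf t (monom 1 (fst p + fst q) * P)) * (snd p * cnj (snd q)))"
proof -
  define R where "R = (\<Sum>p\<leftarrow>zs. monom (Re (snd p)) (fst p))"
  define I where "I = (\<Sum>p\<leftarrow>zs. monom (Im (snd p)) (fst p))"
  have mul: "(\<Sum>p\<leftarrow>zs. a p) * (\<Sum>p\<leftarrow>zs. a p) * P = (\<Sum>p\<leftarrow>zs. \<Sum>q\<leftarrow>zs. a p * a q * P)"
    for a :: "nat \<times> complex \<Rightarrow> real poly"
    by (simp add: sum_list_product sum_list_mult_const)
  have sq: "mf t ((\<Sum>p\<leftarrow>zs. monom (a p) (fst p)) * (\<Sum>p\<leftarrow>zs. monom (a p) (fst p)) * P)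
      = (\<Sum>p\<leftarrow>zs. \<Sum>q\<leftarrow>zs. a p * a q * mf t (monom 1 (fst p + fst q) * P))" for a :: "nat \<times> complex \<Rightarrow> real"
    unfolding mul mf_sum_list mult_monom
    by (subst mf_monom_scale) (simp only: real_scaleR_def)
  have "Re (\<Sum>p\<leftarrow>zs. \<Sum>q\<leftarrow>zs. complex_of_real (mf t (monom 1 (fst p + fst q) * P)) * (snd p * cnj (snd q)))
      = mf t (R * R * P) + mf t (I * I * P)"
    unfolding R_def I_def sq by (simp add: Re_sum_list sum_list_addf[symmetric] algebra_simps)
  moreover have "0 \<le> mf t (R * R * P)" "0 \<le> mf t (I * I * P)"
    using P by (auto intro!: t)
  ultimately show ?thesis by simp
qed

lemma basis_vec_carrier: "u \<in> V \<Longrightarrow> basis_vec u \<in> hcarrier (ell2 V)"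
  unfolding ell2_carrier_iff
proof
  show "(\<lambda>v. (cmod (basis_vec u v))\<^sup>2) summable_on V"
    by (rule finite_nonzero_values_imp_summable_on)
      (rule finite_subset[of _ "{u}"], auto simp: basis_vec_def indicator_def)
qed (auto simp: basis_vec_def indicator_def)

lemma infsum_basis_vec:
  assumes "u \<in> V"
  shows "(\<Sum>\<^sub>\<infinity>v\<in>V. a v * (basis_vec u v * cnj (basis_vec u v))) = a u"
proof -
  have "(\<Sum>\<^sub>\<infinity>v\<in>V. a v * (basis_vec u v * cnj (basis_vec u v)))
      = (\<Sum>\<^sub>\<infinity>v\<in>{u}. a v * (basis_vec u v * cnj (basis_vec u v)))"
    using assms by (intro infsum_cong_neutral) (auto simp: basis_vec_def indicator_def)
  then show ?thesis by (simp add: basis_vec_def)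
qed

section \<open>Moments at the vertices\<close>

locale bounded_wshift =
  fixes V :: "'v set" and E :: "('v \<times> 'v) set" and w :: "'v \<Rightarrow> complex"
  assumes tree: "directed_tree V E"
    and bounded: "bounded_op (ell2 V) (wshift V E w)"
begin

interpretation complex_hilbert_space "ell2 V" by (rule ell2_hilbert)

abbreviation S where "S \<equiv> wshift V E w"

definition moment :: "nat \<Rightarrow> 'v \<Rightarrow> real" where
  "moment n u = (hnorm (ell2 V) ((S ^^ n) (basis_vec u)))\<^sup>2"

lemma edge:
  assumes "(u, v) \<in> E"
  shows "u \<in> V" "v \<in> V" "u \<noteq> v" "v \<in> nonroots V E" "parent E v = u"
proof -
  show uv: "u \<in> V" "v \<in> V" "u \<noteq> v" using tree assms by (auto simp: directed_tree_def)
  have "\<not> is_root V E v" using assms by (auto simp: is_root_def)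
  then show "v \<in> nonroots V E" using uv by (simp add: nonroots_def)
  have "\<exists>!u. (u, v) \<in> E"
    using tree uv \<open>\<not> is_root V E v\<close> unfolding directed_tree_def by blast
  then show "parent E v = u" unfolding parent_def using assms by (rule the1_equality)
qed

lemma nonroot_edge: "v \<in> nonroots V E \<Longrightarrow> (parent E v, v) \<in> E"
  using edge(5) by (auto simp: nonroots_def is_root_def)

lemma S_edge: "(p, v) \<in> E \<Longrightarrow> S f v = w v * f p"
  using edge by (simp add: wshift_def)

lemma lin: "linear_map (ell2 V) (ell2 V) (S ^^ n)"
  using bounded by (simp add: linear_map_pow bounded_op_def)

lemma pow_closed: "f \<in> hcarrier (ell2 V) \<Longrightarrow> (S ^^ n) f \<in> hcarrier (ell2 V)"
  using lin[of n] by (simp add: linear_map_def)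

lemma S_closed: "f \<in> hcarrier (ell2 V) \<Longrightarrow> S f \<in> hcarrier (ell2 V)"
  using pow_closed[of f 1] by simp

text \<open>Every vertex with a parent is a child of exactly one vertex, so the sum can be regrouped
  by parents, and \<open>S f\<close>, \<open>S g\<close> depend on \<open>f\<close>,
  \<open>g\<close> only through the value at the parent. This is why no products of values at
  different vertices appear.\<close>

lemma infsum_shift:
  assumes "(\<lambda>v. a v * (S f v * cnj (S g v))) summable_on V"
  shows "(\<Sum>\<^sub>\<infinity>v\<in>V. a v * (S f v * cnj (S g v)))
    = (\<Sum>\<^sub>\<infinity>p\<in>V. (\<Sum>\<^sub>\<infinity>v\<in>chi E p. a v * (w v * cnj (w v))) * (f p * cnj (g p)))"
proof -
  define F where "F = (\<lambda>v. a v * (S f v * cnj (S g v)))"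
  have bij: "bij_betw snd (Sigma V (chi E)) (nonroots V E)"
    by (rule bij_betwI[where g = "\<lambda>v. (parent E v, v)"])
      (auto simp: chi_def edge nonroot_edge intro: edge(1)[OF nonroot_edge])
  have sub: "nonroots V E \<subseteq> V" by (auto simp: nonroots_def)
  have "F summable_on nonroots V E"
    using assms sub unfolding F_def by (rule summable_on_subset_banach)
  then have sum: "(\<lambda>q. F (snd q)) summable_on Sigma V (chi E)"
    using summable_on_reindex_bij_betw[OF bij] by blast
  have "infsum F V = infsum F (nonroots V E)"
    by (rule infsum_cong_neutral) (auto simp: F_def wshift_def nonroots_def)
  also have "\<dots> = infsum (\<lambda>q. F (snd q)) (Sigma V (chi E))"
    by (rule infsum_reindex_bij_betw[OF bij, symmetric])
  also have "\<dots> = (\<Sum>\<^sub>\<infinity>p\<in>V. \<Sum>\<^sub>\<infinity>v\<in>chi E p. F v)"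
    using infsum_Sigma_banach[OF sum] by simp
  also have "\<dots> = (\<Sum>\<^sub>\<infinity>p\<in>V. (\<Sum>\<^sub>\<infinity>v\<in>chi E p. a v * (w v * cnj (w v))) * (f p * cnj (g p)))"
  proof (rule infsum_cong)
    fix p
    have "(\<Sum>\<^sub>\<infinity>v\<in>chi E p. F v) = (\<Sum>\<^sub>\<infinity>v\<in>chi E p. (a v * (w v * cnj (w v))) * (f p * cnj (g p)))"
      by (rule infsum_cong) (simp add: F_def chi_def S_edge ac_simps)
    then show "(\<Sum>\<^sub>\<infinity>v\<in>chi E p. F v) = (\<Sum>\<^sub>\<infinity>v\<in>chi E p. a v * (w v * cnj (w v))) * (f p * cnj (g p))"
      by (simp only: infsum_cmult_left')
  qed
  finally show ?thesis unfolding F_def .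
qed

text \<open>One constant serves all vertices because the basis vectors have norm 1; positivity on a
  common interval can then be summed over \<open>V\<close>.\<close>

lemma moment_growth:
  obtains c where "c > 0" "\<And>n u. u \<in> V \<Longrightarrow> moment n u \<le> c ^ n"
proof -
  obtain C where C: "C \<ge> 1" "\<And>n x. x \<in> hcarrier (ell2 V) \<Longrightarrow> hnorm (ell2 V) ((S ^^ n) x) \<le> C ^ n * hnorm (ell2 V) x"
    using bounded_op_powE[OF bounded] by blast
  have "moment n u \<le> (C\<^sup>2) ^ n" if u: "u \<in> V" for n u
  proof -
    have "(hnorm (ell2 V) (basis_vec u))\<^sup>2 = 1"
      using infsum_basis_vec[OF u, of "\<lambda>_. 1"] inner_self[OF basis_vec_carrier[OF u]]
      by (simp flip: of_real_power)
    then have 1: "hnorm (ell2 V) (basis_vec u) = 1"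
      using hnorm_nonneg[OF basis_vec_carrier[OF u]] by (simp add: power2_eq_1_iff)
    have "moment n u \<le> (C ^ n)\<^sup>2"
      unfolding moment_def using C(2)[OF basis_vec_carrier[OF u], of n]
        hnorm_nonneg[OF pow_closed[OF basis_vec_carrier[OF u]]] by (intro power_mono) (simp_all add: 1)
    then show ?thesis by (simp add: power_mult[symmetric] mult.commute)
  qed
  then show thesis using that[of "C\<^sup>2"] C(1) by simp
qed

lemma moment_inner: "u \<in> V \<Longrightarrow> complex_of_real (moment n u)
    = hinner (ell2 V) ((S ^^ n) (basis_vec u)) ((S ^^ n) (basis_vec u))"
  unfolding moment_def by (rule inner_self[symmetric]) (intro pow_closed basis_vec_carrier)

lemma summable_moment:
  assumes "f \<in> hcarrier (ell2 V)" "g \<in> hcarrier (ell2 V)"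
  shows "(\<lambda>v. complex_of_real (moment n v) * (f v * cnj (g v))) summable_on V"
proof -
  obtain c where c: "c > 0" "\<And>n u. u \<in> V \<Longrightarrow> moment n u \<le> c ^ n" using moment_growth by blast
  have "(\<lambda>v. norm (complex_of_real (moment n v) * (f v * cnj (g v)))) summable_on V"
  proof (rule Infinite_Sum.abs_summable_on_comparison_test')
    show "(\<lambda>v. c ^ n * norm (f v * cnj (g v))) summable_on V"
      by (intro summable_on_cmult_right ell2_abs_summable_mult assms)
    have "0 \<le> moment n v" for v by (simp add: moment_def)
    then show "norm (complex_of_real (moment n v) * (f v * cnj (g v))) \<le> c ^ n * norm (f v * cnj (g v))"
      if "v \<in> V" for v
      using c(2)[OF that, of n] unfolding norm_mult by (intro mult_right_mono) auto
  qed
  then show ?thesis by (rule abs_summable_summable)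
qed

text \<open>On a directed tree \<open>S\<^sup>*\<^sup>n S\<^sup>n\<close> is diagonal.\<close>

lemma inner_pow:
  assumes "f \<in> hcarrier (ell2 V)" "g \<in> hcarrier (ell2 V)"
  shows "hinner (ell2 V) ((S ^^ n) f) ((S ^^ n) g)
    = (\<Sum>\<^sub>\<infinity>v\<in>V. complex_of_real (moment n v) * (f v * cnj (g v)))"
  using assms
proof (induction n arbitrary: f g)
  case 0
  have "moment 0 v = 1" if "v \<in> V" for v
    using moment_inner[OF that, of 0] infsum_basis_vec[OF that, of "\<lambda>_. 1"] by simp
  then show ?case by (simp cong: infsum_cong)
next
  case (Suc n)
  define W where "W p = (\<Sum>\<^sub>\<infinity>v\<in>chi E p. complex_of_real (moment n v) * (w v * cnj (w v)))" for p
  have step: "hinner (ell2 V) ((S ^^ Suc n) f) ((S ^^ Suc n) g) = (\<Sum>\<^sub>\<infinity>p\<in>V. W p * (f p * cnj (g p)))"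
    if f: "f \<in> hcarrier (ell2 V)" and g: "g \<in> hcarrier (ell2 V)" for f g
  proof -
    have "hinner (ell2 V) ((S ^^ Suc n) f) ((S ^^ Suc n) g)
        = (\<Sum>\<^sub>\<infinity>v\<in>V. complex_of_real (moment n v) * (S f v * cnj (S g v)))"
      unfolding funpow_Suc_right o_apply by (intro Suc.IH S_closed f g)
    also have "\<dots> = (\<Sum>\<^sub>\<infinity>p\<in>V. W p * (f p * cnj (g p)))"
      unfolding W_def by (intro infsum_shift summable_moment S_closed f g)
    finally show ?thesis .
  qed
  \<comment> \<open>Testing the diagonal form on the basis vector at \<open>p\<close> identifies its
    entry there with the next moment.\<close>
  have "complex_of_real (moment (Suc n) p) = W p" if "p \<in> V" for p
    unfolding moment_inner[OF that] step[OF basis_vec_carrier[OF that] basis_vec_carrier[OF that]]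
    by (rule infsum_basis_vec[OF that])
  then have "(\<Sum>\<^sub>\<infinity>p\<in>V. W p * (f p * cnj (g p))) = (\<Sum>\<^sub>\<infinity>p\<in>V. complex_of_real (moment (Suc n) p) * (f p * cnj (g p)))"
    by (intro infsum_cong) simp
  then show ?case using step[OF Suc.prems] by simp
qed

lemma has_sum_mf_inner:
  assumes "f \<in> hcarrier (ell2 V)" "g \<in> hcarrier (ell2 V)"
  shows "((\<lambda>v. complex_of_real (mf (\<lambda>n. moment n v) P) * (f v * cnj (g v)))
    has_sum mf (\<lambda>n. hinner (ell2 V) ((S ^^ n) f) ((S ^^ n) g)) P) V"
  unfolding mf_of_real_mult[symmetric] inner_pow[OF assms]
  by (intro has_sum_mf has_sum_infsum summable_moment assms)

text \<open>By diagonality the Embry form is a convergent sum over the vertices \<open>v\<close> of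
  scalar forms whose coefficients are the values of the vectors at \<open>v\<close>, so it is
  nonnegative term by term.\<close>

theorem subnormal_if_moments:
  assumes c: "c > 0"
    and pos: "\<And>v P. \<lbrakk>v \<in> V; \<And>x. \<lbrakk>0 \<le> x; x \<le> c\<rbrakk> \<Longrightarrow> 0 \<le> poly P x\<rbrakk> \<Longrightarrow> 0 \<le> mf (\<lambda>n. moment n v) P"
  shows "subnormal (ell2 V) S"
proof (rule subnormal_if_embry[OF bounded c])
  fix zs :: "(nat \<times> ('v \<Rightarrow> complex)) list" and P :: "real poly"
  assume zs: "set zs \<subseteq> UNIV \<times> hcarrier (ell2 V)" and P: "\<And>x. \<lbrakk>0 \<le> x; x \<le> c\<rbrakk> \<Longrightarrow> 0 \<le> poly P x"
  let ?L = "\<lambda>v Q. mf (\<lambda>n. moment n v) Q"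
  have zsc: "snd p \<in> hcarrier (ell2 V)" if "p \<in> set zs" for p using zs that by auto
  have "((\<lambda>v. \<Sum>p\<leftarrow>zs. \<Sum>q\<leftarrow>zs. complex_of_real (?L v (monom 1 (fst p + fst q) * P)) * (snd p v * cnj (snd q v)))
    has_sum (\<Sum>p\<leftarrow>zs. \<Sum>q\<leftarrow>zs. mf (\<lambda>n. hinner (ell2 V) ((S ^^ n) (snd p)) ((S ^^ n) (snd q)))
        (monom 1 (fst p + fst q) * P))) V"
    by (intro has_sum_sum_list has_sum_mf_inner zsc)
  from has_sum_Re[OF this]
  show "0 \<le> Re (\<Sum>p\<leftarrow>zs. \<Sum>q\<leftarrow>zs. mf (\<lambda>n. hinner (ell2 V) ((S ^^ n) (snd p)) ((S ^^ n) (snd q)))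
        (monom 1 (fst p + fst q) * P))"
  proof (rule has_sum_nonneg)
    fix v assume v: "v \<in> V"
    show "0 \<le> Re (\<Sum>p\<leftarrow>zs. \<Sum>q\<leftarrow>zs. complex_of_real (?L v (monom 1 (fst p + fst q) * P)) * (snd p v * cnj (snd q v)))"
      using pos_mf_quadratic[of c "\<lambda>n. moment n v" P "map (\<lambda>p. (fst p, snd p v)) zs"] pos[OF v] P
      by (simp add: o_def)
  qed
qed

theorem moment_measure:
  assumes hankel: "\<And>u n (\<alpha> :: nat \<Rightarrow> complex). u \<in> V \<Longrightarrow>
      (\<Sum>k\<le>n. \<Sum>l\<le>n. complex_of_real (moment (k + l) u) * \<alpha> k * cnj (\<alpha> l)) \<in> \<real>\<^sub>\<ge>\<^sub>0"
  shows "\<exists>c>0. \<forall>u\<in>V.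
    \<exists>M. real_distribution M \<and> (AE x in M. 0 \<le> x \<and> x \<le> c) \<and> (\<forall>n. moment n u = (LINT x|M. x ^ n))"
proof -
  obtain c where c: "c > 0" "\<And>n u. u \<in> V \<Longrightarrow> moment n u \<le> c ^ n" using moment_growth by blast
  have pos: "0 \<le> mf (\<lambda>n. moment n u) (p * p)" if "u \<in> V" for u p
  proof -
    have "complex_of_real (mf (\<lambda>n. moment n u) (p * p))
      = (\<Sum>k\<le>degree p. \<Sum>l\<le>degree p. complex_of_real (moment (k + l) u) * coeff p k * cnj (complex_of_real (coeff p l)))"
      by (simp add: mf_mult ac_simps)
    also have "\<dots> \<in> \<real>\<^sub>\<ge>\<^sub>0" using hankel[OF that, of "\<lambda>k. complex_of_real (coeff p k)" "degree p"] by simp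
    finally show ?thesis by (simp add: nonneg_Reals_of_real_iff)
  qed
  \<comment> \<open>The shifted moments of \<open>u\<close> are the moments of the vector
    \<open>S (basis_vec u)\<close>. By \<open>has_sum_mf_inner\<close> their functional is a sum of
    vertex functionals with nonnegative weights, so \<open>pos\<close> at the other vertices gives
    the claim.\<close>
  have pos1: "0 \<le> mf (\<lambda>n. moment n u) (monom 1 1 * (p * p))" if u: "u \<in> V" for u p
  proof -
    note e = basis_vec_carrier[OF u]
    have "complex_of_real (mf (\<lambda>n. moment n u) (monom 1 1 * (p * p)))
        = mf (\<lambda>n. complex_of_real (moment (Suc n) u)) (p * p)"
      by (simp only: mf_monom_mult mf_of_real[symmetric]) simp
    also have "\<dots> = mf (\<lambda>n. hinner (ell2 V) ((S ^^ n) (S (basis_vec u))) ((S ^^ n) (S (basis_vec u)))) (p * p)"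
      unfolding moment_inner[OF u] funpow_Suc_right o_apply ..
    finally have "((\<lambda>v. complex_of_real (mf (\<lambda>n. moment n v) (p * p)) * (S (basis_vec u) v * cnj (S (basis_vec u) v)))
        has_sum complex_of_real (mf (\<lambda>n. moment n u) (monom 1 1 * (p * p)))) V"
      using has_sum_mf_inner[OF S_closed[OF e] S_closed[OF e]] by simp
    from has_sum_Re[OF this] have "0 \<le> Re (complex_of_real (mf (\<lambda>n. moment n u) (monom 1 1 * (p * p))))"
    proof (rule has_sum_nonneg)
      fix v assume v: "v \<in> V"
      show "0 \<le> Re (complex_of_real (mf (\<lambda>n. moment n v) (p * p)) * (S (basis_vec u) v * cnj (S (basis_vec u) v)))"
        using pos[OF v] by (simp flip: complex_norm_square of_real_power of_real_mult)
    qed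
    then show ?thesis by simp
  qed
  have "\<exists>M. real_distribution M \<and> (AE x in M. 0 \<le> x \<and> x \<le> c) \<and> (\<forall>n. moment n u = (LINT x|M. x ^ n))"
    if u: "u \<in> V" for u
  proof (rule stieltjes_moment_problem_bounded[where t = "\<lambda>n. moment n u" and K = 1, OF c(1)])
    show "moment 0 u = 1"
      using moment_inner[OF u, of 0] infsum_basis_vec[OF u, of "\<lambda>_. 1"] by simp
  qed (use c(2)[OF u] pos[OF u] pos1[OF u] in auto)
  then show ?thesis using c(1) by blast
qed

section \<open>Generations of descendants and path weights\<close>

lemma chi_pow_Suc_iff: "v \<in> chi_pow E (Suc n) u \<longleftrightarrow> v \<in> nonroots V E \<and> parent E v \<in> chi_pow E n u"
  using edge nonroot_edge by (fastforce simp: chi_def)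

lemma chi_pow_parent: "v \<in> chi_pow E (a + b) u \<Longrightarrow> (parent E ^^ b) v \<in> chi_pow E a u"
proof (induction b arbitrary: v)
  case (Suc b)
  then have "parent E v \<in> chi_pow E (a + b) u" using chi_pow_Suc_iff[of v "a + b" u] by simp
  from Suc.IH[OF this] show ?case by (simp add: funpow_swap1)
qed simp

lemma chi_pow_of_edges:
  "(\<And>i. i < m \<Longrightarrow> (parent E ^^ i) x \<in> nonroots V E) \<Longrightarrow> x \<in> chi_pow E m ((parent E ^^ m) x)"
proof (induction m arbitrary: x)
  case (Suc m)
  have "(parent E ^^ i) (parent E x) \<in> nonroots V E" if "i < m" for i
    using Suc.prems[of "Suc i"] that by (simp add: funpow_swap1)
  then have "parent E x \<in> chi_pow E m ((parent E ^^ m) (parent E x))" by (rule Suc.IH)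
  then show ?case using Suc.prems[of 0] unfolding chi_pow_Suc_iff by (simp add: funpow_swap1)
qed simp

text \<open>Going back along parents gives a closed walk of length \<open>k\<close>, but only
  circuits with distinct vertices are excluded from a tree. Strong induction supplies distinctness:
  a repetition would make \<open>u\<close> its own descendant in fewer steps. Length 1 is ruled out
  separately, as circuits have at least two vertices.\<close>

lemma not_in_chi_pow_self: "k > 0 \<Longrightarrow> u \<notin> chi_pow E k u"
proof (induction k rule: less_induct)
  case (less k)
  show ?case
  proof
    assume u: "u \<in> chi_pow E k u"
    have anc: "(parent E ^^ i) u \<in> nonroots V E" if "i < k" for i
      using chi_pow_parent[of u "Suc (k - Suc i)" i u] u that chi_pow_Suc_iff by simp
    have cyc: "(parent E ^^ k) u = u" using chi_pow_parent[of u 0 k u] u by simp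
    have "k \<noteq> 1" using u edge(3)[of u u] by (auto simp: chi_def)
    then have k: "k \<ge> 2" using less.prems by simp
    \<comment> \<open>Reversed because edges run from parent to child: the list ends in
      \<open>u\<close> and starts with the ancestor whose parent is \<open>u\<close> again.\<close>
    define us where "us = map (\<lambda>i. (parent E ^^ i) u) (rev [0..<k])"
    have len: "length us = k" by (simp add: us_def)
    have nth: "us ! j = (parent E ^^ (k - Suc j)) u" if "j < k" for j
      using that by (simp add: us_def rev_nth)
    have "(parent E ^^ i) u \<noteq> (parent E ^^ j) u" if ij: "i < j" "j < k" for i j
    proof
      assume eq: "(parent E ^^ i) u = (parent E ^^ j) u"
      \<comment> \<open>The length of the closed walk after cutting out the stretch between the two
        equal ancestors.\<close>
      define m where "m = k - j + i"
      have m: "0 < m" "m < k" using ij by (auto simp: m_def)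
      have "(parent E ^^ m) u = (parent E ^^ (k - j)) ((parent E ^^ j) u)"
        by (simp only: m_def funpow_add o_apply eq)
      also have "\<dots> = (parent E ^^ (k - j + j)) u" by (simp only: funpow_add o_apply)
      also have "\<dots> = u" using ij cyc by simp
      finally have "u \<in> chi_pow E m u" using chi_pow_of_edges[of m u] anc m by simp
      then show False using less.IH[OF m(2,1)] by simp
    qed
    then have "distinct us"
      unfolding us_def distinct_map by (auto intro!: inj_onI) (metis linorder_neqE_nat)
    moreover have "(us ! j, us ! Suc j) \<in> E" if "Suc j < length us" for j
    proof -
      have "k - Suc j = Suc (k - Suc (Suc j))" using that len by simp
      then have "us ! j = parent E (us ! Suc j)" using that len by (simp add: nth)
      then show ?thesis using nonroot_edge[OF anc[of "k - Suc (Suc j)"]] nth[of "Suc j"] that len by simp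
    qed
    moreover have "(last us, hd us) \<in> E"
    proof -
      have "us \<noteq> []" using len k by auto
      then have "last us = u" "hd us = (parent E ^^ (k - 1)) u"
        using nth[of "k - 1"] nth[of 0] k by (simp_all add: last_conv_nth hd_conv_nth len)
      moreover have "parent E ((parent E ^^ (k - 1)) u) = u"
        using cyc k by (metis Suc_diff_1 funpow.simps(2) less.prems o_apply)
      ultimately show ?thesis using nonroot_edge[OF anc[of "k - 1"]] k by simp
    qed
    ultimately have "circuit E us" using k len by (simp add: circuit_def)
    then show False using tree by (auto simp: directed_tree_def)
  qed
qed

text \<open>For generations a < b the a-th ancestor of \<open>v\<close> would be \<open>u\<close>
  and also lie in generation b - a of \<open>u\<close>. This justifies the definite description in
  \<open>path_weight\<close>.\<close>

lemma chi_pow_unique: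
  assumes "v \<in> chi_pow E n u" "v \<in> chi_pow E m u"
  shows "n = m"
proof -
  have False if v: "v \<in> chi_pow E a u" "v \<in> chi_pow E b u" and ab: "a < b" for a b
  proof -
    have "(parent E ^^ a) v \<in> chi_pow E (b - a) u" using chi_pow_parent[of v "b - a" a u] v ab by simp
    moreover have "(parent E ^^ a) v = u" using chi_pow_parent[of v 0 a u] v by simp
    ultimately show False using not_in_chi_pow_self[of "b - a" u] ab by simp
  qed
  then show ?thesis using assms by (meson linorder_neqE_nat)
qed

lemma pow_basis_vec:
  "(S ^^ n) (basis_vec u) v = (if v \<in> chi_pow E n u then path_weight E w u v else 0)"
proof -
  have "(S ^^ n) (basis_vec u) v = (if v \<in> chi_pow E n u then \<Prod>j<n. w ((parent E ^^ j) v) else 0)"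
  proof (induction n arbitrary: v)
    case 0
    then show ?case by (simp add: basis_vec_def indicator_def)
  next
    case (Suc n)
    have "(\<Prod>j<Suc n. w ((parent E ^^ j) v)) = w v * (\<Prod>j<n. w ((parent E ^^ j) (parent E v)))"
      by (simp add: prod.lessThan_Suc_shift funpow_swap1 del: prod.lessThan_Suc)
    then show ?case using Suc[of "parent E v"]
      by (simp add: wshift_def chi_pow_Suc_iff del: chi_pow.simps prod.lessThan_Suc)
  qed
  moreover have "(THE n. v \<in> chi_pow E n u) = n" if "v \<in> chi_pow E n u"
    using that chi_pow_unique by blast
  ultimately show ?thesis by (simp add: path_weight_def)
qed

lemma chi_pow_subset: "u \<in> V \<Longrightarrow> chi_pow E n u \<subseteq> V"
  using edge by (cases n) (auto simp: chi_def)

lemma moment_eq_path_weights: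
  assumes "u \<in> V"
  shows "moment n u = (\<Sum>\<^sub>\<infinity>v\<in>chi_pow E n u. (cmod (path_weight E w u v))\<^sup>2)"
  unfolding moment_def ell2_hnorm_sq pow_basis_vec
  by (rule infsum_cong_neutral) (use chi_pow_subset[OF assms, of n] in auto)

end

section \<open>From measures on [0, c] to the equivalences\<close>

lemma represents_moments_bounded:
  assumes M: "real_distribution M" and AE: "AE x in M. 0 \<le> x \<and> x \<le> c"
    and t: "\<And>n. t n = (LINT x|M. x ^ n)"
  shows "represents_moments M t" "emeasure M {..<0} = 0"
proof -
  interpret real_distribution M by (rule M)
  have "integrable M (\<lambda>x. x ^ n)" for n
  proof (rule integrable_const_bound)
    show "AE x in M. norm (x ^ n) \<le> c ^ n"
      using AE by eventually_elim (simp add: power_mono)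
  qed simp
  then show "represents_moments M t" using t by (simp add: represents_moments_def)
  have "AE x in M. \<not> x < 0" using AE by eventually_elim simp
  then have "emeasure M {x \<in> space M. x < 0} = 0" by (subst (asm) AE_iff_measurable[OF _ refl]) auto
  then show "emeasure M {..<0} = 0" by (simp add: lessThan_def)
qed

lemma mf_nonneg_if_moments:
  assumes M: "real_distribution M" and AE: "AE x in M. 0 \<le> x \<and> x \<le> c"
    and t: "\<And>n. t n = (LINT x|M. x ^ n)"
    and P: "\<And>x. \<lbrakk>0 \<le> x; x \<le> c\<rbrakk> \<Longrightarrow> 0 \<le> poly P x"
  shows "0 \<le> mf t P"
proof -
  have int: "integrable M (\<lambda>x. x ^ n)" for n
    using represents_moments_bounded(1)[OF M AE t] by (simp add: represents_moments_def)
  have "(LINT x|M. poly P x) = (\<Sum>i\<le>degree P. LINT x|M. coeff P i * x ^ i)"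
    unfolding poly_altdef by (intro Bochner_Integration.integral_sum integrable_mult_right int)
  then have "mf t P = (LINT x|M. poly P x)" by (simp add: mf_def t)
  also have "\<dots> \<ge> 0"
  proof (rule integral_nonneg_AE)
    show "AE x in M. 0 \<le> poly P x" using AE by eventually_elim (simp add: P)
  qed
  finally show ?thesis .
qed

theorem theorem6p1p3:
  fixes V :: "'v set" and E :: "('v \<times> 'v) set" and w :: "'v \<Rightarrow> complex"
  assumes "directed_tree V E"
    and "wshift_dom V E w = hcarrier (ell2 V)"
    and "bounded_op (ell2 V) (wshift V E w)"
  shows
    "(subnormal (ell2 V) (wshift V E w) \<longleftrightarrow>
        (\<forall>u\<in>V. stieltjes_moment_seq
           (\<lambda>n. \<Sum>\<^sub>\<infinity>v\<in>chi_pow E n u. (cmod (path_weight E w u v))\<^sup>2)))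
   \<and> (subnormal (ell2 V) (wshift V E w) \<longleftrightarrow>
        (\<forall>u\<in>V. stieltjes_moment_seq (\<lambda>n. (hnorm (ell2 V) ((wshift V E w ^^ n) (basis_vec u)))\<^sup>2)))
   \<and> (subnormal (ell2 V) (wshift V E w) \<longleftrightarrow>
        (\<forall>u\<in>V. hamburger_moment_seq (\<lambda>n. (hnorm (ell2 V) ((wshift V E w ^^ n) (basis_vec u)))\<^sup>2)))
   \<and> (subnormal (ell2 V) (wshift V E w) \<longleftrightarrow>
        (\<forall>u\<in>V. \<forall>n. \<forall>\<alpha> :: nat \<Rightarrow> complex.
           (\<Sum>k\<le>n. \<Sum>l\<le>n. complex_of_real ((hnorm (ell2 V) ((wshift V E w ^^ (k + l)) (basis_vec u)))\<^sup>2)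
              * \<alpha> k * cnj (\<alpha> l)) \<in> \<real>\<^sub>\<ge>\<^sub>0))"
proof -
  interpret bounded_wshift V E w by (unfold_locales) (use assms in auto)
  interpret complex_hilbert_space "ell2 V" by (rule ell2_hilbert)
  let ?i = "subnormal (ell2 V) S"
  let ?iii = "\<forall>u\<in>V. stieltjes_moment_seq (\<lambda>n. moment n u)"
  let ?iv = "\<forall>u\<in>V. hamburger_moment_seq (\<lambda>n. moment n u)"
  let ?v = "\<forall>u\<in>V. \<forall>n. \<forall>\<alpha> :: nat \<Rightarrow> complex.
    (\<Sum>k\<le>n. \<Sum>l\<le>n. complex_of_real (moment (k + l) u) * \<alpha> k * cnj (\<alpha> l)) \<in> \<real>\<^sub>\<ge>\<^sub>0"
  have i_v: "?i \<Longrightarrow> ?v"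
    unfolding moment_def by (intro ballI allI subnormal_imp_hankel_nonneg basis_vec_carrier)
  \<comment> \<open>The same measures on [0, c] give both (i) and (iii); from (iii) the circle
    closes through (iv) back to (v), and (ii) is (iii) with the norms written out by path
    weights.\<close>
  have v_i: ?i and v_iii: ?iii if v: ?v
  proof -
    have hankel: "(\<Sum>k\<le>n. \<Sum>l\<le>n. complex_of_real (moment (k + l) u) * \<alpha> k * cnj (\<alpha> l)) \<in> \<real>\<^sub>\<ge>\<^sub>0"
      if "u \<in> V" for u n and \<alpha> :: "nat \<Rightarrow> complex" using v that by blast
    obtain c where c: "c > 0" and ex: "\<And>u. u \<in> V \<Longrightarrow>
        \<exists>M. real_distribution M \<and> (AE x in M. 0 \<le> x \<and> x \<le> c) \<and> (\<forall>n. moment n u = (LINT x|M. x ^ n))"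
      using moment_measure[OF hankel] by blast
    show ?i
    proof (rule subnormal_if_moments[OF c])
      fix u :: 'v and P :: "real poly"
      assume u: "u \<in> V" and P: "\<And>x. \<lbrakk>0 \<le> x; x \<le> c\<rbrakk> \<Longrightarrow> 0 \<le> poly P x"
      obtain M where M: "real_distribution M" "AE x in M. 0 \<le> x \<and> x \<le> c" "\<forall>n. moment n u = (LINT x|M. x ^ n)"
        using ex[OF u] by blast
      show "0 \<le> mf (\<lambda>n. moment n u) P" by (rule mf_nonneg_if_moments[OF M(1,2) spec[OF M(3)] P])
    qed
    show ?iii
    proof
      fix u assume "u \<in> V"
      then obtain M where M: "real_distribution M" "AE x in M. 0 \<le> x \<and> x \<le> c" "\<forall>n. moment n u = (LINT x|M. x ^ n)"
        using ex by blast
      show "stieltjes_moment_seq (\<lambda>n. moment n u)"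
        unfolding stieltjes_moment_seq_def
        using represents_moments_bounded[OF M(1,2) spec[OF M(3)]] by blast
    qed
  qed
  have iii_iv: "?iii \<Longrightarrow> ?iv" by (auto simp: stieltjes_moment_seq_def hamburger_moment_seq_def)
  have iv_v: "?iv \<Longrightarrow> ?v" by (intro ballI allI hamburger_imp_hankel_nonneg) blast
  have "?iii \<longleftrightarrow> (\<forall>u\<in>V. stieltjes_moment_seq (\<lambda>n. \<Sum>\<^sub>\<infinity>v\<in>chi_pow E n u. (cmod (path_weight E w u v))\<^sup>2))"
    by (intro ball_cong refl) (simp add: moment_eq_path_weights)
  then show ?thesis
    using i_v v_i v_iii iii_iv iv_v unfolding moment_def by argo
qed

end
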